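(* Every holonomic biharmonic hypersurface $\Sigma^n$ of $\mathbb{E}^{n+1}$ is minimal.
   Context: All hypersurfaces are smooth. For a hypersurface $\Sigma^n\subset\mathbb{E}^{n+1}$ (Euclidean space) with unit normal field $N$, let $D$ be the flat connection of $\mathbb{E}^{n+1}$. The shape operator $A$ is $AX=-D_XN$, and the mean curvature function $h$ is defined by $nh=\operatorname{Tr}A$; $H=hN$ is the mean curvature vector field. $\Delta$ denotes the Laplacian of the induced metric, applied componentwise to $\mathbb{E}^{n+1}$-valued functions. One works on open sets where the multiplicities of the distinct principal curvatures are constant. $\Sigma^n$ is biharmonic (BHH) if $\Delta H=0$ (equivalently $\Delta^2X=0$ for the position vector $X$), i.e. both $2D_{\nabla h}N-nh\nabla h=0$ and $\Delta h-|A|^2h=0$. It is minimal if $h\equiv 0$. A hypersurface is holonomic if the principal curvature directions define an integrable net: near each point there are local coordinates $(x_1,\dots,x_n)$ in which the coordinate lines are orthogonal lines of curvature, i.e. the first and second fundamental forms are both diagonal. *)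

theory Defs
  imports "HOL-Analysis.Analysis"
begin

text \<open>
  Meaningful for open sets in finite-dimensional spaces: derivatives are two-sided, and continuity
  of the derivative is required direction by direction.
\<close>

fun C_k_on :: "nat \<Rightarrow> ('a::real_normed_vector) set \<Rightarrow> ('a \<Rightarrow> 'b::real_normed_vector) \<Rightarrow> bool" where
  "C_k_on 0 U f \<longleftrightarrow> continuous_on U f"
| "C_k_on (Suc k) U f \<longleftrightarrow>
     (\<forall>x\<in>U. f differentiable (at x)) \<and> (\<forall>v. C_k_on k U (\<lambda>x. frechet_derivative f (at x) v))"

definition smooth_on :: "('a::euclidean_space) set \<Rightarrow> ('a \<Rightarrow> 'b::real_normed_vector) \<Rightarrow> bool" where
  "smooth_on U f \<longleftrightarrow> (\<forall>k. C_k_on k U f)"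

definition pd :: "'n::finite \<Rightarrow> (real^'n \<Rightarrow> 'b::real_normed_vector) \<Rightarrow> real^'n \<Rightarrow> 'b" where
  "pd i f x = frechet_derivative f (at x) (axis i 1)"


text \<open>
  Immersed hypersurfaces. A hypersurface is a topological space \<open>M\<close> (a subspace of some Hausdorff,
  second countable type) with a map \<open>F\<close> into a Euclidean space that is, locally on \<open>M\<close>, a smooth
  immersion in suitable charts. No atlas has to be recorded: two parametrisations in the sense of
  \<open>local_param\<close> always have smooth transition maps, because both become immersions after composing
  with \<open>F\<close>. Embedded hypersurfaces are the case \<open>F = (\<lambda>x. x)\<close>.
\<close>

definition local_param ::
  "('m::topological_space) set \<Rightarrow> ('m \<Rightarrow> 'e::euclidean_space) \<Rightarrow> (real^'n) set \<Rightarrow> (real^'n \<Rightarrow> 'm) \<Rightarrow> bool"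
where
  "local_param M F U \<phi> \<longleftrightarrow>
     open U \<and> openin (top_of_set M) (\<phi> ` U) \<and> (\<exists>\<psi>. homeomorphism U (\<phi> ` U) \<phi> \<psi>) \<and>
     smooth_on U (F \<circ> \<phi>) \<and> (\<forall>p\<in>U. inj (frechet_derivative (F \<circ> \<phi>) (at p)))"

definition hypersurface ::
  "'n::finite itself \<Rightarrow> ('m::{t2_space,second_countable_topology}) set \<Rightarrow> ('m \<Rightarrow> 'e::euclidean_space) \<Rightarrow> bool"
where
  "hypersurface _ M F \<longleftrightarrow>
     DIM('e) = CARD('n) + 1 \<and>
     (\<forall>m\<in>M. \<exists>(U :: (real^'n) set) \<phi>. local_param M F U \<phi> \<and> m \<in> \<phi> ` U)"


text \<open>
  Local geometry of a parametrisation \<open>X\<close> (in use, \<open>X = F \<circ> \<phi>\<close>) with unit normal field \<open>N\<close>,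
  expressed in the coordinates of the parameter domain.
\<close>

definition unit_normal_on ::
  "(real^'n) set \<Rightarrow> (real^'n \<Rightarrow> 'e::euclidean_space) \<Rightarrow> (real^'n \<Rightarrow> 'e) \<Rightarrow> bool"
where
  "unit_normal_on U X N \<longleftrightarrow>
     smooth_on U N \<and>
     (\<forall>p\<in>U. norm (N p) = 1 \<and> (\<forall>v. N p \<bullet> frechet_derivative X (at p) v = 0))"

definition first_form ::
  "(real^'n \<Rightarrow> 'e::euclidean_space) \<Rightarrow> real^'n \<Rightarrow> real^'n^'n"
where
  "first_form X p = (\<chi> i j. pd i X p \<bullet> pd j X p)"

text \<open>
  The shape operator \<open>A w = - D\<^sub>w N\<close>, pulled back along the injective differential of \<open>X\<close> to an
  endomorphism of the coordinate space.
\<close>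

definition shape_operator ::
  "(real^'n \<Rightarrow> 'e::euclidean_space) \<Rightarrow> (real^'n \<Rightarrow> 'e) \<Rightarrow> real^'n \<Rightarrow> real^'n \<Rightarrow> real^'n"
where
  "shape_operator X N p v =
     (THE w. frechet_derivative X (at p) w = - frechet_derivative N (at p) v)"

definition second_form ::
  "(real^'n \<Rightarrow> 'e::euclidean_space) \<Rightarrow> (real^'n \<Rightarrow> 'e) \<Rightarrow> real^'n \<Rightarrow> real^'n^'n"
where
  "second_form X N p =
     (\<chi> i j. frechet_derivative X (at p) (shape_operator X N p (axis i 1)) \<bullet> pd j X p)"

definition mean_curvature ::
  "(real^'n \<Rightarrow> 'e::euclidean_space) \<Rightarrow> (real^'n \<Rightarrow> 'e) \<Rightarrow> real^'n \<Rightarrow> real"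
where
  "mean_curvature X N p = trace (matrix (shape_operator X N p)) / real CARD('n)"

definition mean_curvature_vector ::
  "(real^'n \<Rightarrow> 'e::euclidean_space) \<Rightarrow> (real^'n \<Rightarrow> 'e) \<Rightarrow> real^'n \<Rightarrow> 'e"
where
  "mean_curvature_vector X N p = mean_curvature X N p *\<^sub>R N p"

text \<open>The Laplace--Beltrami operator of the induced metric, with sign \<open>\<Delta> = div grad\<close>.\<close>

definition laplacian ::
  "(real^'n \<Rightarrow> 'e::euclidean_space) \<Rightarrow> (real^'n \<Rightarrow> real) \<Rightarrow> real^'n \<Rightarrow> real"
where
  "laplacian X f p =
     (\<Sum>i\<in>UNIV. pd i (\<lambda>q. sqrt (det (first_form X q)) *
        (\<Sum>j\<in>UNIV. matrix_inv (first_form X q) $ i $ j * pd j f q)) p)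
     / sqrt (det (first_form X p))"

definition vector_laplacian ::
  "(real^'n \<Rightarrow> 'e::euclidean_space) \<Rightarrow> (real^'n \<Rightarrow> 'e) \<Rightarrow> real^'n \<Rightarrow> 'e"
where
  "vector_laplacian X Y p = (\<Sum>b\<in>Basis. laplacian X (\<lambda>q. Y q \<bullet> b) p *\<^sub>R b)"


text \<open>
  The conditions on a hypersurface. They are local and do not depend on the sign of the unit normal
  or on the parametrisation; unit normals exist along every local parametrisation, so no
  orientability is needed.
\<close>

definition biharmonic ::
  "'n::finite itself \<Rightarrow> ('m::topological_space) set \<Rightarrow> ('m \<Rightarrow> 'e::euclidean_space) \<Rightarrow> bool"
where
  "biharmonic _ M F \<longleftrightarrow>
     (\<forall>(U :: (real^'n) set) \<phi> N.
        local_param M F U \<phi> \<longrightarrow> unit_normal_on U (F \<circ> \<phi>) N \<longrightarrow>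
        (\<forall>p\<in>U. vector_laplacian (F \<circ> \<phi>) (mean_curvature_vector (F \<circ> \<phi>) N) p = 0))"

definition minimal ::
  "'n::finite itself \<Rightarrow> ('m::topological_space) set \<Rightarrow> ('m \<Rightarrow> 'e::euclidean_space) \<Rightarrow> bool"
where
  "minimal _ M F \<longleftrightarrow>
     (\<forall>(U :: (real^'n) set) \<phi> N.
        local_param M F U \<phi> \<longrightarrow> unit_normal_on U (F \<circ> \<phi>) N \<longrightarrow>
        (\<forall>p\<in>U. mean_curvature (F \<circ> \<phi>) N p = 0))"

definition holonomic ::
  "'n::finite itself \<Rightarrow> ('m::topological_space) set \<Rightarrow> ('m \<Rightarrow> 'e::euclidean_space) \<Rightarrow> bool"
where
  "holonomic _ M F \<longleftrightarrow>
     (\<forall>m\<in>M. \<exists>(U :: (real^'n) set) \<phi> N.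
        local_param M F U \<phi> \<and> m \<in> \<phi> ` U \<and> unit_normal_on U (F \<circ> \<phi>) N \<and>
        (\<forall>p\<in>U. \<forall>i j. i \<noteq> j \<longrightarrow>
           first_form (F \<circ> \<phi>) p $ i $ j = 0 \<and> second_form (F \<circ> \<phi>) N p $ i $ j = 0))"

end

theory Submission
  imports Defs
begin

text \<open>
  Suppose \<open>h \<noteq> 0\<close> at some point of an orthogonal chart of curvature lines. The tangential equation
  \<open>2 \<lambda>\<^sub>k + n h = 0\<close> wherever \<open>\<partial>\<^sub>k h \<noteq> 0\<close> leaves, after shrinking the chart, exactly one direction \<open>k\<close> in which
  \<open>h\<close> varies, and there \<open>\<Lambda> = \<lambda>\<^sub>k = - (\<Sum>\<^sub>j\<^sub>\<noteq>\<^sub>k \<lambda>\<^sub>j) / 3\<close>. Codazzi's and Gauss' equations then give, along the \<open>k\<close>-line and in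
  terms of arc length, the closed quadratic system \<open>\<lambda>\<^sub>j' = (\<Lambda> - \<lambda>\<^sub>j) w\<^sub>j\<close>, \<open>w\<^sub>j' = - w\<^sub>j\<^sup>2 - \<Lambda> \<lambda>\<^sub>j\<close> with
  \<open>w\<^sub>j = \<partial>\<^sub>k G\<^sub>j / (2 \<surd>G\<^sub>k G\<^sub>j)\<close>, while the normal equation is a polynomial constraint on the solution.

  All iterated Lie derivatives of the constraint vanish at a point of the curve, so by analyticity the constraint
  holds along the whole maximal solution through that point. Put \<open>E\<^sub>j = exp (\<integral> w\<^sub>j)\<close>, \<open>u\<^sub>j = w\<^sub>j E\<^sub>j = E\<^sub>j'\<close> and
  \<open>v\<^sub>j = \<lambda>\<^sub>j E\<^sub>j\<close>: then \<open>(v\<^sub>j, u\<^sub>j)\<close> rotates by the common angle \<open>\<theta> = \<integral> \<Lambda>\<close>, and \<open>(\<Prod>\<^sub>j E\<^sub>j) \<Lambda>'\<close> is increasing. If \<open>\<theta>\<close> is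
  unbounded, every \<open>E\<^sub>j\<close> stays away from \<open>0\<close>; the solution is then bounded and global, which contradicts the growth
  of \<open>\<Lambda>\<close>. If \<open>\<theta>\<close> is bounded, the solution blows up in finite time \<open>T\<close>, some \<open>E\<^sub>j\<close> tends to \<open>0\<close> there, and \<open>\<Lambda>\<close> turns
  out to grow like \<open>1 / (T - t)\<close>, so that \<open>\<theta>\<close> would be unbounded.
\<close>

section \<open>Solutions of the curvature system do not exist\<close>

text \<open>The curvature functions are merely smooth and known only on a short piece of a
  coordinate line, while growth and blow-up say something only about a solution followed to its end.
  The system for \<open>(l, w)\<close> prolongs this piece beyond the hypersurface, but it already
  determines the second derivative of \<Lambda> by itself; the normal equation is an additional
  condition whose survival under prolongation has to be justified. Hence the detour through its Lie
  derivatives at one point. The rotation has a geometric origin. A line in direction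
  \<open>k\<close> is a plane curve with curvature \<Lambda> and turning angle \<theta>, and along
  it \<open>sqrt (G j)\<close> is, up to a constant factor, the function \<open>E j\<close>, which
  is affine in the position of the point in that plane. So all vectors \<open>(v j, u j)\<close>
  turn at the same rate. The normal equation pushes \<Lambda> away from zero once \<Lambda> and
  \<Lambda>' have the same sign. Symmetries of the system make both positive, and then \<Lambda>
  stays positive and grows.\<close>

lemma has_real_derivative_nonneg_imp_le:
  fixes f :: "real \<Rightarrow> real"
  assumes D: "is_interval D" "a \<in> D" "b \<in> D" "a \<le> b"
    and f: "\<And>t. t \<in> D \<Longrightarrow> (f has_real_derivative f' t) (at t within D)"
    and nonneg: "\<And>t. a \<le> t \<Longrightarrow> t \<le> b \<Longrightarrow> t \<in> D \<Longrightarrow> 0 \<le> f' t"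
  shows "f a \<le> f b"
proof (cases "a = b")
  case False
  then have "a < b" using D by simp
  have sub: "{a..b} \<subseteq> D"
    using D by (meson atLeastAtMost_iff mem_is_interval_1_I subsetI)
  have "(f has_derivative (\<lambda>h. f' x * h)) (at x within {a..b})" if "x \<in> {a..b}" for x
    using f[of x] that sub by (meson has_derivative_subset has_field_derivative_def subsetD)
  from mvt_simple[OF \<open>a < b\<close>, of f "\<lambda>x h. f' x * h"] this
  obtain x where x: "x \<in> {a<..<b}" "f b - f a = f' x * (b - a)" by auto
  have "0 \<le> f' x" using nonneg[of x] x sub by (auto simp: subset_iff)
  then have "0 \<le> f b - f a" using x(2) \<open>a < b\<close> by simp
  then show ?thesis by simp
qed simp

lemma continuous_on_imp_primitive:
  fixes f :: "real \<Rightarrow> real"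
  assumes D: "D = {0..} \<or> (\<exists>T>0. D = {0..<T})" and f: "continuous_on D f"
  obtains g where "g 0 = 0" "\<And>t. t \<in> D \<Longrightarrow> (g has_real_derivative f t) (at t within D)"
proof -
  define g where "g t = integral {0..t} f" for t
  have "(g has_real_derivative f t) (at t within D)" if t: "t \<in> D" for t
  proof -
  \<comment> \<open>\<open>D\<close> contains points beyond each of its points, so a compact
    \<open>{0..b}\<close> inside \<open>D\<close> is a neighbourhood of \<open>t\<close> relative to
    \<open>D\<close>.\<close>
  obtain b where b: "t < b" "b \<in> D"
  proof -
    from D consider "D = {0..}" | T where "D = {0..<T}" by blast
    then show thesis
    proof cases
      case 1 then show thesis using that[of "t+1"] t by auto
    next
      case 2 then show thesis using that[of "(t+T)/2"] t by auto
    qed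
  qed
  have sub: "{0..b} \<subseteq> D" and pos: "D \<subseteq> {0..}" using D b by auto
  have "(g has_vector_derivative f t) (at t within {0..b})"
    unfolding g_def using t b pos
    by (intro integral_has_vector_derivative continuous_on_subset[OF f sub]) auto
  then have "(g has_real_derivative f t) (at t within {0..b})"
    by (simp add: has_real_derivative_iff_has_vector_derivative)
  moreover have "at t within {0..b} = at t within D"
    using b t pos sub by (intro at_within_nhd[of _ "{..<b}"]) auto
  ultimately show ?thesis by simp
  qed
  moreover have "g 0 = 0" by (simp add: g_def)
  ultimately show thesis using that by blast
qed

text \<open>The data of a line in direction \<open>k\<close>, parametrised by arc length:
  \<open>L\<close> is \<Lambda> and \<open>m\<close> its derivative, and \<open>m_deriv\<close> is
  the normal equation with \<open>|A|^2 = L^2 + \<Sum> (l j)^2\<close>. Maximality of the solution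
  enters in the form that a bounded solution lives for all positive times.\<close>

locale rotating_system =
  fixes D :: "real set" and l w :: "'n::finite \<Rightarrow> real \<Rightarrow> real" and L m :: "real \<Rightarrow> real"
  assumes D_cases: "D = {0..} \<or> (\<exists>T>0. D = {0..<T})"
    and l_deriv: "t \<in> D \<Longrightarrow> (l j has_real_derivative (L t - l j t) * w j t) (at t within D)"
    and w_deriv: "t \<in> D \<Longrightarrow> (w j has_real_derivative - (w j t)\<^sup>2 - L t * l j t) (at t within D)"
    and L_deriv: "t \<in> D \<Longrightarrow> (L has_real_derivative m t) (at t within D)"
    and m_deriv: "t \<in> D \<Longrightarrow> (m has_real_derivative
          ((L t)\<^sup>2 + (\<Sum>j\<in>UNIV. (l j t)\<^sup>2)) * L t - (\<Sum>j\<in>UNIV. w j t) * m t) (at t within D)"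
    and L_eq: "t \<in> D \<Longrightarrow> L t = - (\<Sum>j\<in>UNIV. l j t) / 3"
    and L_0: "0 < L 0" and m_0: "0 < m 0"
    and maximal: "(\<And>t j. t \<in> D \<Longrightarrow> \<bar>l j t\<bar> \<le> B \<and> \<bar>w j t\<bar> \<le> B) \<Longrightarrow> D = {0..}"
begin

section \<open>Integrating factor, rotation and monotonicity\<close>

lemma D_interval: "is_interval D" and zero_in_D: "0 \<in> D" and D_nonneg: "t \<in> D \<Longrightarrow> 0 \<le> t"
  using D_cases by (auto simp: is_interval_1)

lemma D_down: "t \<in> D \<Longrightarrow> 0 \<le> s \<Longrightarrow> s \<le> t \<Longrightarrow> s \<in> D"
  using D_interval zero_in_D by (meson mem_is_interval_1_I)

lemmas mono_D = has_real_derivative_nonneg_imp_le[OF D_interval]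

lemma cont_D: "(\<And>t. t \<in> D \<Longrightarrow> (f has_real_derivative f' t) (at t within D)) \<Longrightarrow> continuous_on D f"
  by (meson DERIV_continuous continuous_on_eq_continuous_within)

text \<open>A primitive of \<open>w j\<close> that vanishes at \<open>0\<close>. In the geometric
  situation \<open>w j\<close> is the arc-length derivative of \<open>ln (sqrt (G j))\<close>, so
  \<open>E j\<close> is \<open>sqrt (G j)\<close> divided by its initial value and \<open>P\<close>
  is the corresponding density transversal to the line.\<close>

definition "W j = (SOME g. g 0 = 0 \<and> (\<forall>t\<in>D. (g has_real_derivative w j t) (at t within D)))"
definition "E j t = exp (W j t)"
definition "\<theta> = (SOME g. g 0 = 0 \<and> (\<forall>t\<in>D. (g has_real_derivative L t) (at t within D)))"
definition "u j t = w j t * E j t"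
definition "v j t = l j t * E j t"
definition "P t = (\<Prod>j\<in>UNIV. E j t)"
definition "r j = sqrt ((v j 0)\<^sup>2 + (u j 0)\<^sup>2)"

lemma W_deriv: "t \<in> D \<Longrightarrow> (W j has_real_derivative w j t) (at t within D)"
proof -
  obtain g where "g 0 = 0" "\<And>t. t \<in> D \<Longrightarrow> (g has_real_derivative w j t) (at t within D)"
    using continuous_on_imp_primitive[OF D_cases cont_D[OF w_deriv]] by blast
  then have "\<exists>g. g 0 = 0 \<and> (\<forall>t\<in>D. (g has_real_derivative w j t) (at t within D))" by blast
  from someI_ex[OF this] show "t \<in> D \<Longrightarrow> ?thesis" unfolding W_def by blast
qed

lemma \<theta>_0: "\<theta> 0 = 0" and \<theta>_deriv: "t \<in> D \<Longrightarrow> (\<theta> has_real_derivative L t) (at t within D)"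
proof -
  obtain g where "g 0 = 0" "\<And>t. t \<in> D \<Longrightarrow> (g has_real_derivative L t) (at t within D)"
    using continuous_on_imp_primitive[OF D_cases cont_D[OF L_deriv]] by blast
  then have "\<exists>g. g 0 = 0 \<and> (\<forall>t\<in>D. (g has_real_derivative L t) (at t within D))" by blast
  from someI_ex[OF this] show "\<theta> 0 = 0" "t \<in> D \<Longrightarrow> (\<theta> has_real_derivative L t) (at t within D)"
    unfolding \<theta>_def by blast+
qed

lemma E_pos: "0 < E j t" by (simp add: E_def)

lemma P_pos: "0 < P t" by (simp add: P_def E_pos prod_pos)

lemma E_deriv: "t \<in> D \<Longrightarrow> (E j has_real_derivative u j t) (at t within D)"
  unfolding E_def[abs_def] u_def
  by (auto intro!: derivative_eq_intros W_deriv simp: E_def)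

lemma u_deriv: "t \<in> D \<Longrightarrow> (u j has_real_derivative - L t * v j t) (at t within D)"
  unfolding u_def[abs_def] v_def
  by (auto intro!: derivative_eq_intros E_deriv w_deriv simp: u_def algebra_simps power2_eq_square)

lemma v_deriv: "t \<in> D \<Longrightarrow> (v j has_real_derivative L t * u j t) (at t within D)"
  unfolding v_def[abs_def] u_def
  by (auto intro!: derivative_eq_intros E_deriv l_deriv simp: u_def algebra_simps power2_eq_square)

lemma P_deriv: "t \<in> D \<Longrightarrow> (P has_real_derivative P t * (\<Sum>j\<in>UNIV. w j t)) (at t within D)"
proof -
  assume t: "t \<in> D"
  have eq: "P = (\<lambda>t. exp (\<Sum>j\<in>UNIV. W j t))"
    by (auto simp: P_def E_def exp_sum)
  show ?thesis unfolding eq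
    by (auto intro!: derivative_eq_intros W_deriv t)
qed

text \<open>\<open>P\<close> is the integrating factor for the term \<open>- (\<Sum> w) m\<close>.
  What remains has the sign of \<open>L\<close>.\<close>

lemma Pm_deriv: "t \<in> D \<Longrightarrow> ((\<lambda>t. P t * m t) has_real_derivative
    P t * (((L t)\<^sup>2 + (\<Sum>j\<in>UNIV. (l j t)\<^sup>2)) * L t)) (at t within D)"
  by (auto intro!: derivative_eq_intros P_deriv m_deriv simp: algebra_simps)

text \<open>The derivative of \<open>P m L\<close> is a sum of squares times \<open>P\<close>, whatever the signs of \<open>m\<close> and \<open>L\<close>.\<close>

lemma mL_pos: assumes t: "t \<in> D" shows "0 < m t * L t"
proof -
  have "P 0 * m 0 * L 0 \<le> P t * m t * L t"
  proof (rule mono_D[OF zero_in_D t D_nonneg[OF t]])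
    fix s assume s: "s \<in> D"
    show "((\<lambda>t. P t * m t * L t) has_real_derivative
       (P s * (((L s)\<^sup>2 + (\<Sum>j\<in>UNIV. (l j s)\<^sup>2)) * L s)) * L s + m s * (P s * m s)) (at s within D)"
      by (rule DERIV_mult[OF Pm_deriv[OF s] L_deriv[OF s]])
    have "0 \<le> P s * (((L s)\<^sup>2 + (\<Sum>j\<in>UNIV. (l j s)\<^sup>2)) * (L s)\<^sup>2) + P s * (m s)\<^sup>2"
      by (intro add_nonneg_nonneg mult_nonneg_nonneg sum_nonneg) (auto simp: P_pos less_imp_le)
    then show "0 \<le> (P s * (((L s)\<^sup>2 + (\<Sum>j\<in>UNIV. (l j s)\<^sup>2)) * L s)) * L s + m s * (P s * m s)"
      by (simp add: power2_eq_square algebra_simps)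
  qed
  then have "0 < P t * m t * L t"
    using mult_pos_pos[OF mult_pos_pos[OF P_pos m_0] L_0, of 0] by linarith
  then have "0 < P t * (m t * L t)" by (simp add: mult.assoc)
  then show ?thesis using P_pos[of t] by (simp add: zero_less_mult_iff)
qed

text \<open>The product \<open>m L\<close> is positive throughout, so \<open>L\<close> has no zero
  to cross.\<close>

lemma L_pos: assumes t: "t \<in> D" shows "0 < L t"
proof (rule ccontr)
  assume "\<not> 0 < L t"
  moreover have "continuous_on {0..t} L"
    by (rule continuous_on_subset[OF cont_D[OF L_deriv]]) (auto intro: D_down[OF t])
  ultimately obtain s where "0 \<le> s" "s \<le> t" "L s = 0"
    using IVT2'[of L t 0 0] L_0 D_nonneg[OF t] by auto
  then show False using mL_pos[of s] D_down[OF t] by auto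
qed

lemma m_pos: "t \<in> D \<Longrightarrow> 0 < m t"
  using mL_pos[of t] L_pos[of t] by (simp add: zero_less_mult_iff)

lemma L_mono: "s \<in> D \<Longrightarrow> t \<in> D \<Longrightarrow> s \<le> t \<Longrightarrow> L s \<le> L t"
  by (rule mono_D[of s t L m]) (auto intro: L_deriv less_imp_le[OF m_pos])

lemma L_ge: "t \<in> D \<Longrightarrow> L 0 \<le> L t"
  using L_mono zero_in_D D_nonneg by blast

lemma Pm_ge: assumes t: "t \<in> D" shows "P 0 * m 0 \<le> P t * m t"
proof (rule mono_D[OF zero_in_D t D_nonneg[OF t] Pm_deriv])
  fix s assume s: "s \<in> D"
  show "0 \<le> P s * (((L s)\<^sup>2 + (\<Sum>j\<in>UNIV. (l j s)\<^sup>2)) * L s)"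
    using P_pos[of s] L_pos[OF s] by (intro mult_nonneg_nonneg add_nonneg_nonneg sum_nonneg) auto
qed

text \<open>From \<open>v' = L u\<close>, \<open>u' = - L v\<close> and
  \<open>\<theta>' = L\<close>: turning \<open>(v, u)\<close> back by \<theta> leaves a constant
  vector.\<close>

lemma uv_const:
  assumes t: "t \<in> D"
  shows "v j t * cos (\<theta> t) - u j t * sin (\<theta> t) = v j 0"
    and "v j t * sin (\<theta> t) + u j t * cos (\<theta> t) = u j 0"
proof -
  have 1: "((\<lambda>t. v j t * cos (\<theta> t) - u j t * sin (\<theta> t)) has_real_derivative 0) (at s within D)"
    if "s \<in> D" for s
    by (auto intro!: derivative_eq_intros u_deriv v_deriv \<theta>_deriv that simp: algebra_simps)
  have 2: "((\<lambda>t. v j t * sin (\<theta> t) + u j t * cos (\<theta> t)) has_real_derivative 0) (at s within D)"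
    if "s \<in> D" for s
    by (auto intro!: derivative_eq_intros u_deriv v_deriv \<theta>_deriv that simp: algebra_simps)
  have c: "convex D" using D_interval by (simp add: is_interval_convex_1)
  show "v j t * cos (\<theta> t) - u j t * sin (\<theta> t) = v j 0"
    using has_field_derivative_zero_constant[OF c 1] t zero_in_D \<theta>_0 by fastforce
  show "v j t * sin (\<theta> t) + u j t * cos (\<theta> t) = u j 0"
    using has_field_derivative_zero_constant[OF c 2] t zero_in_D \<theta>_0 by fastforce
qed

lemma v_rot: assumes t: "t \<in> D" shows "v j t = v j 0 * cos (\<theta> t) + u j 0 * sin (\<theta> t)"
proof -
  have "v j 0 * cos (\<theta> t) + u j 0 * sin (\<theta> t) = v j t * ((cos (\<theta> t))\<^sup>2 + (sin (\<theta> t))\<^sup>2)"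
    unfolding uv_const[OF t, of j, symmetric] by algebra
  then show ?thesis by simp
qed

lemma u_rot: assumes t: "t \<in> D" shows "u j t = u j 0 * cos (\<theta> t) - v j 0 * sin (\<theta> t)"
proof -
  have "u j 0 * cos (\<theta> t) - v j 0 * sin (\<theta> t) = u j t * ((cos (\<theta> t))\<^sup>2 + (sin (\<theta> t))\<^sup>2)"
    unfolding uv_const[OF t, of j, symmetric] by algebra
  then show ?thesis by simp
qed

lemma uv_norm: assumes t: "t \<in> D" shows "(v j t)\<^sup>2 + (u j t)\<^sup>2 = (r j)\<^sup>2"
proof -
  have "(v j t)\<^sup>2 + (u j t)\<^sup>2 = ((v j 0)\<^sup>2 + (u j 0)\<^sup>2) * ((cos (\<theta> t))\<^sup>2 + (sin (\<theta> t))\<^sup>2)"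
    unfolding v_rot[OF t] u_rot[OF t] by algebra
  then show ?thesis by (simp add: r_def)
qed

lemma r_nonneg: "0 \<le> r j" by (simp add: r_def)

lemma v_bound: "t \<in> D \<Longrightarrow> \<bar>v j t\<bar> \<le> r j" and u_bound: "t \<in> D \<Longrightarrow> \<bar>u j t\<bar> \<le> r j"
  using uv_norm[of t j] r_nonneg[of j] by (metis abs_le_square_iff abs_of_nonneg le_add_same_cancel1 le_add_same_cancel2 zero_le_power2)+

lemma l_eq: "l j t = v j t / E j t" and w_eq: "w j t = u j t / E j t"
  using E_pos[of j t] by (auto simp: v_def u_def)

section \<open>Unbounded turning angle\<close>

lemma bounded_below_tail:
  assumes s: "s \<in> D" and "0 < c" and c: "\<And>t. t \<in> D \<Longrightarrow> s \<le> t \<Longrightarrow> c \<le> E j t"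
  shows "\<exists>c>0. \<forall>t\<in>D. c \<le> E j t"
proof -
  have "continuous_on {0..s} (E j)"
    by (rule continuous_on_subset[OF cont_D[OF E_deriv]]) (auto intro: D_down[OF s])
  then have "\<exists>z\<in>{0..s}. \<forall>t\<in>{0..s}. E j z \<le> E j t"
    using D_nonneg[OF s] by (intro continuous_attains_inf) auto
  then obtain z where z: "\<And>t. t \<in> {0..s} \<Longrightarrow> E j z \<le> E j t" by blast
  have "min c (E j z) \<le> E j t" if "t \<in> D" for t
    using z[of t] c[of t] D_nonneg[OF that] that by (cases "t \<le> s") auto
  then show ?thesis using \<open>0 < c\<close> E_pos by (intro exI[of _ "min c (E j z)"]) auto
qed

text \<open>The numerators in \<open>l = v / E\<close> and \<open>w = u / E\<close> stay on circles,
  so a solution can become unbounded only through some \<open>E j\<close> approaching zero.\<close>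

lemma bounded_of_E_bounded_below:
  assumes "\<And>j. \<exists>c>0. \<forall>t\<in>D. c \<le> E j t"
  obtains B where "\<And>t j. t \<in> D \<Longrightarrow> \<bar>l j t\<bar> \<le> B \<and> \<bar>w j t\<bar> \<le> B"
proof -
  from assms obtain c where c: "\<And>j. 0 < c j" "\<And>j t. t \<in> D \<Longrightarrow> c j \<le> E j t" by metis
  have "\<bar>l j t\<bar> \<le> r j / c j \<and> \<bar>w j t\<bar> \<le> r j / c j" if "t \<in> D" for j t
    using v_bound[OF that, of j] u_bound[OF that, of j] c(1)[of j] c(2)[OF that, of j] E_pos[of j t]
    by (auto simp: l_eq w_eq abs_divide r_nonneg intro!: frac_le)
  moreover have "r j / c j \<le> (\<Sum>j\<in>UNIV. r j / c j)" for j
    using c(1) r_nonneg by (intro member_le_sum) (auto simp: less_imp_le)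
  ultimately show thesis using that[of "\<Sum>j\<in>UNIV. r j / c j"] order_trans by blast
qed

text \<open>Integration by parts in \<open>E' = u = v' / L\<close>, where \<open>c\<close> is the
  free constant in the primitive \<open>v + c\<close>. With \<open>c = r j\<close> the derivative is
  nonnegative, which bounds \<open>E j\<close> below; with \<open>c = - r j\<close> it is
  nonpositive, which bounds \<open>E j\<close> above.\<close>

lemma E_minus_deriv:
  assumes t: "t \<in> D"
  shows "((\<lambda>t. E j t - (v j t + c) / L t) has_real_derivative (v j t + c) * m t / (L t)\<^sup>2) (at t within D)"
  using L_pos[OF t]
  by (auto intro!: derivative_eq_intros E_deriv v_deriv L_deriv t simp: field_simps power2_eq_square)

text \<open>Once the solution is bounded and global, the upper bounds on \<open>E j\<close> bound
  \<open>P\<close>. Then \<open>P m \<ge> P 0 m 0\<close> keeps \<open>m\<close> above a positive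
  constant and \<open>L\<close> grows linearly, although the bound on \<open>l\<close> also bounds
  \<open>L\<close>.\<close>

lemma theta_not_unbounded:
  assumes unb: "\<And>B. \<exists>t\<in>D. B \<le> \<theta> t"
  shows False
proof -
  have Ec: "\<exists>c>0. \<forall>t\<in>D. c \<le> E j t" for j
  proof -
    \<comment> \<open>Start from a time at which \<open>v j\<close> is minimal: from then on \<open>E j - (v j + r j) / L\<close> is nondecreasing,
       and it equals \<open>E j\<close> at the start.\<close>
    obtain \<alpha> where \<alpha>: "v j 0 * cos \<alpha> + u j 0 * sin \<alpha> = - r j" "0 \<le> \<alpha>"
    proof (cases "r j = 0")
      case True
      then have "v j 0 = 0" "u j 0 = 0" by (auto simp: r_def sum_power2_eq_zero_iff)
      then show thesis using that[of 0] True by simp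
    next
      case False
      then have r: "0 < r j" using r_nonneg[of j] by simp
      have "(v j 0)\<^sup>2 + (u j 0)\<^sup>2 = (r j)\<^sup>2" by (rule uv_norm[OF zero_in_D])
      \<comment> \<open>The opposite of the initial unit vector: with \<open>a\<close> as its polar
        angle, \<open>v j\<close> equals \<open>- r j * cos (\<theta> - a)\<close>, which is minimal
        at \<open>\<theta> = a\<close>.\<close>
      then have "(- v j 0 / r j)\<^sup>2 + (- u j 0 / r j)\<^sup>2 = 1"
        using r by (simp add: power_divide add_divide_distrib[symmetric])
      from sincos_total_2pi[OF this] obtain a where
        a: "0 \<le> a" "- v j 0 / r j = cos a" "- u j 0 / r j = sin a" by blast
      have "v j 0 = - r j * cos a" "u j 0 = - r j * sin a"
        using a(2,3) r by (auto simp: field_simps)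
      then have "v j 0 * cos a + u j 0 * sin a = - r j * ((cos a)\<^sup>2 + (sin a)\<^sup>2)"
        by algebra
      then show thesis using that[of a] a(1) by simp
    qed
    obtain t1 where t1: "t1 \<in> D" "\<alpha> \<le> \<theta> t1" using unb by blast
    have "continuous_on {0..t1} \<theta>"
      by (rule continuous_on_subset[OF cont_D[OF \<theta>_deriv]]) (auto intro: D_down[OF t1(1)])
    then obtain s where s: "0 \<le> s" "s \<le> t1" "\<theta> s = \<alpha>"
      using IVT'[of \<theta> 0 \<alpha> t1] \<alpha>(2) \<theta>_0 t1 D_nonneg by auto
    have sD: "s \<in> D" using D_down t1 s by blast
    have vs: "v j s = - r j" using v_rot[OF sD] \<alpha>(1) s(3) by simp
    have "E j s \<le> E j t" if t: "t \<in> D" "s \<le> t" for t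
    proof -
      have "E j s - (v j s + r j) / L s \<le> E j t - (v j t + r j) / L t"
      proof (rule mono_D[OF sD t E_minus_deriv])
        fix q assume "q \<in> D"
        then show "0 \<le> (v j q + r j) * m q / (L q)\<^sup>2"
          using v_bound[of q j] m_pos[of q] by (intro divide_nonneg_nonneg mult_nonneg_nonneg) auto
      qed
      moreover have "0 \<le> (v j t + r j) / L t" using v_bound[OF t(1), of j] L_pos[OF t(1)] by simp
      ultimately show ?thesis using vs by simp
    qed
    then show ?thesis using bounded_below_tail[OF sD E_pos[of j s]] by blast
  qed
  obtain B where B: "\<And>t j. t \<in> D \<Longrightarrow> \<bar>l j t\<bar> \<le> B \<and> \<bar>w j t\<bar> \<le> B"
    using bounded_of_E_bounded_below[OF Ec] by blast
  have D: "D = {0..}" using maximal B by blast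
  have EB: "E j t \<le> E j 0 + 2 * r j / L 0" if t: "t \<in> D" for j t
  proof -
    have "-(E j 0 - (v j 0 + - r j) / L 0) \<le> -(E j t - (v j t + - r j) / L t)"
    proof (rule mono_D[OF zero_in_D t D_nonneg[OF t]])
      fix q assume q: "q \<in> D"
      show "((\<lambda>t. -(E j t - (v j t + - r j) / L t)) has_real_derivative -((v j q + - r j) * m q / (L q)\<^sup>2)) (at q within D)"
        by (rule DERIV_minus[OF E_minus_deriv[OF q]])
      show "0 \<le> -((v j q + - r j) * m q / (L q)\<^sup>2)"
        using v_bound[OF q, of j] m_pos[OF q] by (auto simp: divide_nonpos_nonneg mult_nonpos_nonneg)
    qed
    moreover have "(v j t + - r j) / L t \<le> 0" using v_bound[OF t, of j] L_pos[OF t] by (simp add: divide_nonpos_pos)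
    moreover have "(r j - v j 0) / L 0 \<le> 2 * r j / L 0"
      using v_bound[OF zero_in_D, of j] L_0 by (intro divide_right_mono) auto
    moreover have "(r j - v j 0) / L 0 = - ((v j 0 + - r j) / L 0)" by (simp add: minus_divide_left)
    ultimately show ?thesis by linarith
  qed
  define Q where "Q = (\<Prod>j\<in>UNIV. E j 0 + 2 * r j / L 0)"
  have PQ: "P t \<le> Q" if "t \<in> D" for t
    unfolding P_def Q_def using EB[OF that] E_pos by (intro prod_mono) (auto simp: less_imp_le)
  have Q: "0 < Q" using PQ[OF zero_in_D] P_pos[of 0] by simp
  define c where "c = P 0 * m 0 / Q"
  have c: "0 < c" using Q P_pos m_0 by (simp add: c_def)
  have mc: "c \<le> m t" if t: "t \<in> D" for t
  proof -
    have "P 0 * m 0 \<le> Q * m t"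
      using Pm_ge[OF t] mult_right_mono[OF PQ[OF t] less_imp_le[OF m_pos[OF t]]] by linarith
    then show ?thesis using Q by (simp add: c_def field_simps)
  qed
  have Lc: "c * t \<le> L t" if t: "t \<in> D" for t
  proof -
    have "L 0 - c * 0 \<le> L t - c * t"
    proof (rule mono_D[OF zero_in_D t D_nonneg[OF t]])
      fix q assume "q \<in> D"
      then show "((\<lambda>t. L t - c * t) has_real_derivative m q - c) (at q within D)"
        by (auto intro!: derivative_eq_intros L_deriv)
    qed (use mc in auto)
    then show ?thesis using L_0 by simp
  qed
  have LB: "L t \<le> real CARD('n) * B / 3" if t: "t \<in> D" for t
  proof -
    have "(\<Sum>j\<in>UNIV. - l j t) \<le> (\<Sum>j\<in>(UNIV::'n set). B)"
    proof (rule sum_mono)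
      fix j show "- l j t \<le> B" using B[OF t, of j] by linarith
    qed
    then show ?thesis using L_eq[OF t] by (simp add: sum_negf)
  qed
  \<comment> \<open>At this time the lower bound \<open>c * t\<close> exceeds the upper bound on
    \<open>L\<close> by at least \<open>c\<close>.\<close>
  define t where "t = \<bar>real CARD('n) * B / 3\<bar> / c + 1"
  have "t \<in> D" using c D by (auto simp: t_def)
  from Lc[OF this] LB[OF this] have "c * t \<le> real CARD('n) * B / 3" by linarith
  moreover have "c * t = \<bar>real CARD('n) * B / 3\<bar> + c" using c by (simp add: t_def distrib_left)
  ultimately show False using c by linarith
qed

lemma theta_ge: assumes t: "t \<in> D" shows "L 0 * t \<le> \<theta> t"
proof -
  have "\<theta> 0 - L 0 * 0 \<le> \<theta> t - L 0 * t"
  proof (rule mono_D[OF zero_in_D t D_nonneg[OF t]])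
    fix q assume "q \<in> D"
    then show "((\<lambda>t. \<theta> t - L 0 * t) has_real_derivative L q - L 0) (at q within D)"
      by (auto intro!: derivative_eq_intros \<theta>_deriv)
  qed (use L_ge in auto)
  then show ?thesis by (simp add: \<theta>_0)
qed

lemma theta_mono: "s \<in> D \<Longrightarrow> t \<in> D \<Longrightarrow> s \<le> t \<Longrightarrow> \<theta> s \<le> \<theta> t"
  by (rule mono_D[of s t \<theta> L]) (auto intro: \<theta>_deriv less_imp_le[OF L_pos])

lemma theta_bounded: obtains B where "\<And>t. t \<in> D \<Longrightarrow> \<theta> t < B"
proof -
  obtain B where "\<And>t. t \<in> D \<Longrightarrow> \<not> B \<le> \<theta> t"
    using theta_not_unbounded by blast
  then show thesis by (intro that[of B]) (auto simp: not_le)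
qed

text \<open>\<open>L\<close> never drops below \<open>L 0\<close>, so \<theta> grows at least
  linearly; a bounded angle leaves no room for infinite time.\<close>

lemma finite_lifespan:
  obtains T where "0 < T" "D = {0..<T}"
proof -
  obtain B where B: "\<And>t. t \<in> D \<Longrightarrow> \<theta> t < B" using theta_bounded by blast
  have "D \<noteq> {0..}"
  proof
    assume D: "D = {0..}"
    have "\<bar>B\<bar> / L 0 \<in> D" using D L_0 by simp
    from theta_ge[OF this] B[OF this] show False using L_0 by simp
  qed
  then show thesis using D_cases that by blast
qed

end

section \<open>Bounded turning angle: behaviour at the blow-up time\<close>

locale bounded_rotating_system = rotating_system +
  fixes T :: real
  assumes T_pos: "0 < T" and D_eq: "D = {0..<T}"
begin

abbreviation "F \<equiv> at T within {0..<T}"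

lemma F_nontrivial: "F \<noteq> bot"
proof -
  have "T islimpt {0..<T}" using T_pos
    by (simp add: islimpt_in_closure)
  then show ?thesis by (simp add: trivial_limit_within)
qed

lemma eventually_F_I: "s \<in> D \<Longrightarrow> (\<And>t. t \<in> D \<Longrightarrow> s \<le> t \<Longrightarrow> Q t) \<Longrightarrow> eventually Q F"
  unfolding D_eq eventually_at by (rule exI[of _ "T - s"]) (auto simp: dist_real_def)

lemma eventually_F_D: assumes "eventually Q F" obtains s where "s \<in> D" "\<And>t. t \<in> D \<Longrightarrow> s \<le> t \<Longrightarrow> Q t"
proof -
  obtain d where d: "0 < d" "\<And>t. t \<in> {0..<T} \<Longrightarrow> t \<noteq> T \<Longrightarrow> dist t T < d \<Longrightarrow> Q t"
    using assms unfolding eventually_at by blast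
  define s where "s = max 0 (T - d/2)"
  have "s \<in> D" using T_pos d by (auto simp: s_def D_eq)
  moreover have "Q t" if "t \<in> D" "s \<le> t" for t
    using that d(1) by (intro d(2)) (auto simp: s_def D_eq dist_real_def)
  ultimately show thesis using that by blast
qed

text \<open>Comparison with \<open>- c * ln (T - t)\<close>, which tends to infinity at
  \<open>T\<close>; the term \<open>c0 * t\<close> stays bounded.\<close>

lemma no_log_growth:
  fixes f :: "real \<Rightarrow> real"
  assumes f: "\<And>t. t \<in> D \<Longrightarrow> (f has_real_derivative f' t) (at t within D)"
    and "0 < c" and f': "\<And>t. t \<in> D \<Longrightarrow> s \<le> t \<Longrightarrow> c / (T - t) - c0 \<le> f' t" and s: "s \<in> D"
  shows "\<exists>t\<in>D. s \<le> t \<and> B \<le> f t"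
proof -
  define g where "g t = f t + c * ln (T - t) + c0 * t" for t
  have mono: "g s \<le> g t" if t: "t \<in> D" "s \<le> t" for t
  proof (rule mono_D[OF s t])
    fix q assume q: "q \<in> D"
    then have "0 < T - q" by (simp add: D_eq)
    then show "(g has_real_derivative f' q + c * (-1 / (T - q)) + c0) (at q within D)"
      unfolding g_def by (auto intro!: derivative_eq_intros f q)
    show "0 \<le> f' q + c * (-1 / (T - q)) + c0" if "s \<le> q" using f'[OF q that] by simp
  qed
  \<comment> \<open>Chosen so that \<open>ln (T - t) \<le> A\<close> turns the comparison
    \<open>g s \<le> g t\<close> into \<open>B \<le> f t\<close>.\<close>
  define A where "A = (g s - B - \<bar>c0\<bar> * T) / c"
  define t where "t = max s (T - exp A)"
  have t: "t \<in> D" "s \<le> t" using s by (auto simp: t_def D_eq)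
  have "T - t \<le> exp A" "0 < T - t" using t by (auto simp: t_def D_eq)
  then have "ln (T - t) \<le> A" by (metis exp_le_cancel_iff exp_ln)
  then have "c * ln (T - t) \<le> c * A" using \<open>0 < c\<close> by simp
  moreover have "c * A = g s - B - \<bar>c0\<bar> * T" using \<open>0 < c\<close> by (simp add: A_def)
  moreover have "c0 * t \<le> \<bar>c0\<bar> * t" "\<bar>c0\<bar> * t \<le> \<bar>c0\<bar> * T"
    using t(1) by (auto simp: D_eq intro: mult_right_mono mult_left_mono)
  ultimately have "B \<le> f t" using mono[OF t] unfolding g_def by linarith
  then show ?thesis using t by blast
qed

text \<open>The contradiction aimed at below: a pole of order one in \<open>L = \<theta>'\<close>
  would let \<theta> grow logarithmically, against its bound.\<close>

lemma L_not_inverse: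
  assumes s: "s \<in> D" and c: "0 < c" "\<And>t. t \<in> D \<Longrightarrow> s \<le> t \<Longrightarrow> c / (T - t) - c0 \<le> L t"
  shows False
proof -
  obtain B where B: "\<And>t. t \<in> D \<Longrightarrow> \<theta> t < B" using theta_bounded by blast
  from no_log_growth[OF \<theta>_deriv c s, of B] show False using B by force
qed

text \<open>The rate matters as much as the limit: where \<open>E j\<close> tends to zero, it does
  so at least linearly in \<open>T - t\<close>.\<close>

lemma Lipschitz_tendsto:
  assumes f: "\<And>t. t \<in> D \<Longrightarrow> (f has_real_derivative f' t) (at t within D)"
    and B: "\<And>t. t \<in> D \<Longrightarrow> \<bar>f' t\<bar> \<le> B"
  obtains y where "(f \<longlongrightarrow> y) F" "\<And>t. t \<in> D \<Longrightarrow> \<bar>f t - y\<bar> \<le> B * (T - t)"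
proof -
  have lip: "\<bar>f t - f s\<bar> \<le> B * (t - s)" if "s \<in> D" "t \<in> D" "s \<le> t" for s t
  proof -
    have "B * s - f s \<le> B * t - f t"
    proof (rule mono_D[OF that])
      fix q assume "q \<in> D"
      then show "((\<lambda>t. B * t - f t) has_real_derivative B - f' q) (at q within D)" "0 \<le> B - f' q"
        using B[of q] by (auto intro!: derivative_eq_intros f)
    qed
    moreover have "B * s + f s \<le> B * t + f t"
    proof (rule mono_D[OF that])
      fix q assume "q \<in> D"
      then show "((\<lambda>t. B * t + f t) has_real_derivative B + f' q) (at q within D)" "0 \<le> B + f' q"
        using B[of q] by (auto intro!: derivative_eq_intros f)
    qed
    ultimately show ?thesis by (simp add: algebra_simps abs_le_iff)
  qed
  have B0: "0 \<le> B" using B[OF zero_in_D] by linarith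
  have "uniformly_continuous_on D f"
    unfolding uniformly_continuous_on_def
  proof (intro allI impI)
    fix e :: real assume "0 < e"
    have "dist (f x) (f y) < e" if "x \<in> D" "y \<in> D" "dist x y < e / (B + 1)" for x y
    proof -
      have "\<bar>f x - f y\<bar> \<le> B * \<bar>x - y\<bar>"
        using lip[of x y] lip[of y x] that by (cases "x \<le> y") (auto simp: abs_minus_commute)
      also have "\<dots> \<le> (B + 1) * \<bar>x - y\<bar>" by (simp add: algebra_simps)
      also have "\<dots> < e" using that(3) B0 by (simp add: dist_real_def field_simps)
      finally show ?thesis by (simp add: dist_real_def)
    qed
    then show "\<exists>d>0. \<forall>x\<in>D. \<forall>x'\<in>D. dist x' x < d \<longrightarrow> dist (f x') (f x) < e"
      using \<open>0 < e\<close> B0 by (intro exI[of _ "e / (B + 1)"]) auto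
  qed
  moreover have "T \<in> closure D" using T_pos by (simp add: D_eq)
  ultimately obtain y where y: "(f \<longlongrightarrow> y) (at T within D)"
    using uniformly_continuous_on_extension_at_closure[of D f T] by blast
  have "\<bar>f t - y\<bar> \<le> B * (T - t)" if t: "t \<in> D" for t
  proof (rule tendsto_le[OF F_nontrivial])
    show "((\<lambda>s. \<bar>f t - f s\<bar>) \<longlongrightarrow> \<bar>f t - y\<bar>) F" using y unfolding D_eq by (intro tendsto_intros)
    show "((\<lambda>s. B * (s - t)) \<longlongrightarrow> B * (T - t)) F" by (intro tendsto_intros)
    show "\<forall>\<^sub>F s in F. \<bar>f t - f s\<bar> \<le> B * (s - t)"
      using t by (rule eventually_F_I) (use lip[OF t] in \<open>simp add: abs_minus_commute\<close>)
  qed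
  then show thesis using y that unfolding D_eq by blast
qed

lemma theta_limit: obtains \<theta>' where "(\<theta> \<longlongrightarrow> \<theta>') F"
proof -
  obtain B where B: "\<And>t. t \<in> D \<Longrightarrow> \<theta> t < B" using theta_bounded by blast
  define S where "S = Sup (\<theta> ` D)"
  have bdd: "bdd_above (\<theta> ` D)" using B by (force intro!: bdd_aboveI2[of _ _ B])
  have "(\<theta> \<longlongrightarrow> S) F"
  proof (rule order_tendstoI)
    fix a assume "a < S"
    then obtain s where s: "s \<in> D" "a < \<theta> s"
      using less_cSup_iff[OF _ bdd, of a] zero_in_D unfolding S_def by blast
    show "\<forall>\<^sub>F t in F. a < \<theta> t"
      using s theta_mono by (intro eventually_F_I[OF s(1)]) fastforce
  next
    fix a assume a: "S < a"
    show "\<forall>\<^sub>F t in F. \<theta> t < a"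
    proof (rule eventually_F_I[OF zero_in_D])
      fix t assume "t \<in> D"
      then have "\<theta> t \<le> S" unfolding S_def by (intro cSup_upper bdd) auto
      then show "\<theta> t < a" using a by simp
    qed
  qed
  then show thesis using that by blast
qed

lemma uv_limit:
  obtains u' v' where "(u j \<longlongrightarrow> u') F" "(v j \<longlongrightarrow> v') F" "v'\<^sup>2 + u'\<^sup>2 = (r j)\<^sup>2"
proof -
  obtain \<theta>' where th: "(\<theta> \<longlongrightarrow> \<theta>') F" using theta_limit by blast
  define u' where "u' = u j 0 * cos \<theta>' - v j 0 * sin \<theta>'"
  define v' where "v' = v j 0 * cos \<theta>' + u j 0 * sin \<theta>'"
  have 1: "((\<lambda>t. u j 0 * cos (\<theta> t) - v j 0 * sin (\<theta> t)) \<longlongrightarrow> u') F"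
    unfolding u'_def by (intro tendsto_intros th)
  have 2: "((\<lambda>t. v j 0 * cos (\<theta> t) + u j 0 * sin (\<theta> t)) \<longlongrightarrow> v') F"
    unfolding v'_def by (intro tendsto_intros th)
  have u: "(u j \<longlongrightarrow> u') F"
    by (rule Lim_transform_eventually[OF 1 eventually_F_I[OF zero_in_D]]) (simp add: u_rot)
  have v: "(v j \<longlongrightarrow> v') F"
    by (rule Lim_transform_eventually[OF 2 eventually_F_I[OF zero_in_D]]) (simp add: v_rot)
  have "((\<lambda>t. (v j t)\<^sup>2 + (u j t)\<^sup>2) \<longlongrightarrow> v'\<^sup>2 + u'\<^sup>2) F" by (intro tendsto_intros u v)
  moreover have "((\<lambda>t. (v j t)\<^sup>2 + (u j t)\<^sup>2) \<longlongrightarrow> (r j)\<^sup>2) F"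
    by (rule Lim_transform_eventually[OF tendsto_const eventually_F_I[OF zero_in_D]]) (simp add: uv_norm)
  ultimately have "v'\<^sup>2 + u'\<^sup>2 = (r j)\<^sup>2" using tendsto_unique[OF F_nontrivial] by blast
  then show thesis using u v that by blast
qed

text \<open>All \<open>E j\<close> have limits, and a blow-up needs one that vanishes. If exactly
  one does, \<open>3 L\<close> is \<open>- v j / E j\<close> up to a bounded term: a nonzero limit
  of \<open>v j\<close> produces the forbidden pole, and a zero limit is incompatible with
  \<open>E' = u\<close> and \<open>v' = L u\<close>.\<close>

lemma no_finite_time_solution: False
proof -
  have "\<exists>y. (E j \<longlongrightarrow> y) F \<and> (\<forall>t\<in>D. \<bar>E j t - y\<bar> \<le> r j * (T - t))" for j
    using Lipschitz_tendsto[OF E_deriv u_bound] by metis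
  then obtain Y where Y: "\<And>j. (E j \<longlongrightarrow> Y j) F" "\<And>j t. t \<in> D \<Longrightarrow> \<bar>E j t - Y j\<bar> \<le> r j * (T - t)"
    by metis
  have Y_nonneg: "0 \<le> Y j" for j
    by (rule tendsto_lowerbound[OF Y(1)[of j] _ F_nontrivial]) (simp add: E_pos less_imp_le)
  have below: "\<exists>c>0. \<forall>t\<in>D. c \<le> E j t" if "Y j \<noteq> 0" for j
  proof -
    have "Y j / 2 < Y j" using that Y_nonneg[of j] by simp
    from eventually_F_D[OF order_tendstoD(1)[OF Y(1) this]] obtain s
      where "s \<in> D" "\<And>t. t \<in> D \<Longrightarrow> s \<le> t \<Longrightarrow> Y j / 2 < E j t" by blast
    then show ?thesis using that Y_nonneg[of j] bounded_below_tail[of s "Y j / 2" j] by force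
  qed
  \<comment> \<open>One rate for all indices; the added \<open>1\<close> makes it positive even if
    every \<open>r j\<close> is zero.\<close>
  define R where "R = (\<Sum>j\<in>UNIV. r j) + 1"
  have R: "r j < R" for j
    using member_le_sum[of j UNIV r] r_nonneg by (simp add: R_def)
  have R0: "0 < R" using R r_nonneg le_less_trans by blast
  have small: "E j t \<le> R * (T - t)" if "Y j = 0" "t \<in> D" for j t
  proof -
    have "E j t \<le> r j * (T - t)" using Y(2)[OF that(2), of j] that(1) by simp
    also have "\<dots> \<le> R * (T - t)" using R[of j] that(2) by (intro mult_right_mono) (auto simp: D_eq)
    finally show ?thesis .
  qed
  \<comment> \<open>Bounds of at least \<open>1\<close> may be multiplied into the factors of
    \<open>Z\<close> as well, so that \<open>Q\<close> does not depend on \<open>Z\<close>.\<close>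
  have "\<exists>B\<ge>1. \<forall>t\<in>D. E j t \<le> B" for j
  proof (intro exI[of _ "Y j + r j * T + 1"] conjI ballI)
    fix t assume t: "t \<in> D"
    have "E j t \<le> Y j + r j * (T - t)" using Y(2)[OF t, of j] by linarith
    also have "\<dots> \<le> Y j + r j * T"
      using D_nonneg[OF t] mult_left_mono[OF _ r_nonneg, of "T - t" T j] by simp
    finally show "E j t \<le> Y j + r j * T + 1" by simp
  qed (use Y_nonneg r_nonneg T_pos in simp)
  then obtain b where b: "\<And>j. 1 \<le> b j" "\<And>j t. t \<in> D \<Longrightarrow> E j t \<le> b j" by metis
  define Q where "Q = (\<Prod>j\<in>UNIV. b j)"
  have Q: "1 \<le> Q" unfolding Q_def using b(1) by (intro prod_ge_1)
  have Pm: "0 < P 0 * m 0" using P_pos m_0 by simp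
  \<comment> \<open>The number of vanishing factors bounds from below the order to which
    \<open>P\<close> vanishes at \<open>T\<close>, and by \<open>Pm_ge\<close> the order of the pole
    of \<open>m\<close>.\<close>
  have prod_le: "P t \<le> (R * (T - t)) ^ card Z * Q" if t: "t \<in> D" and Z: "\<And>j. j \<in> Z \<Longrightarrow> Y j = 0" for Z t
  proof -
    have "P t \<le> (\<Prod>j\<in>UNIV. (if j \<in> Z then R * (T - t) else 1) * b j)"
      unfolding P_def
    proof (rule prod_mono, safe)
      fix j
      show "0 \<le> E j t" using E_pos less_imp_le by blast
      have "E j t \<le> R * (T - t) * b j" if "j \<in> Z"
      proof -
        have "E j t \<le> R * (T - t) * 1" using small[OF Z[OF that] t] by simp
        also have "\<dots> \<le> R * (T - t) * b j" using R0 t b(1) by (intro mult_left_mono) (auto simp: D_eq)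
        finally show ?thesis .
      qed
      then show "E j t \<le> (if j \<in> Z then R * (T - t) else 1) * b j" using b(2)[OF t, of j] by auto
    qed
    also have "\<dots> = (R * (T - t)) ^ card Z * Q"
      by (simp add: prod.distrib Q_def prod.If_cases)
    finally show ?thesis .
  qed
  have m_ge: "P 0 * m 0 / ((R * (T - t)) ^ card Z * Q) \<le> m t"
    if t: "t \<in> D" and Z: "\<And>j. j \<in> Z \<Longrightarrow> Y j = 0" for Z t
  proof -
    have "P 0 * m 0 \<le> P t * m t" by (rule Pm_ge[OF t])
    also have "\<dots> \<le> ((R * (T - t)) ^ card Z * Q) * m t"
      using prod_le[OF t Z] m_pos[OF t] by (intro mult_right_mono) auto
    finally show ?thesis using R0 t Q by (simp add: D_eq pos_divide_le_eq mult.commute)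
  qed
  obtain j where j: "Y j = 0"
  proof (rule ccontr)
    assume "\<not> thesis"
    then have nz: "\<And>j. Y j \<noteq> 0" using that by blast
    obtain B where "\<And>t j. t \<in> D \<Longrightarrow> \<bar>l j t\<bar> \<le> B \<and> \<bar>w j t\<bar> \<le> B"
      using bounded_of_E_bounded_below[OF below[OF nz]] by blast
    then have "D = {0..}" by (rule maximal)
    then have "T \<in> D" using T_pos by simp
    then show False by (simp add: D_eq)
  qed
  have only: "i = j" if "Y i = 0" for i
  proof (rule ccontr)
    assume "i \<noteq> j"
    then have "card {i, j} = 2" by simp
    define c where "c = P 0 * m 0 / (R\<^sup>2 * Q)"
    have c: "0 < c" using Pm R0 Q by (simp add: c_def)
    \<comment> \<open>Two vanishing factors would give \<open>L\<close> a derivative of order \<open>1 / (T - t)\<^sup>2\<close>.\<close>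
    have mc: "c / (T - t)\<^sup>2 \<le> m t" if t: "t \<in> D" for t
    proof -
      have "P 0 * m 0 / ((R * (T - t)) ^ card {i, j} * Q) \<le> m t"
        by (rule m_ge[OF t]) (use \<open>Y i = 0\<close> j in auto)
      moreover have "(R * (T - t)) ^ card {i, j} * Q = R\<^sup>2 * Q * (T - t)\<^sup>2"
        by (simp only: \<open>card {i, j} = 2\<close> power_mult_distrib mult_ac)
      ultimately show ?thesis by (simp add: c_def)
    qed
    show False
    proof (rule L_not_inverse[OF zero_in_D c, of "c / T"])
      fix t assume t: "t \<in> D"
      have "L 0 - c / (T - 0) \<le> L t - c / (T - t)"
      proof (rule mono_D[OF zero_in_D t D_nonneg[OF t]])
        fix q assume q: "q \<in> D"
        then have "0 < T - q" by (simp add: D_eq)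
        then show "((\<lambda>t. L t - c / (T - t)) has_real_derivative m q - c / (T - q)\<^sup>2) (at q within D)"
          by (auto intro!: derivative_eq_intros L_deriv q simp: power2_eq_square)
        show "0 \<le> m q - c / (T - q)\<^sup>2" using mc[OF q] by simp
      qed
      then show "c / (T - t) - c / T \<le> L t" using L_0 by simp
    qed
  qed
  \<comment> \<open>One vanishing factor still makes \<open>L\<close> unbounded, and since the other \<open>l i\<close> are bounded this forces \<open>v j < 0\<close>.\<close>
  have L_unbounded: "\<exists>t\<in>D. s \<le> t \<and> B \<le> L t" if "s \<in> D" for s B
  proof (rule no_log_growth[OF L_deriv _ _ that])
    show "0 < P 0 * m 0 / (R * Q)" using Pm R0 Q by simp
    fix t assume "t \<in> D"
    then show "P 0 * m 0 / (R * Q) / (T - t) - 0 \<le> m t"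
      using m_ge[of t "{j}"] j by (simp add: mult_ac)
  qed
  have L_large: "\<forall>\<^sub>F t in F. B \<le> L t" for B
  proof -
    obtain t where t: "t \<in> D" "B \<le> L t" using L_unbounded[OF zero_in_D] by blast
    have "B \<le> L q" if "q \<in> D" "t \<le> q" for q using L_mono[OF t(1) that] t(2) by simp
    then show ?thesis by (rule eventually_F_I[OF t(1)])
  qed
  have "\<exists>B. \<forall>t\<in>D. \<bar>l i t\<bar> \<le> B" if "i \<noteq> j" for i
  proof -
    have "Y i \<noteq> 0" using only that by blast
    then obtain c where c: "0 < c" "\<And>t. t \<in> D \<Longrightarrow> c \<le> E i t" using below[of i] by blast
    have "\<bar>l i t\<bar> \<le> r i / c" if "t \<in> D" for t
      using v_bound[OF that, of i] c(2)[OF that] c(1) E_pos[of i t]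
      by (auto simp: l_eq abs_divide r_nonneg intro!: frac_le)
    then show ?thesis by blast
  qed
  then obtain B where B: "\<And>i t. i \<noteq> j \<Longrightarrow> t \<in> D \<Longrightarrow> \<bar>l i t\<bar> \<le> B i" by metis
  define A where "A = (\<Sum>i\<in>UNIV-{j}. B i)"
  have L_le: "3 * L t \<le> A - v j t / E j t" if t: "t \<in> D" for t
  proof -
    have "- (\<Sum>i\<in>UNIV-{j}. l i t) \<le> A"
      unfolding A_def sum_negf[symmetric] using B[OF _ t] by (intro sum_mono) (auto simp: abs_le_iff)
    moreover have "(\<Sum>i\<in>UNIV. l i t) = l j t + (\<Sum>i\<in>UNIV-{j}. l i t)" by (simp add: sum.remove)
    ultimately show ?thesis using L_eq[OF t] by (simp add: l_eq)
  qed
  have L_ge': "- v j t / E j t - A \<le> 3 * L t" if t: "t \<in> D" for t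
  proof -
    have "(\<Sum>i\<in>UNIV-{j}. l i t) \<le> A"
      unfolding A_def using B[OF _ t] by (intro sum_mono) (auto simp: abs_le_iff)
    moreover have "(\<Sum>i\<in>UNIV. l i t) = l j t + (\<Sum>i\<in>UNIV-{j}. l i t)" by (simp add: sum.remove)
    ultimately show ?thesis using L_eq[OF t] by (simp add: l_eq)
  qed
  have v_neg: "\<forall>\<^sub>F t in F. v j t < 0"
  proof -
    have "\<forall>\<^sub>F t in F. t \<in> D" by (rule eventually_F_I[OF zero_in_D])
    then show ?thesis using L_large[of "A / 3 + 1"]
    proof eventually_elim
      case (elim t)
      then have "0 < - v j t / E j t" using L_le[of t] by simp
      then show ?case using E_pos[of j t] by (simp add: divide_less_0_iff zero_less_divide_iff)
    qed
  qed
  obtain u' v' where lim: "(u j \<longlongrightarrow> u') F" "(v j \<longlongrightarrow> v') F" and uv': "v'\<^sup>2 + u'\<^sup>2 = (r j)\<^sup>2"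
    using uv_limit by blast
  have "v' \<le> 0"
    using tendsto_upperbound[OF lim(2) eventually_mono[OF v_neg less_imp_le] F_nontrivial] .
  show False
  proof (cases "v' = 0")
    case False
    with \<open>v' \<le> 0\<close> have "v' < v' / 2" by simp
    from eventually_F_D[OF order_tendstoD(2)[OF lim(2) this]] obtain s
      where s: "s \<in> D" "\<And>t. t \<in> D \<Longrightarrow> s \<le> t \<Longrightarrow> v j t < v' / 2" by blast
    show False
    proof (rule L_not_inverse[OF s(1)])
      \<comment> \<open>A factor \<open>2\<close> comes from \<open>v j < v' / 2\<close>, a factor
        \<open>3\<close> from \<open>L_ge'\<close>, and \<open>R\<close> from the linear decay of
        \<open>E j\<close>.\<close>
      show "0 < - v' / (6 * R)" using \<open>v' < v' / 2\<close> R0 by (simp add: divide_neg_pos)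
      fix t assume t: "t \<in> D" "s \<le> t"
      have le: "(- v' / 2) / (R * (T - t)) \<le> - v j t / E j t"
        using s(2)[OF t] \<open>v' \<le> 0\<close> small[OF j t(1)] E_pos by (intro frac_le) auto
      show "- v' / (6 * R) / (T - t) - A / 3 \<le> L t"
      proof -
        have "(- v' / 2) / (R * (T - t)) = 3 * (- v' / (6 * R) / (T - t))" by simp
        moreover note le L_ge'[OF t(1)]
        ultimately show ?thesis by linarith
      qed
    qed
  next
    case True
    obtain s where s: "s \<in> D" "\<And>t. t \<in> D \<Longrightarrow> s \<le> t \<Longrightarrow> v j t < 0"
      using eventually_F_D[OF v_neg] by blast
    \<comment> \<open>The limit vector has length \<open>r j\<close>; with \<open>v' = 0\<close> it
      lies on the \<open>u\<close> axis away from the origin.\<close>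
    have "r j \<noteq> 0" using v_bound[OF s(1), of j] s(2)[OF s(1)] by auto
    then have "u' \<noteq> 0" using uv' True by auto
    then consider "0 < u'" | "u' < 0" by linarith
    then show False
    proof cases
      case 1
      from eventually_F_D[OF order_tendstoD(1)[OF lim(1) 1]] obtain q
        where q: "q \<in> D" "\<And>t. t \<in> D \<Longrightarrow> q \<le> t \<Longrightarrow> 0 < u j t" by blast
      \<comment> \<open>\<open>u j\<close> is the derivative of \<open>E j\<close>: if it is
        positive near \<open>T\<close>, then \<open>E j\<close> increases and cannot tend to
        zero.\<close>
      have "E j q \<le> E j t" if t: "t \<in> D" "q \<le> t" for t
        by (rule mono_D[OF q(1) t E_deriv]) (use q less_imp_le in blast)+
      then have "E j q \<le> Y j"
        by (intro tendsto_lowerbound[OF Y(1) eventually_F_I[OF q(1)] F_nontrivial]) blast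
      then show False using j E_pos[of j q] by simp
    next
      case 2
      from eventually_F_D[OF order_tendstoD(2)[OF lim(1) 2]] obtain q
        where q: "q \<in> D" "\<And>t. t \<in> D \<Longrightarrow> q \<le> t \<Longrightarrow> u j t < 0" by blast
      define z where "z = max s q"
      have z: "z \<in> D" using s q by (simp add: z_def max_def)
      \<comment> \<open>Here \<open>v j\<close> is negative with derivative
        \<open>L u j < 0\<close>, so it moves away from its supposed limit zero.\<close>
      have "- v j z \<le> - v j t" if t: "t \<in> D" "z \<le> t" for t
      proof (rule mono_D[OF z t])
        fix x assume x: "x \<in> D"
        show "((\<lambda>t. - v j t) has_real_derivative - (L x * u j x)) (at x within D)"
          by (rule DERIV_minus[OF v_deriv[OF x]])
        show "0 \<le> - (L x * u j x)" if "z \<le> x"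
          using q(2)[OF x] that L_pos[OF x] by (simp add: z_def mult_pos_neg less_imp_le)
      qed
      then have "v' \<le> v j z"
        by (intro tendsto_upperbound[OF lim(2) eventually_F_I[OF z] F_nontrivial]) simp
      then show False using s(2)[OF z] True by (simp add: z_def)
    qed
  qed
qed

end

lemma (in rotating_system) no_global_solution: False
proof -
  obtain T where "0 < T" "D = {0..<T}" by (rule finite_lifespan)
  then interpret bounded_rotating_system D l w L m T by unfold_locales
  show False by (rule no_finite_time_solution)
qed

section \<open>Analytic solutions of quadratic vector fields\<close>

text \<open>The radius is a parameter, so that sums, products and derivatives are represented on one
  and the same interval.\<close>

definition rep_by_fps :: "real \<Rightarrow> (real \<Rightarrow> real) \<Rightarrow> real fps \<Rightarrow> bool" where
  "rep_by_fps \<rho> g F \<longleftrightarrow> ereal \<rho> \<le> fps_conv_radius F \<and> (\<forall>t. \<bar>t\<bar> < \<rho> \<longrightarrow> eval_fps F t = g t)"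

lemma rep_by_fps_less: "rep_by_fps \<rho> g F \<Longrightarrow> \<bar>t\<bar> < \<rho> \<Longrightarrow> ereal (norm t) < fps_conv_radius F"
  using less_le_trans[of "ereal \<bar>t\<bar>" "ereal \<rho>" "fps_conv_radius F"] by (simp add: rep_by_fps_def)

lemma rep_by_fps_const: "rep_by_fps \<rho> (\<lambda>t. c) (fps_const c)"
  by (simp add: rep_by_fps_def)

lemma rep_by_fps_add:
  assumes "rep_by_fps \<rho> f F" "rep_by_fps \<rho> g G"
  shows "rep_by_fps \<rho> (\<lambda>t. f t + g t) (F + G)"
  using assms rep_by_fps_less[OF assms(1)] rep_by_fps_less[OF assms(2)]
    order_trans[OF _ fps_conv_radius_add[of F G], of "ereal \<rho>"]
  by (auto simp: rep_by_fps_def eval_fps_add)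

lemma rep_by_fps_mult:
  assumes "rep_by_fps \<rho> f F" "rep_by_fps \<rho> g G"
  shows "rep_by_fps \<rho> (\<lambda>t. f t * g t) (F * G)"
  using assms rep_by_fps_less[OF assms(1)] rep_by_fps_less[OF assms(2)]
    order_trans[OF _ fps_conv_radius_mult[of F G], of "ereal \<rho>"]
  by (auto simp: rep_by_fps_def eval_fps_mult)

lemma rep_by_fps_sum:
  assumes "\<And>i. i \<in> I \<Longrightarrow> rep_by_fps \<rho> (f i) (F i)"
  shows "rep_by_fps \<rho> (\<lambda>t. \<Sum>i\<in>I. f i t) (\<Sum>i\<in>I. F i)"
  using assms
proof (induction I rule: infinite_finite_induct)
  case (insert i I)
  then show ?case by (simp add: rep_by_fps_add)
qed (use rep_by_fps_const[of \<rho> 0] in auto)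

lemma rep_by_fps_derivative:
  assumes "rep_by_fps \<rho> f F" "\<And>t. \<bar>t\<bar> < \<rho> \<Longrightarrow> (f has_real_derivative f' t) (at t)"
  shows "rep_by_fps \<rho> f' (fps_deriv F)"
  unfolding rep_by_fps_def
proof (intro conjI allI impI)
  show "ereal \<rho> \<le> fps_conv_radius (fps_deriv F)"
    using assms(1) fps_conv_radius_deriv[of F] order_trans unfolding rep_by_fps_def by blast
  fix t assume t: "\<bar>t\<bar> < \<rho>"
  have "(eval_fps F has_real_derivative eval_fps (fps_deriv F) t) (at t)"
    by (rule has_field_derivative_eval_fps[OF rep_by_fps_less[OF assms(1) t]])
  moreover have "(eval_fps F has_real_derivative f' t) (at t)"
  proof (rule has_field_derivative_transform_within_open[OF assms(2)[OF t], of "{-\<rho><..<\<rho>}"])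
    fix x assume "x \<in> {-\<rho><..<\<rho>}"
    then have "\<bar>x\<bar> < \<rho>" by auto
    then show "f x = eval_fps F x" using assms(1) unfolding rep_by_fps_def by simp
  qed (use t in auto)
  ultimately show "eval_fps (fps_deriv F) t = f' t" by (rule DERIV_unique)
qed

text \<open>Identity theorem for power series. \<open>g k\<close> is the \<open>k\<close>-th
  derivative of \<open>g 0\<close>, so its value at \<open>0\<close> is a nonzero multiple of the
  \<open>k\<close>-th coefficient.\<close>

lemma rep_by_fps_zero:
  assumes "0 < \<rho>" and F: "rep_by_fps \<rho> (g 0) F"
    and g: "\<And>k t. \<bar>t\<bar> < \<rho> \<Longrightarrow> (g k has_real_derivative g (Suc k) t) (at t)"
    and zero: "\<And>k. g k 0 = 0" and t: "\<bar>t\<bar> < \<rho>"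
  shows "g 0 t = 0"
proof -
  have k: "rep_by_fps \<rho> (g k) ((fps_deriv ^^ k) F)" for k
    by (induction k) (use F rep_by_fps_derivative g in auto)
  have "fps_nth F k = 0" for k
  proof -
    have "fps_nth ((fps_deriv ^^ k) F) 0 = eval_fps ((fps_deriv ^^ k) F) 0"
      by (simp add: eval_fps_at_0)
    also have "\<dots> = 0" using k[of k] \<open>0 < \<rho>\<close> zero unfolding rep_by_fps_def by simp
    finally show ?thesis by (simp add: fps_0th_higher_deriv)
  qed
  then have "F = 0" by (simp add: fps_eq_iff)
  then show ?thesis using F t unfolding rep_by_fps_def by simp
qed

section \<open>Power series solutions and polynomials along them\<close>

fun taylor_coeff :: "('v::real_vector \<Rightarrow> 'v \<Rightarrow> 'v) \<Rightarrow> 'v \<Rightarrow> nat \<Rightarrow> 'v" where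
  "taylor_coeff Q y 0 = y"
| "taylor_coeff Q y (Suc n) =
     (1 / real (Suc n)) *\<^sub>R (\<Sum>i\<le>n. Q (taylor_coeff Q y i) (taylor_coeff Q y (n - i)))"

definition lie :: "('v::real_normed_vector \<Rightarrow> 'v \<Rightarrow> 'v) \<Rightarrow> ('v \<Rightarrow> real) \<Rightarrow> 'v \<Rightarrow> real" where
  "lie Q C x = frechet_derivative C (at x) (Q x x)"

lemma real_polynomial_function_differentiable:
  "real_polynomial_function p \<Longrightarrow> p differentiable (at x)"
  by (induction rule: real_polynomial_function.induct)
     (auto simp: bounded_linear_imp_differentiable)

locale quadratic_vector_field = bounded_bilinear Q
  for Q :: "'v::euclidean_space \<Rightarrow> 'v \<Rightarrow> 'v"
begin

lemma bilinear_expand: "Q x y = (\<Sum>c\<in>Basis. \<Sum>d\<in>Basis. ((x \<bullet> c) * (y \<bullet> d)) *\<^sub>R Q c d)"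
proof -
  have "Q x y = Q (\<Sum>c\<in>Basis. (x \<bullet> c) *\<^sub>R c) (\<Sum>d\<in>Basis. (y \<bullet> d) *\<^sub>R d)"
    by (simp add: euclidean_representation)
  also have "\<dots> = (\<Sum>c\<in>Basis. \<Sum>d\<in>Basis. ((x \<bullet> c) * (y \<bullet> d)) *\<^sub>R Q c d)"
    unfolding sum_left sum_right
    by (subst sum.swap) (simp add: scaleR_left scaleR_right mult.commute)
  finally show ?thesis .
qed

lemma lie_linear:
  assumes "bounded_linear f" shows "lie Q f x = f (Q x x)"
  unfolding lie_def using frechet_derivative_at[OF bounded_linear_imp_has_derivative[OF assms]]
  by metis

text \<open>The factor \<open>c\<close> admits curves that follow the field at a speed other than
  one, such as coordinate lines parametrised by the coordinate instead of arc length.\<close>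

lemma lie_has_derivative:
  assumes "real_polynomial_function C" and y: "(y has_vector_derivative c *\<^sub>R Q (y t) (y t)) (at t within S)"
  shows "((\<lambda>t. C (y t)) has_real_derivative c * lie Q C (y t)) (at t within S)"
proof -
  have d: "(C has_derivative frechet_derivative C (at (y t))) (at (y t))"
    using real_polynomial_function_differentiable[OF assms(1)] frechet_derivative_works by blast
  then have lin: "linear (frechet_derivative C (at (y t)))" by (rule has_derivative_linear)
  have "((C \<circ> y) has_derivative (frechet_derivative C (at (y t)) \<circ> (\<lambda>x. x *\<^sub>R (c *\<^sub>R Q (y t) (y t))))) (at t within S)"
    by (rule diff_chain_within) (use y d in \<open>auto simp: has_vector_derivative_def intro: has_derivative_at_withinI\<close>)
  moreover have "frechet_derivative C (at (y t)) \<circ> (\<lambda>x. x *\<^sub>R (c *\<^sub>R Q (y t) (y t))) = (\<lambda>x. c * lie Q C (y t) * x)"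
    by (auto simp: lie_def linear_cmul[OF lin])
  ultimately show ?thesis by (simp add: has_field_derivative_def o_def)
qed

text \<open>Closure under \<open>lie\<close> allows iteration: each Lie derivative of a polynomial
  constraint is again differentiable and has a power series along a solution.\<close>

lemma lie_polynomial:
  assumes "real_polynomial_function C" shows "real_polynomial_function (lie Q C)"
  using assms
proof (induction rule: real_polynomial_function.induct)
  case (linear f)
  have "real_polynomial_function (\<lambda>x. \<Sum>c\<in>Basis. \<Sum>d\<in>Basis. ((x \<bullet> c) * (x \<bullet> d)) * f (Q c d))"
    by (intro real_polynomial_function_sum real_polynomial_function.intros(4)
        real_polynomial_function.intros(2) real_polynomial_function.intros(1) bounded_linear_inner_left) auto
  moreover have "f (Q x x) = (\<Sum>c\<in>Basis. \<Sum>d\<in>Basis. ((x \<bullet> c) * (x \<bullet> d)) * f (Q c d))" for x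
    unfolding bilinear_expand[of x x] linear_sum[OF bounded_linear.linear[OF linear]]
    by (simp add: linear_cmul[OF bounded_linear.linear[OF linear]])
  ultimately show ?case by (simp add: lie_linear[OF linear])
next
  case (const c)
  have "lie Q (\<lambda>x. c) = (\<lambda>x. 0)" by (auto simp: lie_def)
  then show ?case by auto
next
  case (add f g)
  have "lie Q (\<lambda>x. f x + g x) x = lie Q f x + lie Q g x" for x
    using frechet_derivative_at[OF has_derivative_add[OF
        real_polynomial_function_differentiable[OF add.hyps(1), of x, unfolded frechet_derivative_works]
        real_polynomial_function_differentiable[OF add.hyps(2), of x, unfolded frechet_derivative_works]], symmetric]
    by (simp add: lie_def)
  then show ?case using add by auto
next
  case (mult f g)
  have "lie Q (\<lambda>x. f x * g x) x = f x * lie Q g x + lie Q f x * g x" for x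
    using frechet_derivative_at[OF has_derivative_mult[OF
        real_polynomial_function_differentiable[OF mult.hyps(1), of x, unfolded frechet_derivative_works]
        real_polynomial_function_differentiable[OF mult.hyps(2), of x, unfolded frechet_derivative_works]], symmetric]
    by (simp add: lie_def)
  then show ?case using mult by auto
qed

lemma lie_power_polynomial:
  "real_polynomial_function C \<Longrightarrow> real_polynomial_function ((lie Q ^^ k) C)"
  by (induction k) (auto simp: lie_polynomial)

text \<open>A quadratic recursion preserves geometric bounds exactly, so the existence time depends only on the norm of the
  initial value.\<close>

lemma norm_taylor_coeff:
  assumes K: "\<And>a b. norm (Q a b) \<le> norm a * norm b * K" "0 \<le> K" and y: "norm y \<le> R"
  shows "norm (taylor_coeff Q y n) \<le> R * (K * R) ^ n"
proof (induction n rule: less_induct)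
  case (less n)
  have R: "0 \<le> R" using y norm_ge_zero order_trans by blast
  show ?case
  proof (cases n)
    case 0 then show ?thesis using y by simp
  next
    case (Suc k)
    \<comment> \<open>All \<open>n = k + 1\<close> terms obey the same bound, so the factor
      \<open>1 / n\<close> of the recursion cancels their number.\<close>
    have "norm (\<Sum>i\<le>k. Q (taylor_coeff Q y i) (taylor_coeff Q y (k - i))) \<le> (\<Sum>i\<le>k. R * (K * R) ^ n)"
    proof (rule sum_norm_le)
      fix i assume i: "i \<in> {..k}"
      have "norm (Q (taylor_coeff Q y i) (taylor_coeff Q y (k - i)))
          \<le> norm (taylor_coeff Q y i) * norm (taylor_coeff Q y (k - i)) * K" by (rule K)
      also have "\<dots> \<le> (R * (K * R) ^ i) * (R * (K * R) ^ (k - i)) * K"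
        using i Suc K(2) R by (intro mult_right_mono mult_mono less.IH) auto
      also have "\<dots> = R * (K * R) * ((K * R) ^ i * (K * R) ^ (k - i))" by (simp only: mult_ac)
      also have "(K * R) ^ i * (K * R) ^ (k - i) = (K * R) ^ k"
        using i by (simp add: power_add[symmetric])
      finally show "norm (Q (taylor_coeff Q y i) (taylor_coeff Q y (k - i))) \<le> R * (K * R) ^ n"
        by (simp add: Suc mult_ac)
    qed
    then show ?thesis by (simp add: Suc field_simps)
  qed
qed

lemma local_solution:
  assumes K: "\<And>a b. norm (Q a b) \<le> norm a * norm b * K" "0 < K"
    and y: "norm y \<le> R" "0 < R"
  obtains \<phi> Y where "\<phi> 0 = y"
    "\<And>t. \<bar>t\<bar> < 1 / (K * R) \<Longrightarrow> (\<phi> has_vector_derivative Q (\<phi> t) (\<phi> t)) (at t)"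
    "\<And>b. b \<in> Basis \<Longrightarrow> rep_by_fps (1 / (K * R)) (\<lambda>t. \<phi> t \<bullet> b) (Y b)"
proof -
  define \<rho> where "\<rho> = 1 / (K * R)"
  define a where "a = taylor_coeff Q y"
  define Y where "Y b = Abs_fps (\<lambda>n. a n \<bullet> b)" for b
  define \<phi> where "\<phi> t = (\<Sum>b\<in>Basis. eval_fps (Y b) t *\<^sub>R b)" for t
  have comp: "\<phi> t \<bullet> b = eval_fps (Y b) t" if "b \<in> Basis" for b t
    using that by (simp add: \<phi>_def)
  have rad: "ereal \<rho> \<le> fps_conv_radius (Y b)" if b: "b \<in> Basis" for b
    unfolding fps_conv_radius_def
  proof (rule conv_radius_geI_ex')
    fix r assume r: "0 < r" "ereal r < ereal \<rho>"
    \<comment> \<open>The ratio of the geometric majorant supplied by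
      \<open>norm_taylor_coeff\<close>.\<close>
    have "K * R * r < 1" using r K y by (simp add: \<rho>_def field_simps)
    then have "summable (\<lambda>n. R * (K * R * r) ^ n)"
      using r K y by (intro summable_mult summable_geometric) auto
    then show "summable (\<lambda>n. fps_nth (Y b) n * of_real r ^ n)"
    proof (rule summable_comparison_test')
      fix n :: nat
      have "\<bar>a n \<bullet> b\<bar> \<le> norm (a n)" using b by (rule Basis_le_norm)
      also have "\<dots> \<le> R * (K * R) ^ n"
        unfolding a_def using K y by (intro norm_taylor_coeff) auto
      finally have "\<bar>a n \<bullet> b\<bar> * r ^ n \<le> R * (K * R) ^ n * r ^ n"
        using r by (intro mult_right_mono) auto
      then show "norm (fps_nth (Y b) n * of_real r ^ n) \<le> R * (K * R * r) ^ n"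
        using r by (simp add: Y_def abs_mult power_mult_distrib mult_ac)
    qed
  qed
  then have rep: "rep_by_fps \<rho> (\<lambda>t. \<phi> t \<bullet> b) (Y b)" if "b \<in> Basis" for b
    using that by (simp add: rep_by_fps_def comp)
  define G where "G b = (\<Sum>c\<in>Basis. \<Sum>d\<in>Basis. (Y c * Y d) * fps_const (Q c d \<bullet> b))" for b
  have Qrep: "rep_by_fps \<rho> (\<lambda>t. Q (\<phi> t) (\<phi> t) \<bullet> b) (G b)" for b
    unfolding bilinear_expand[of "\<phi> _"] inner_sum_left inner_scaleR_left G_def
    by (intro rep_by_fps_sum rep_by_fps_mult rep_by_fps_const rep)
  \<comment> \<open>\<open>G\<close> is the series of \<open>Q \<phi> \<phi>\<close>; the recursion
    for \<open>taylor_coeff\<close> is the differential equation read coefficient by coefficient,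
    with the Cauchy product on the right.\<close>
  have deriv: "fps_deriv (Y b) = G b" for b
  proof (rule fps_ext)
    fix n
    have "fps_nth (fps_deriv (Y b)) n = (\<Sum>i\<le>n. Q (a i) (a (n - i)) \<bullet> b)"
      by (simp add: Y_def a_def inner_sum_left)
    also have "\<dots> = (\<Sum>i\<le>n. \<Sum>c\<in>Basis. \<Sum>d\<in>Basis. (a i \<bullet> c) * (a (n - i) \<bullet> d) * (Q c d \<bullet> b))"
      by (subst bilinear_expand) (simp add: inner_sum_left)
    also have "\<dots> = (\<Sum>c\<in>Basis. \<Sum>d\<in>Basis. \<Sum>i\<le>n. (a i \<bullet> c) * (a (n - i) \<bullet> d) * (Q c d \<bullet> b))"
      by (subst sum.swap, rule sum.cong[OF refl], subst sum.swap) (rule refl)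
    also have "\<dots> = fps_nth (G b) n"
      unfolding G_def fps_sum_nth fps_mult_right_const_nth fps_mult_nth[of "Y c" "Y d" for c d]
      by (simp add: Y_def sum_distrib_right atLeast0AtMost)
    finally show "fps_nth (fps_deriv (Y b)) n = fps_nth (G b) n" .
  qed
  have "(\<phi> has_vector_derivative Q (\<phi> t) (\<phi> t)) (at t)" if t: "\<bar>t\<bar> < \<rho>" for t
  proof -
    have "(\<phi> has_vector_derivative (\<Sum>b\<in>Basis. eval_fps (fps_deriv (Y b)) t *\<^sub>R b)) (at t)"
      unfolding \<phi>_def
    proof (rule has_vector_derivative_sum)
      fix b :: 'v assume b: "b \<in> Basis"
      show "((\<lambda>t. eval_fps (Y b) t *\<^sub>R b) has_vector_derivative eval_fps (fps_deriv (Y b)) t *\<^sub>R b) (at t)"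
        using has_field_derivative_eval_fps[OF rep_by_fps_less[OF rep[OF b] t]]
        by (auto intro!: derivative_eq_intros)
    qed
    also have "(\<Sum>b\<in>Basis. eval_fps (fps_deriv (Y b)) t *\<^sub>R b) = (\<Sum>b\<in>Basis. (Q (\<phi> t) (\<phi> t) \<bullet> b) *\<^sub>R b)"
      unfolding deriv using Qrep t by (simp add: rep_by_fps_def)
    finally show ?thesis by (simp add: euclidean_representation)
  qed
  moreover have "\<phi> 0 = y"
    by (simp add: \<phi>_def eval_fps_at_0 Y_def a_def euclidean_representation)
  ultimately show thesis using that rep unfolding \<rho>_def by blast
qed

lemma polynomial_along_solution:
  assumes "real_polynomial_function C" and "\<And>b. b \<in> Basis \<Longrightarrow> rep_by_fps \<rho> (\<lambda>t. \<phi> t \<bullet> b) (Y b)"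
  shows "\<exists>F. rep_by_fps \<rho> (\<lambda>t. C (\<phi> t :: 'v)) F"
  using assms(1)
proof (induction rule: real_polynomial_function.induct)
  case (linear f)
  have eq: "f x = (\<Sum>b\<in>Basis. (x \<bullet> b) * f b)" for x
  proof -
    have "f x = f (\<Sum>b\<in>Basis. (x \<bullet> b) *\<^sub>R b)" by (simp add: euclidean_representation)
    also have "\<dots> = (\<Sum>b\<in>Basis. (x \<bullet> b) * f b)"
      by (simp add: linear_sum[OF bounded_linear.linear[OF linear]] linear_cmul[OF bounded_linear.linear[OF linear]])
    finally show ?thesis .
  qed
  have "rep_by_fps \<rho> (\<lambda>t. \<Sum>b\<in>Basis. (\<phi> t \<bullet> b) * f b) (\<Sum>b\<in>Basis. Y b * fps_const (f b))"
    by (intro rep_by_fps_sum rep_by_fps_mult rep_by_fps_const assms)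
  moreover have "(\<lambda>t. f (\<phi> t)) = (\<lambda>t. \<Sum>b\<in>Basis. (\<phi> t \<bullet> b) * f b)"
    by (rule ext, rule eq)
  ultimately show ?case by metis
next
  case (const c) then show ?case using rep_by_fps_const by blast
next
  case (add f g)
  then obtain F G where "rep_by_fps \<rho> (\<lambda>t. f (\<phi> t)) F" "rep_by_fps \<rho> (\<lambda>t. g (\<phi> t)) G" by blast
  from rep_by_fps_add[OF this] show ?case by blast
next
  case (mult f g)
  then obtain F G where "rep_by_fps \<rho> (\<lambda>t. f (\<phi> t)) F" "rep_by_fps \<rho> (\<lambda>t. g (\<phi> t)) G" by blast
  from rep_by_fps_mult[OF this] show ?case by blast
qed

text \<open>Unlike the zero set of \<open>C\<close> alone, this set is preserved by the analytic
  solutions starting in it.\<close>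

definition "lie_zeros C = {y. \<forall>k. (lie Q ^^ k) C y = 0}"

text \<open>Along the solution every iterated Lie derivative of \<open>C\<close> has a power series,
  and its own derivatives at \<open>0\<close> are further Lie derivatives of \<open>C\<close> at
  \<open>y\<close>, which vanish.\<close>

lemma local_solution_in_lie_zeros:
  assumes K: "\<And>a b. norm (Q a b) \<le> norm a * norm b * K" "0 < K"
    and C: "real_polynomial_function C" and y: "y \<in> lie_zeros C" "norm y \<le> R" "0 < R"
  obtains \<phi> where "\<phi> 0 = y"
    "\<And>t. \<bar>t\<bar> < 1 / (K * R) \<Longrightarrow> (\<phi> has_vector_derivative Q (\<phi> t) (\<phi> t)) (at t)"
    "\<And>t. \<bar>t\<bar> < 1 / (K * R) \<Longrightarrow> \<phi> t \<in> lie_zeros C"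
proof -
  obtain \<phi> Y where \<phi>: "\<phi> 0 = y"
    "\<And>t. \<bar>t\<bar> < 1 / (K * R) \<Longrightarrow> (\<phi> has_vector_derivative Q (\<phi> t) (\<phi> t)) (at t)"
    "\<And>b. b \<in> Basis \<Longrightarrow> rep_by_fps (1 / (K * R)) (\<lambda>t. \<phi> t \<bullet> b) (Y b)"
    using local_solution[OF K y(2,3)] by blast
  have "(lie Q ^^ j) C (\<phi> t) = 0" if t: "\<bar>t\<bar> < 1 / (K * R)" for t j
  proof -
    let ?C = "(lie Q ^^ j) C"
    have C': "real_polynomial_function ?C" by (rule lie_power_polynomial[OF C])
    obtain F where "rep_by_fps (1 / (K * R)) (\<lambda>t. ?C (\<phi> t)) F"
      using polynomial_along_solution[OF C' \<phi>(3)] by blast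
    then have F: "rep_by_fps (1 / (K * R)) (\<lambda>t. (lie Q ^^ 0) ?C (\<phi> t)) F" by simp
    have "(lie Q ^^ 0) ?C (\<phi> t) = 0"
    proof (rule rep_by_fps_zero[where g = "\<lambda>k t. (lie Q ^^ k) ?C (\<phi> t)" and \<rho> = "1 / (K * R)"])
      show "rep_by_fps (1 / (K * R)) (\<lambda>t. (lie Q ^^ 0) ?C (\<phi> t)) F" by (rule F)
      show "\<bar>t\<bar> < 1 / (K * R)" by (rule t)
      show "0 < 1 / (K * R)" using K y by simp
      show "((\<lambda>t. (lie Q ^^ k) ?C (\<phi> t)) has_real_derivative (lie Q ^^ Suc k) ?C (\<phi> s)) (at s)"
        if "\<bar>s\<bar> < 1 / (K * R)" for k s
        using lie_has_derivative[OF lie_power_polynomial[OF C', of k], of \<phi> 1 s UNIV] \<phi>(2)[OF that] by simp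
      show "(lie Q ^^ k) ?C (\<phi> 0) = 0" for k
      proof -
        have "(lie Q ^^ k) ?C = (lie Q ^^ (k + j)) C" by (simp add: funpow_add)
        then show ?thesis using y(1) by (simp add: lie_zeros_def \<phi>(1))
      qed
    qed
    then show ?thesis by simp
  qed
  then show thesis using that \<phi> by (simp add: lie_zeros_def)
qed

end

text \<open>Local solutions are concatenated, each started at the end point of the preceding one.
  The step length depends only on the norm of that point, so a bounded solution advances by steps
  bounded away from zero and exhausts \<open>{0..}\<close>.\<close>

lemma maximal_solution:
  fixes f :: "'v::real_normed_vector \<Rightarrow> 'v"
  assumes K: "0 < K" and y: "y \<in> V"
    and local: "\<And>y. y \<in> V \<Longrightarrow> \<exists>\<phi>. \<phi> 0 = y \<and>
      (\<forall>t. \<bar>t\<bar> < 1 / (K * (norm y + 1)) \<longrightarrow> (\<phi> has_vector_derivative f (\<phi> t)) (at t) \<and> \<phi> t \<in> V)"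
  obtains D Y where "D = {0..} \<or> (\<exists>T>0. D = {0..<T})" "Y 0 = y"
    "\<And>t. t \<in> D \<Longrightarrow> Y t \<in> V \<and> (Y has_vector_derivative f (Y t)) (at t within D)"
    "bounded (Y ` D) \<Longrightarrow> D = {0..}"
proof -
  \<comment> \<open>Half of the guaranteed time, so that the end point of a step lies inside the
    interval where the local solution is differentiable and remains in \<open>V\<close>.\<close>
  define h where "h y = 1 / (2 * K * (norm y + 1))" for y :: 'v
  have h_pos: "0 < h z" for z using K by (simp add: h_def add_nonneg_pos)
  have h_less: "\<bar>t\<bar> < 1 / (K * (norm z + 1))" if "0 \<le> t" "t \<le> h z" for t z
  proof -
    have "h z < 2 * h z" using h_pos[of z] by simp
    also have "2 * h z = 1 / (K * (norm z + 1))" by (simp add: h_def)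
    finally show ?thesis using that by simp
  qed
  obtain \<phi> where \<phi>: "\<And>z. z \<in> V \<Longrightarrow> \<phi> z 0 = z"
    "\<And>z t. z \<in> V \<Longrightarrow> 0 \<le> t \<Longrightarrow> t \<le> h z \<Longrightarrow> (\<phi> z has_vector_derivative f (\<phi> z t)) (at t) \<and> \<phi> z t \<in> V"
    using local h_less by metis
  define z where "z = rec_nat y (\<lambda>_ x. \<phi> x (h x))"
  have z_0: "z 0 = y" and z_Suc: "z (Suc n) = \<phi> (z n) (h (z n))" for n by (simp_all add: z_def)
  have zV: "z n \<in> V" for n
  proof (induction n)
    case (Suc n)
    then show ?case using \<phi>(2)[of "z n" "h (z n)"] h_pos[of "z n"] by (simp add: z_Suc)
  qed (simp add: z_0 y)
  define t where "t n = (\<Sum>i<n. h (z i))" for n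
  have t_0: "t 0 = 0" and t_Suc: "t (Suc n) = t n + h (z n)" for n by (simp_all add: t_def)
  have t_less: "t n < t (Suc n)" for n using h_pos by (simp add: t_Suc)
  then have t_mono: "strict_mono t" by (simp add: strict_mono_Suc_iff)
  have t_nonneg: "0 \<le> t n" for n by (simp add: t_def sum_nonneg less_imp_le h_pos)
  \<comment> \<open>\<open>S n\<close> consists of the first \<open>n\<close> pieces and is
    meaningful on \<open>{0..t n}\<close>. \<open>S 0\<close> lives on the single point
    \<open>0\<close>, and derivatives are asserted only from \<open>n = 1\<close> on.\<close>
  define S where "S = rec_nat (\<lambda>_. y) (\<lambda>n Y s. if s \<in> {0..t n} then Y s else \<phi> (z n) (s - t n))"
  have S_0: "S 0 = (\<lambda>_. y)"
    and S_Suc: "S (Suc n) = (\<lambda>s. if s \<in> {0..t n} then S n s else \<phi> (z n) (s - t n))" for n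
    unfolding S_def by (simp, rule ext, simp)
  have S_end: "S n (t n) = z n" for n
  proof (cases n)
    case (Suc k) then show ?thesis using t_less[of k] by (simp add: S_Suc z_Suc t_Suc)
  qed (simp add: S_0 z_0)
  have sol: "S n s \<in> V \<and> (0 < n \<longrightarrow> (S n has_vector_derivative f (S n s)) (at s within {0..t n}))"
    if "s \<in> {0..t n}" for n s
    using that
  proof (induction n arbitrary: s)
    case 0 then show ?case using y by (simp add: S_0)
  next
    case (Suc n)
    have V: "\<phi> (z n) (s - t n) \<in> V" if "t n \<le> s" "s \<le> t (Suc n)" for s
      using \<phi>(2)[OF zV, of "s - t n" n] that by (simp add: t_Suc)
    have d: "((\<lambda>s. \<phi> (z n) (s - t n)) has_vector_derivative f (\<phi> (z n) (s - t n))) (at s within A)"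
      if "t n \<le> s" "s \<le> t (Suc n)" for s A
    proof -
      have "(\<phi> (z n) has_vector_derivative f (\<phi> (z n) (s - t n))) (at (s - t n))"
        using \<phi>(2)[OF zV, of "s - t n" n] that by (simp add: t_Suc)
      then have "((\<phi> (z n) \<circ> (\<lambda>s. s - t n)) has_vector_derivative 1 *\<^sub>R f (\<phi> (z n) (s - t n))) (at s within A)"
      proof (rule vector_diff_chain_within[rotated, OF has_vector_derivative_at_within])
        show "((\<lambda>s. s - t n) has_vector_derivative 1) (at s within A)"
          by (auto intro!: derivative_eq_intros)
      qed
      then show ?thesis by (simp add: o_def)
    qed
    have un: "{0..t (Suc n)} = {0..t n} \<union> {t n..t (Suc n)}"
      using t_nonneg[of n] t_less[of n] by auto
    have eq_end: "S n (t n) = \<phi> (z n) (t n - t n)" using S_end \<phi>(1)[OF zV] by simp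
    show ?case
    proof (intro conjI impI)
      show "S (Suc n) s \<in> V" using Suc V[of s] by (auto simp: S_Suc)
      show "(S (Suc n) has_vector_derivative f (S (Suc n) s)) (at s within {0..t (Suc n)})"
      proof (cases "n = 0")
        case True
        then have eq: "S (Suc n) s = \<phi> (z n) (s - t n)" if "s \<in> {0..t (Suc n)}" for s
          using that \<phi>(1)[OF y] by (auto simp: S_Suc S_0 t_0 z_0)
        show ?thesis unfolding eq[OF Suc.prems]
          by (rule has_vector_derivative_transform[OF Suc.prems eq d])
             (use Suc.prems True in \<open>auto simp: t_0\<close>)
      next
        case False
        \<comment> \<open>At the joint both pieces have the value \<open>z n\<close>, and the
          derivative is a function of the value; so the one-sided derivatives fit.\<close>
        have "((\<lambda>s. if s \<in> {0..t n} then S n s else \<phi> (z n) (s - t n)) has_vector_derivative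
           (if s \<in> {0..t n} then f (S n s) else f (\<phi> (z n) (s - t n)))) (at s within {0..t (Suc n)})"
        proof (rule has_vector_derivative_If_within_closures)
          show "s \<in> {0..t n} \<union> {t n..t (Suc n)}" using Suc.prems un by simp
          have cl: "{0..t n} \<union> closure {0..t n} \<inter> closure {t n..t (Suc n)} = {0..t n}"
            "{t n..t (Suc n)} \<union> closure {0..t n} \<inter> closure {t n..t (Suc n)} = {t n..t (Suc n)}"
            by auto
          show "(S n has_vector_derivative f (S n s)) (at s within {0..t n} \<union> closure {0..t n} \<inter> closure {t n..t (Suc n)})"
            if "s \<in> {0..t n} \<union> closure {0..t n} \<inter> closure {t n..t (Suc n)}"
            using Suc.IH[of s] that False unfolding cl by simp
          show "((\<lambda>s. \<phi> (z n) (s - t n)) has_vector_derivative f (\<phi> (z n) (s - t n)))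
              (at s within {t n..t (Suc n)} \<union> closure {0..t n} \<inter> closure {t n..t (Suc n)})"
            if "s \<in> {t n..t (Suc n)} \<union> closure {0..t n} \<inter> closure {t n..t (Suc n)}"
            using that unfolding cl by (intro d) auto
        next
          assume "s \<in> closure {0..t n}" "s \<in> closure {t n..t (Suc n)}"
          then have "s = t n" by auto
          then show "S n s = \<phi> (z n) (s - t n)" "f (S n s) = f (\<phi> (z n) (s - t n))"
            using eq_end by simp_all
        qed (rule un)
        then show ?thesis by (simp add: S_Suc if_distrib)
      qed
    qed
  qed
  have S_agree: "S m s = S n s" if "n \<le> m" "s \<in> {0..t n}" for m n s
    using that(1)
  proof (induction rule: dec_induct)
    case (step k)
    have "t n \<le> t k" using step(1) t_mono by (simp add: strict_mono_less_eq)
    then show ?case using step that(2) by (simp add: S_Suc)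
  qed simp
  define N where "N s = (LEAST n. s < t n)" for s
  define Y where "Y s = S (N s) s" for s
  define D where "D = {s. 0 \<le> s \<and> (\<exists>n. s < t n)}"
  have Y_eq: "Y s = S n s" if "0 \<le> s" "s < t n" for s n
  proof -
    have "s < t (N s)" "N s \<le> n" unfolding N_def using that(2) by (auto intro: LeastI Least_le)
    then show ?thesis unfolding Y_def using S_agree[of "N s" n s] that(1) by simp
  qed
  show thesis
  proof (rule that)
    show "Y 0 = y" using Y_eq[of 0 1] t_less[of 0] by (simp add: t_0 S_Suc S_0)
  next
    fix s assume "s \<in> D"
    then obtain n where n: "0 \<le> s" "s < t n" by (auto simp: D_def)
    have "0 < n" using n t_0 by (cases n) auto
    then have S: "S n s \<in> V" "(S n has_vector_derivative f (S n s)) (at s within {0..t n})"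
      using sol[of s n] n by auto
    have sub: "{0..<t n} \<subseteq> {0..t n}" by auto
    have "(Y has_vector_derivative f (S n s)) (at s within {0..<t n})"
      by (rule has_vector_derivative_transform[OF _ _ has_vector_derivative_within_subset[OF S(2) sub]])
         (use n Y_eq in auto)
    moreover have "at s within {0..<t n} = at s within D"
      using n by (intro at_within_nhd[of _ "{..<t n}"]) (auto simp: D_def)
    ultimately show "Y s \<in> V \<and> (Y has_vector_derivative f (Y s)) (at s within D)"
      using S(1) Y_eq[OF n] by simp
  next
    show "D = {0..} \<or> (\<exists>T>0. D = {0..<T})"
    proof (cases "bdd_above (range t)")
      case True
      have "D = {0..<Sup (range t)}"
        using less_cSup_iff[OF _ True] by (auto simp: D_def)
      moreover have "0 < Sup (range t)"
        using less_cSup_iff[OF _ True, of 0] t_less[of 0] by (auto simp: t_0)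
      ultimately show ?thesis by blast
    next
      case False
      then have "\<exists>n. x < t n" for x
        unfolding bdd_above_def by (metis not_less rangeE)
      then show ?thesis by (auto simp: D_def)
    qed
  next
    assume "bounded (Y ` D)"
    then obtain B where B: "\<And>s. s \<in> D \<Longrightarrow> norm (Y s) \<le> B" by (auto simp: bounded_iff)
    have "norm (z n) \<le> B" for n
    proof -
      have "t n \<in> D" using t_nonneg t_less by (auto simp: D_def)
      moreover have "Y (t n) = z n"
        using Y_eq[OF t_nonneg t_less] S_agree[of n "Suc n" "t n"] S_end t_nonneg by simp
      ultimately show ?thesis using B by metis
    qed
    then have zB: "norm (z n) \<le> B" for n by blast
    then have B: "0 \<le> B" using norm_ge_zero order_trans by blast
    have hB: "1 / (2 * K * (B + 1)) \<le> h (z n)" for n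
      unfolding h_def using K B zB[of n]
      by (intro divide_left_mono mult_left_mono mult_pos_pos) (auto simp: add_nonneg_pos)
    define c where "c = 1 / (2 * K * (B + 1))"
    have c: "0 < c" using K B by (simp add: c_def)
    have tn: "real n * c \<le> t n" for n
    proof (induction n)
      case (Suc n)
      have "real (Suc n) * c = real n * c + c" by (simp add: distrib_right)
      then show ?case using Suc hB[of n] t_Suc[of n] unfolding c_def by linarith
    qed (simp add: t_0)
    have "\<exists>n. x < t n" for x
    proof -
      obtain n where "x < real n * c" using c reals_Archimedean3 by blast
      then show ?thesis using tn less_le_trans by blast
    qed
    then show "D = {0..}" by (auto simp: D_def)
  qed
qed

section \<open>Rigidity of the curvature system\<close>

definition sum_third :: "real^'n::finite \<Rightarrow> real" where
  "sum_third l = - (\<Sum>j\<in>UNIV. l $ j) / 3"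

text \<open>A bilinear, not symmetrised map whose diagonal \<open>rot_field x x\<close> is the
  system for \<open>x = (l, w)\<close>.\<close>

definition rot_field :: "(real^'n::finite) \<times> (real^'n) \<Rightarrow> (real^'n) \<times> (real^'n) \<Rightarrow> (real^'n) \<times> (real^'n)" where
  "rot_field x y = ((\<chi> j. (sum_third (fst x) - fst x $ j) * snd y $ j),
                    (\<chi> j. - (snd x $ j) * (snd y $ j) - sum_third (fst x) * fst y $ j))"

definition sum_third_deriv :: "(real^'n::finite) \<times> (real^'n) \<Rightarrow> real" where
  "sum_third_deriv x = - (\<Sum>j\<in>UNIV. (sum_third (fst x) - fst x $ j) * snd x $ j) / 3"

text \<open>The difference between the second arc-length derivative of \<Lambda> that the system
  produces and the one that the normal equation prescribes.\<close>

definition rot_constraint :: "(real^'n::finite) \<times> (real^'n) \<Rightarrow> real" where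
  "rot_constraint x = lie rot_field sum_third_deriv x
     - (((sum_third (fst x))\<^sup>2 + (\<Sum>j\<in>UNIV. (fst x $ j)\<^sup>2)) * sum_third (fst x)
        - (\<Sum>j\<in>UNIV. snd x $ j) * sum_third_deriv x)"

lemma sum_third_add: "sum_third (x + y) = sum_third x + sum_third y"
  by (simp add: sum_third_def sum.distrib)

lemma sum_third_scale: "sum_third (c *\<^sub>R x) = c * sum_third x"
  by (simp add: sum_third_def sum_distrib_left[symmetric])

interpretation rot: quadratic_vector_field "rot_field :: (real^'n::finite) \<times> (real^'n) \<Rightarrow> _"
proof -
  have "bilinear (rot_field :: (real^'n) \<times> (real^'n) \<Rightarrow> _)"
    unfolding bilinear_def
    by (auto intro!: linearI simp: rot_field_def sum_third_add sum_third_scale vec_eq_iff algebra_simps)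
  then have "bounded_bilinear (rot_field :: (real^'n) \<times> (real^'n) \<Rightarrow> _)"
    by (simp add: bilinear_conv_bounded_bilinear)
  then show "quadratic_vector_field (rot_field :: (real^'n) \<times> (real^'n) \<Rightarrow> _)"
    by (simp add: quadratic_vector_field_def)
qed

lemma bounded_linear_fst_nth: "bounded_linear (\<lambda>x::(real^'n::finite) \<times> (real^'n). fst x $ j)"
  by (rule bounded_linear_compose[OF bounded_linear_vec_nth bounded_linear_fst, unfolded o_def])

lemma bounded_linear_snd_nth: "bounded_linear (\<lambda>x::(real^'n::finite) \<times> (real^'n). snd x $ j)"
  by (rule bounded_linear_compose[OF bounded_linear_vec_nth bounded_linear_snd, unfolded o_def])

lemma bounded_linear_sum_third: "bounded_linear (\<lambda>x::(real^'n::finite) \<times> (real^'n). sum_third (fst x))"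
  unfolding linear_conv_bounded_linear[symmetric]
  by (auto intro!: linearI simp: sum_third_add sum_third_scale)

lemma sum_third_deriv_polynomial:
  "real_polynomial_function (sum_third_deriv :: (real^'n::finite) \<times> (real^'n) \<Rightarrow> real)"
  unfolding sum_third_deriv_def[abs_def]
  by (intro real_polynomial_function_divide real_polynomial_function_minus real_polynomial_function_sum
      real_polynomial_function.intros(4) real_polynomial_function_diff
      real_polynomial_function.intros(1)[OF bounded_linear_sum_third]
      real_polynomial_function.intros(1)[OF bounded_linear_fst_nth]
      real_polynomial_function.intros(1)[OF bounded_linear_snd_nth] finite)

lemma rot_constraint_polynomial:
  "real_polynomial_function (rot_constraint :: (real^'n::finite) \<times> (real^'n) \<Rightarrow> real)"
  unfolding rot_constraint_def[abs_def]
  by (intro real_polynomial_function_sum real_polynomial_function.intros(3,4)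
      real_polynomial_function_diff real_polynomial_function_power
      rot.lie_polynomial sum_third_deriv_polynomial
      real_polynomial_function.intros(1)[OF bounded_linear_sum_third]
      real_polynomial_function.intros(1)[OF bounded_linear_fst_nth]
      real_polynomial_function.intros(1)[OF bounded_linear_snd_nth] finite)

lemma lie_sum_third: "lie rot_field (\<lambda>x. sum_third (fst x)) x = sum_third_deriv x"
  unfolding rot.lie_linear[OF bounded_linear_sum_third]
  by (simp add: rot_field_def sum_third_deriv_def sum_third_def)

text \<open>Membership in \<open>lie_zeros\<close> travels along the maximal solution; this turns
  algebraic conditions at one point into the equation \<open>m_deriv\<close> for all times.\<close>

lemma rot_no_positive_zero:
  fixes y :: "(real^'n::finite) \<times> (real^'n)"
  assumes y: "y \<in> rot.lie_zeros rot_constraint"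
    and pos: "0 < sum_third (fst y)" "0 < sum_third_deriv y"
  shows False
proof -
  obtain K where K: "0 < K" "\<And>a b. norm (rot_field a b :: (real^'n) \<times> (real^'n)) \<le> norm a * norm b * K"
    using rot.pos_bounded by blast
  have "\<exists>\<phi>. \<phi> 0 = z \<and> (\<forall>t. \<bar>t\<bar> < 1 / (K * (norm z + 1)) \<longrightarrow>
      (\<phi> has_vector_derivative rot_field (\<phi> t) (\<phi> t)) (at t) \<and> \<phi> t \<in> rot.lie_zeros rot_constraint)"
    if z: "z \<in> rot.lie_zeros rot_constraint" for z :: "(real^'n) \<times> (real^'n)"
  proof -
    \<comment> \<open>The added \<open>1\<close> keeps the radius bound positive at
      \<open>z = 0\<close>.\<close>
    have "norm z \<le> norm z + 1" "0 < norm z + 1" by (auto simp: add_nonneg_pos)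
    from rot.local_solution_in_lie_zeros[OF K(2,1) rot_constraint_polynomial z this]
    show ?thesis by metis
  qed
  from maximal_solution[OF K(1) y this] obtain D Y where
    D: "D = {0..} \<or> (\<exists>T>0. D = {0..<T})" and Y0: "Y 0 = y" and
    Y: "\<And>t. t \<in> D \<Longrightarrow> Y t \<in> rot.lie_zeros rot_constraint \<and>
          (Y has_vector_derivative rot_field (Y t) (Y t)) (at t within D)" and
    max: "bounded (Y ` D) \<Longrightarrow> D = {0..}"
    by metis
  have lin: "((\<lambda>t. g (Y t)) has_real_derivative g (rot_field (Y t) (Y t))) (at t within D)"
    if "bounded_linear g" "t \<in> D" for g t
    using bounded_linear.has_vector_derivative[OF that(1)] Y[OF that(2)]
    by (simp add: has_real_derivative_iff_has_vector_derivative)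
  have C0: "rot_constraint (Y t) = 0" if "t \<in> D" for t
  proof -
    have "(lie rot_field ^^ 0) rot_constraint (Y t) = 0"
      using Y[OF that] unfolding rot.lie_zeros_def by blast
    then show ?thesis by simp
  qed
  interpret rotating_system D "\<lambda>j t. fst (Y t) $ j" "\<lambda>j t. snd (Y t) $ j"
    "\<lambda>t. sum_third (fst (Y t))" "\<lambda>t. sum_third_deriv (Y t)"
  proof
    fix t j assume t: "t \<in> D"
    show "((\<lambda>t. fst (Y t) $ j) has_real_derivative
        (sum_third (fst (Y t)) - fst (Y t) $ j) * snd (Y t) $ j) (at t within D)"
      using lin[OF bounded_linear_fst_nth t, of j] by (simp add: rot_field_def)
    show "((\<lambda>t. snd (Y t) $ j) has_real_derivative
        - (snd (Y t) $ j)\<^sup>2 - sum_third (fst (Y t)) * fst (Y t) $ j) (at t within D)"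
      using lin[OF bounded_linear_snd_nth t, of j] by (simp add: rot_field_def power2_eq_square)
  next
    fix t assume t: "t \<in> D"
    show "((\<lambda>t. sum_third (fst (Y t))) has_real_derivative sum_third_deriv (Y t)) (at t within D)"
      using lin[OF bounded_linear_sum_third t] unfolding rot.lie_linear[OF bounded_linear_sum_third, symmetric]
        lie_sum_third .
    have "((\<lambda>t. sum_third_deriv (Y t)) has_real_derivative 1 * lie rot_field sum_third_deriv (Y t)) (at t within D)"
      by (rule rot.lie_has_derivative[OF sum_third_deriv_polynomial]) (use Y[OF t] in simp)
    then show "((\<lambda>t. sum_third_deriv (Y t)) has_real_derivative
        ((sum_third (fst (Y t)))\<^sup>2 + (\<Sum>j\<in>UNIV. (fst (Y t) $ j)\<^sup>2)) * sum_third (fst (Y t))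
        - (\<Sum>j\<in>UNIV. snd (Y t) $ j) * sum_third_deriv (Y t)) (at t within D)"
      using C0[OF t] by (simp add: rot_constraint_def)
    show "sum_third (fst (Y t)) = - (\<Sum>j\<in>UNIV. fst (Y t) $ j) / 3" by (simp add: sum_third_def)
  next
    fix B assume B: "\<And>t j. t \<in> D \<Longrightarrow> \<bar>fst (Y t) $ j\<bar> \<le> B \<and> \<bar>snd (Y t) $ j\<bar> \<le> B"
    have "norm (Y t) \<le> real CARD('n) * B + real CARD('n) * B" if "t \<in> D" for t
    proof -
      have "norm (Y t) \<le> norm (fst (Y t)) + norm (snd (Y t))"
        by (metis norm_Pair_le prod.collapse)
      also have "norm (fst (Y t)) \<le> (\<Sum>j\<in>(UNIV::'n set). B)"
        by (rule order_trans[OF norm_le_l1_cart sum_mono]) (use B[OF that] in auto)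
      also have "norm (snd (Y t)) \<le> (\<Sum>j\<in>(UNIV::'n set). B)"
        by (rule order_trans[OF norm_le_l1_cart sum_mono]) (use B[OF that] in auto)
      finally show ?thesis by simp
    qed
    then show "D = {0..}" by (intro max) (auto simp: bounded_iff)
  qed (use D pos in \<open>auto simp: Y0\<close>)
  show False by (rule no_global_solution)
qed

lemma has_vector_derivative_vec:
  assumes "\<And>j. (f j has_real_derivative d j) (at t within S)"
  shows "((\<lambda>t. \<chi> j::'n::finite. f j t) has_vector_derivative (\<chi> j. d j)) (at t within S)"
proof -
  have "(f j has_derivative (\<lambda>x. x * d j)) (at t within S)" for j
    using assms[of j] by (rule has_derivative_eq_rhs[OF has_field_derivative_imp_has_derivative]) auto
  then show ?thesis
    unfolding has_vector_derivative_def
    by (subst has_derivative_componentwise_within) (auto simp: Basis_vec_def inner_axis)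
qed

text \<open>A function that vanishes on the whole curve has zero derivative there, and this
  derivative is \<open>e\<close> times its Lie derivative. Dividing by \<open>e\<close> again and
  again places the points of the curve in \<open>lie_zeros\<close>, with no more than
  differentiability of the data.\<close>

lemma quadratic_system_rigidity_pos:
  fixes l w :: "'n::finite \<Rightarrow> real \<Rightarrow> real"
  assumes e: "\<And>t. t \<in> {a<..<b} \<Longrightarrow> e t \<noteq> 0"
    and l: "\<And>t j. t \<in> {a<..<b} \<Longrightarrow> (l j has_real_derivative e t * ((L t - l j t) * w j t)) (at t)"
    and w: "\<And>t j. t \<in> {a<..<b} \<Longrightarrow> (w j has_real_derivative e t * (- (w j t)\<^sup>2 - L t * l j t)) (at t)"
    and L: "\<And>t. t \<in> {a<..<b} \<Longrightarrow> L t = - (\<Sum>j\<in>UNIV. l j t) / 3"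
    and m: "\<And>t. t \<in> {a<..<b} \<Longrightarrow> m t = - (\<Sum>j\<in>UNIV. (L t - l j t) * w j t) / 3"
    and m': "\<And>t. t \<in> {a<..<b} \<Longrightarrow> (m has_real_derivative
        e t * (((L t)\<^sup>2 + (\<Sum>j\<in>UNIV. (l j t)\<^sup>2)) * L t - (\<Sum>j\<in>UNIV. w j t) * m t)) (at t)"
    and t: "t \<in> {a<..<b}" and pos: "0 < L t" "0 < m t"
  shows False
proof -
  define y where "y t = ((\<chi> j. l j t), (\<chi> j. w j t))" for t
  have Ly: "sum_third (fst (y s)) = L s" if "s \<in> {a<..<b}" for s
    using L[OF that] by (simp add: y_def sum_third_def)
  have my: "sum_third_deriv (y s) = m s" if "s \<in> {a<..<b}" for s
    using m[OF that] by (simp add: sum_third_deriv_def Ly[OF that]) (simp add: y_def)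
  have y': "(y has_vector_derivative e s *\<^sub>R rot_field (y s) (y s)) (at s)" if s: "s \<in> {a<..<b}" for s
  proof -
    have 1: "((\<lambda>t. \<chi> j. l j t) has_vector_derivative (\<chi> j. e s * ((L s - l j s) * w j s))) (at s)"
      using l[OF s] by (rule has_vector_derivative_vec)
    have 2: "((\<lambda>t. \<chi> j. w j t) has_vector_derivative (\<chi> j. e s * (- (w j s)\<^sup>2 - L s * l j s))) (at s)"
      using w[OF s] by (rule has_vector_derivative_vec)
    have "e s *\<^sub>R rot_field (y s) (y s)
        = ((\<chi> j. e s * ((L s - l j s) * w j s)), (\<chi> j. e s * (- (w j s)\<^sup>2 - L s * l j s)))"
      using Ly[OF s] by (simp add: rot_field_def y_def vec_eq_iff power2_eq_square)
    then show ?thesis using has_vector_derivative_Pair[OF 1 2] by (simp add: y_def[abs_def])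
  qed
  have zero: "(lie rot_field ^^ k) rot_constraint (y s) = 0" if "s \<in> {a<..<b}" for k s
    using that
  proof (induction k arbitrary: s)
    case 0
    have "((\<lambda>t. sum_third_deriv (y t)) has_real_derivative e s * lie rot_field sum_third_deriv (y s)) (at s)"
      by (rule rot.lie_has_derivative[OF sum_third_deriv_polynomial y'[OF 0]])
    then have "(m has_real_derivative e s * lie rot_field sum_third_deriv (y s)) (at s)"
      by (rule has_field_derivative_transform_within_open[where S = "{a<..<b}"]) (use 0 my in auto)
    from DERIV_unique[OF this m'[OF 0]] e[OF 0]
    have "lie rot_field sum_third_deriv (y s)
        = ((L s)\<^sup>2 + (\<Sum>j\<in>UNIV. (l j s)\<^sup>2)) * L s - (\<Sum>j\<in>UNIV. w j s) * m s"
      by simp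
    then show ?case by (simp add: rot_constraint_def Ly[OF 0] my[OF 0]) (simp add: y_def)
  next
    case (Suc k)
    have "((\<lambda>t. (lie rot_field ^^ k) rot_constraint (y t)) has_real_derivative
        e s * lie rot_field ((lie rot_field ^^ k) rot_constraint) (y s)) (at s)"
      by (rule rot.lie_has_derivative[OF rot.lie_power_polynomial[OF rot_constraint_polynomial] y'[OF Suc.prems]])
    then have "((\<lambda>t. 0) has_real_derivative
        e s * lie rot_field ((lie rot_field ^^ k) rot_constraint) (y s)) (at s)"
      by (rule has_field_derivative_transform_within_open[where S = "{a<..<b}"]) (use Suc in auto)
    from DERIV_unique[OF this DERIV_const] e[OF Suc.prems] show ?case by simp
  qed
  show False
    by (rule rot_no_positive_zero[of "y t"]) (use t zero pos Ly my in \<open>auto simp: rot.lie_zeros_def\<close>)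
qed

text \<open>The signs of \<open>L\<close> and \<open>m\<close> are normalised by the symmetries \<open>(l, w, e) \<mapsto> (- l, w, e)\<close> and
  \<open>(l, w, e) \<mapsto> (l, - w, - e)\<close>; the second one reverses time, which is why \<open>e\<close> may be negative.\<close>

theorem quadratic_system_rigidity:
  fixes l w :: "'n::finite \<Rightarrow> real \<Rightarrow> real"
  assumes e: "\<And>t. t \<in> {a<..<b} \<Longrightarrow> e t \<noteq> 0"
    and l: "\<And>t j. t \<in> {a<..<b} \<Longrightarrow> (l j has_real_derivative e t * ((L t - l j t) * w j t)) (at t)"
    and w: "\<And>t j. t \<in> {a<..<b} \<Longrightarrow> (w j has_real_derivative e t * (- (w j t)\<^sup>2 - L t * l j t)) (at t)"
    and L: "\<And>t. t \<in> {a<..<b} \<Longrightarrow> L t = - (\<Sum>j\<in>UNIV. l j t) / 3"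
    and m: "\<And>t. t \<in> {a<..<b} \<Longrightarrow> m t = - (\<Sum>j\<in>UNIV. (L t - l j t) * w j t) / 3"
    and m': "\<And>t. t \<in> {a<..<b} \<Longrightarrow> (m has_real_derivative
        e t * (((L t)\<^sup>2 + (\<Sum>j\<in>UNIV. (l j t)\<^sup>2)) * L t - (\<Sum>j\<in>UNIV. w j t) * m t)) (at t)"
    and t: "t \<in> {a<..<b}"
  shows "L t = 0 \<or> m t = 0"
proof (rule ccontr)
  assume nz: "\<not> (L t = 0 \<or> m t = 0)"
  \<comment> \<open>\<open>p * q\<close> is the sign of \<open>m t\<close>, so both rescaled
    quantities are positive at \<open>t\<close>; \<open>p\<close> and \<open>q\<close> are
    constants, and their squares cancel in the equations.\<close>
  define p q where "p = sgn (L t)" and "q = sgn (L t * m t)"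
  have p: "p * p = 1" and q: "q * q = 1" using nz by (auto simp: p_def q_def sgn_mult sgn_if)
  show False
  proof (rule quadratic_system_rigidity_pos[where l = "\<lambda>j t. p * l j t" and w = "\<lambda>j t. q * w j t"
        and L = "\<lambda>t. p * L t" and m = "\<lambda>t. p * q * m t" and e = "\<lambda>t. q * e t"])
    fix s assume s: "s \<in> {a<..<b}"
    show "q * e s \<noteq> 0" using e[OF s] q by auto
    show "((\<lambda>t. p * l j t) has_real_derivative q * e s * ((p * L s - p * l j s) * (q * w j s))) (at s)" for j
    proof -
      have "q * e s * ((p * L s - p * l j s) * (q * w j s)) = p * (e s * ((L s - l j s) * w j s))"
        using q by algebra
      then show ?thesis using DERIV_cmult[OF l[OF s], of p j] by (simp only:)
    qed
    show "((\<lambda>t. q * w j t) has_real_derivative q * e s * (- (q * w j s)\<^sup>2 - p * L s * (p * l j s))) (at s)" for j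
    proof -
      have "q * e s * (- (q * w j s)\<^sup>2 - p * L s * (p * l j s)) = q * (e s * (- (w j s)\<^sup>2 - L s * l j s))"
        using p q by algebra
      then show ?thesis using DERIV_cmult[OF w[OF s], of q j] by (simp only:)
    qed
    show "p * L s = - (\<Sum>j\<in>UNIV. p * l j s) / 3"
      using L[OF s] by (simp add: sum_distrib_left[symmetric])
    show "p * q * m s = - (\<Sum>j\<in>UNIV. (p * L s - p * l j s) * (q * w j s)) / 3"
    proof -
      have "(\<Sum>j\<in>UNIV. (p * L s - p * l j s) * (q * w j s)) = p * q * (\<Sum>j\<in>UNIV. (L s - l j s) * w j s)"
        by (simp add: sum_distrib_left algebra_simps)
      then show ?thesis using m[OF s] by simp
    qed
    define A B where "A = (\<Sum>j\<in>UNIV. (l j s)\<^sup>2)" and "B = (\<Sum>j\<in>UNIV. w j s)"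
    have "(\<Sum>j\<in>UNIV. (p * l j s)\<^sup>2) = A"
      using p by (simp add: A_def power_mult_distrib) (simp add: power2_eq_square)
    moreover have "(\<Sum>j\<in>UNIV. q * w j s) = q * B" by (simp add: B_def sum_distrib_left)
    moreover have "q * e s * (((p * L s)\<^sup>2 + A) * (p * L s) - q * B * (p * q * m s))
       = p * q * (e s * (((L s)\<^sup>2 + A) * L s - B * m s))"
      using p q by algebra
    ultimately show "((\<lambda>t. p * q * m t) has_real_derivative q * e s * (((p * L s)\<^sup>2 + (\<Sum>j\<in>UNIV. (p * l j s)\<^sup>2)) * (p * L s)
        - (\<Sum>j\<in>UNIV. q * w j s) * (p * q * m s))) (at s)"
      using DERIV_cmult[OF m'[OF s], of "p * q"] unfolding A_def B_def by (simp only:)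
  next
    show "0 < p * L t" "0 < p * q * m t"
      using nz by (auto simp: p_def q_def sgn_mult sgn_if zero_less_mult_iff)
  qed (rule t)
qed

section \<open>Smooth functions and partial derivatives\<close>

declare C_k_on.simps(2) [simp del]

lemmas C_k_on_Suc = C_k_on.simps(2)

lemma has_derivative_cong_open:
  assumes "open U" "x \<in> U" "\<And>y. y \<in> U \<Longrightarrow> f y = g y"
  shows "(f has_derivative D) (at x) \<longleftrightarrow> (g has_derivative D) (at x)"
  using assms has_derivative_transform_within_open[of f D x UNIV U g]
    has_derivative_transform_within_open[of g D x UNIV U f] by auto

lemma frechet_derivative_cong_open:
  assumes "open U" "x \<in> U" "\<And>y. y \<in> U \<Longrightarrow> f y = g y"
  shows "frechet_derivative f (at x) = frechet_derivative g (at x)"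
  unfolding frechet_derivative_def using has_derivative_cong_open[OF assms] by simp

lemma differentiable_cong_open:
  assumes "open U" "x \<in> U" "\<And>y. y \<in> U \<Longrightarrow> f y = g y"
  shows "f differentiable at x \<longleftrightarrow> g differentiable at x"
  unfolding differentiable_def using has_derivative_cong_open[OF assms] by simp

lemma C_k_on_cong:
  assumes "open U" "\<And>x. x \<in> U \<Longrightarrow> f x = g x"
  shows "C_k_on k U f \<longleftrightarrow> C_k_on k U g"
  using assms
proof (induction k arbitrary: f g)
  case 0 then show ?case by (metis C_k_on.simps(1) continuous_on_cong)
next
  case (Suc k)
  have "C_k_on k U (\<lambda>x. frechet_derivative f (at x) v) \<longleftrightarrow> C_k_on k U (\<lambda>x. frechet_derivative g (at x) v)" for v
  proof (rule Suc.IH[OF Suc.prems(1)])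
    fix x assume "x \<in> U"
    show "frechet_derivative f (at x) v = frechet_derivative g (at x) v"
      by (subst frechet_derivative_cong_open[OF Suc.prems(1) \<open>x \<in> U\<close> Suc.prems(2)]) auto
  qed
  moreover have "f differentiable at x \<longleftrightarrow> g differentiable at x" if "x \<in> U" for x
    using differentiable_cong_open Suc.prems that by blast
  ultimately show ?case by (simp add: C_k_on_Suc)
qed

lemma C_k_on_Suc_imp: "C_k_on (Suc k) U f \<Longrightarrow> C_k_on k U f"
proof (induction k arbitrary: f)
  case 0
  then show ?case
    by (auto simp: C_k_on_Suc intro!: continuous_at_imp_continuous_on differentiable_imp_continuous_within)
next
  case (Suc k)
  have "C_k_on k U (\<lambda>x. frechet_derivative f (at x) v)" for v
    using Suc.prems unfolding C_k_on_Suc[of "Suc k"] by (intro Suc.IH) blast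
  moreover have "\<forall>x\<in>U. f differentiable at x" using Suc.prems unfolding C_k_on_Suc[of "Suc k"] by blast
  ultimately show ?case by (simp add: C_k_on_Suc[of k])
qed

lemma frechet_derivative_eqI:
  "(f has_derivative f') (at x) \<Longrightarrow> frechet_derivative f (at x) v = f' v"
  by (metis frechet_derivative_at)

lemma C_k_on_SucI:
  assumes U: "open U" and f: "\<And>x. x \<in> U \<Longrightarrow> (f has_derivative f' x) (at x)"
    and "\<And>v. C_k_on k U (\<lambda>x. f' x v)"
  shows "C_k_on (Suc k) U f"
proof -
  have "C_k_on k U (\<lambda>x. frechet_derivative f (at x) v)" for v
    by (rule C_k_on_cong[OF U frechet_derivative_eqI[OF f], THEN iffD2, OF _ assms(3)])
  then show ?thesis using f by (auto simp: C_k_on_Suc differentiable_def)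
qed

lemma C_k_on_SucD:
  assumes "C_k_on (Suc k) U f"
  shows "x \<in> U \<Longrightarrow> (f has_derivative frechet_derivative f (at x)) (at x)"
    and "C_k_on k U (\<lambda>x. frechet_derivative f (at x) v)"
  using assms frechet_derivative_works unfolding C_k_on_Suc by blast+

lemma C_k_on_const: "open U \<Longrightarrow> C_k_on k U (\<lambda>x. c)"
proof (induction k arbitrary: c)
  case (Suc k)
  show ?case by (rule C_k_on_SucI[OF Suc.prems has_derivative_const Suc.IH[OF Suc.prems]])
qed simp

lemma C_k_on_add:
  assumes U: "open U" shows "C_k_on k U f \<Longrightarrow> C_k_on k U g \<Longrightarrow> C_k_on k U (\<lambda>x. f x + g x)"
proof (induction k arbitrary: f g)
  case 0 then show ?case by (simp add: continuous_on_add)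
next
  case (Suc k)
  show ?case
    by (rule C_k_on_SucI[OF U has_derivative_add[OF C_k_on_SucD(1)[OF Suc.prems(1)] C_k_on_SucD(1)[OF Suc.prems(2)]]])
       (assumption+, rule Suc.IH[OF C_k_on_SucD(2)[OF Suc.prems(1)] C_k_on_SucD(2)[OF Suc.prems(2)]])
qed

text \<open>One induction serves products and inner products alike. The product rule leaves one
  factor without derivative, so class \<open>Suc k\<close> has to be lowered to \<open>k\<close> for
  it.\<close>

lemma C_k_on_bilinear:
  assumes B: "bounded_bilinear B" and U: "open U"
  shows "C_k_on k U f \<Longrightarrow> C_k_on k U g \<Longrightarrow> C_k_on k U (\<lambda>x. B (f x) (g x))"
proof (induction k arbitrary: f g)
  case 0 then show ?case by (simp add: bounded_bilinear.continuous_on[OF B])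
next
  case (Suc k)
  show ?case
    by (rule C_k_on_SucI[OF U bounded_bilinear.FDERIV[OF B C_k_on_SucD(1)[OF Suc.prems(1)] C_k_on_SucD(1)[OF Suc.prems(2)]]])
       (assumption+, intro C_k_on_add[OF U] Suc.IH C_k_on_SucD(2)[OF Suc.prems(1)] C_k_on_SucD(2)[OF Suc.prems(2)]
          C_k_on_Suc_imp[OF Suc.prems(1)] C_k_on_Suc_imp[OF Suc.prems(2)])
qed

text \<open>The derivative is a product of the derivative of \<open>f\<close> with two copies of the
  inverse itself, which is of class \<open>k\<close> by induction for the same
  \<open>f\<close>.\<close>

lemma C_k_on_inverse:
  fixes f :: "'a::real_normed_vector \<Rightarrow> real"
  assumes U: "open U" shows "C_k_on k U f \<Longrightarrow> (\<And>x. x \<in> U \<Longrightarrow> f x \<noteq> 0) \<Longrightarrow> C_k_on k U (\<lambda>x. inverse (f x))"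
proof (induction k)
  case 0 then show ?case by (auto intro: continuous_on_inverse)
next
  case (Suc k)
  have inv: "C_k_on k U (\<lambda>x. inverse (f x))"
    using Suc.IH[OF C_k_on_Suc_imp[OF Suc.prems(1)]] Suc.prems(2) by blast
  have d: "((\<lambda>x. inverse (f x)) has_derivative
      (\<lambda>v. (-1) * (inverse (f x) * (frechet_derivative f (at x) v * inverse (f x))))) (at x)" if "x \<in> U" for x
    using Deriv.has_derivative_inverse[OF Suc.prems(2)[OF that] C_k_on_SucD(1)[OF Suc.prems(1) that]] by (simp add: mult.assoc)
  show ?case
    by (rule C_k_on_SucI[OF U d])
       (assumption, intro C_k_on_bilinear[OF bounded_bilinear_mult U] C_k_on_const[OF U] inv
         C_k_on_SucD(2)[OF Suc.prems(1)])
qed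

lemma smooth_on_differentiable: "smooth_on U f \<Longrightarrow> x \<in> U \<Longrightarrow> f differentiable at x"
  unfolding smooth_on_def by (metis C_k_on_Suc)

lemma smooth_on_continuous: "smooth_on U f \<Longrightarrow> continuous_on U f"
  unfolding smooth_on_def by (metis C_k_on.simps(1))

lemma smooth_on_pd: "smooth_on U f \<Longrightarrow> smooth_on U (pd i f)"
  unfolding smooth_on_def pd_def[abs_def] by (metis C_k_on_Suc)

lemma smooth_on_const: "open U \<Longrightarrow> smooth_on U (\<lambda>x. c)"
  by (simp add: smooth_on_def C_k_on_const)

lemma smooth_on_add: "open U \<Longrightarrow> smooth_on U f \<Longrightarrow> smooth_on U g \<Longrightarrow> smooth_on U (\<lambda>x. f x + g x)"
  by (simp add: smooth_on_def C_k_on_add)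

lemma smooth_on_mult:
  fixes f g :: "'a::euclidean_space \<Rightarrow> real"
  shows "open U \<Longrightarrow> smooth_on U f \<Longrightarrow> smooth_on U g \<Longrightarrow> smooth_on U (\<lambda>x. f x * g x)"
  by (simp add: smooth_on_def C_k_on_bilinear[OF bounded_bilinear_mult])

lemma smooth_on_inner: "open U \<Longrightarrow> smooth_on U f \<Longrightarrow> smooth_on U g \<Longrightarrow> smooth_on U (\<lambda>x. f x \<bullet> g x)"
  by (simp add: smooth_on_def C_k_on_bilinear[OF bounded_bilinear_inner])

lemma smooth_on_divide:
  fixes f g :: "'a::euclidean_space \<Rightarrow> real"
  shows "open U \<Longrightarrow> smooth_on U f \<Longrightarrow> smooth_on U g \<Longrightarrow> (\<And>x. x \<in> U \<Longrightarrow> g x \<noteq> 0) \<Longrightarrow> smooth_on U (\<lambda>x. f x / g x)"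
  by (simp add: divide_inverse smooth_on_mult) (simp add: smooth_on_def C_k_on_inverse
      C_k_on_bilinear[OF bounded_bilinear_mult])

lemma smooth_on_sum:
  "open U \<Longrightarrow> (\<And>i. i \<in> I \<Longrightarrow> smooth_on U (f i)) \<Longrightarrow> smooth_on U (\<lambda>x. \<Sum>i\<in>I. f i x)"
  by (induction I rule: infinite_finite_induct) (auto intro: smooth_on_const smooth_on_add)

section \<open>Calculus of partial derivatives\<close>

lemma pd_eqI: "(f has_derivative f') (at x) \<Longrightarrow> pd i f x = f' (axis i 1)"
  unfolding pd_def by (rule frechet_derivative_eqI)

lemma pd_cong:
  assumes "open U" "x \<in> U" "\<And>y. y \<in> U \<Longrightarrow> f y = g y" shows "pd i f x = pd i g x"
  unfolding pd_def by (subst frechet_derivative_cong_open[OF assms]) auto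

lemma differentiable_has_derivative:
  "f differentiable at x \<Longrightarrow> (f has_derivative frechet_derivative f (at x)) (at x)"
  by (simp add: frechet_derivative_works)

lemma pd_const [simp]: "pd i (\<lambda>x. c) x = 0"
  by (simp add: pd_def)

lemma pd_bilinear:
  assumes "bounded_bilinear B" "f differentiable at x" "g differentiable at x"
  shows "pd i (\<lambda>x. B (f x) (g x)) x = B (f x) (pd i g x) + B (pd i f x) (g x)"
  unfolding pd_eqI[OF bounded_bilinear.FDERIV[OF assms(1) assms(2,3)[THEN differentiable_has_derivative]]]
  by (simp add: pd_def)

lemmas pd_mult = pd_bilinear[OF bounded_bilinear_mult]
lemmas pd_inner = pd_bilinear[OF bounded_bilinear_inner]
lemmas pd_scaleR = pd_bilinear[OF bounded_bilinear_scaleR]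

lemma pd_minus: "f differentiable at x \<Longrightarrow> pd i (\<lambda>x. - f x) x = - pd i f x"
  by (simp add: pd_eqI[OF has_derivative_minus[OF differentiable_has_derivative]]) (simp add: pd_def)

lemma pd_sum:
  assumes "\<And>j. j \<in> I \<Longrightarrow> f j differentiable at x"
  shows "pd i (\<lambda>x. \<Sum>j\<in>I. f j x) x = (\<Sum>j\<in>I. pd i (f j) x)"
  by (subst pd_eqI[OF has_derivative_sum[OF differentiable_has_derivative]]) (auto simp: pd_def assms)

lemma pd_compose_real:
  fixes f :: "real^'n::finite \<Rightarrow> real"
  assumes "f differentiable at x" "(g has_real_derivative g') (at (f x))"
  shows "pd i (\<lambda>x. g (f x)) x = g' * pd i f x" and "(\<lambda>x. g (f x)) differentiable at x"
proof -
  have "((\<lambda>x. g (f x)) has_derivative (\<lambda>v. g' * frechet_derivative f (at x) v)) (at x)"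
    using diff_chain_at[OF differentiable_has_derivative[OF assms(1)] assms(2)[unfolded has_field_derivative_def]]
    by (simp add: o_def)
  then show "pd i (\<lambda>x. g (f x)) x = g' * pd i f x" "(\<lambda>x. g (f x)) differentiable at x"
    by (auto simp: pd_eqI differentiable_def) (simp add: pd_def)
qed

lemma line_derivative:
  assumes "f differentiable at (p + t *\<^sub>R axis k 1)"
  shows "((\<lambda>t. f (p + t *\<^sub>R axis k 1)) has_vector_derivative pd k f (p + t *\<^sub>R axis k 1)) (at t within S)"
proof -
  let ?f' = "frechet_derivative f (at (p + t *\<^sub>R axis k 1))"
  have f: "(f has_derivative ?f') (at (p + t *\<^sub>R axis k 1))"
    using assms by (rule differentiable_has_derivative)
  have "((\<lambda>t. p + t *\<^sub>R axis k 1) has_derivative (\<lambda>s. s *\<^sub>R axis k 1)) (at t within S)"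
    by (auto intro!: derivative_eq_intros)
  from has_derivative_compose[OF this f]
  have "((\<lambda>t. f (p + t *\<^sub>R axis k 1)) has_derivative (\<lambda>s. ?f' (s *\<^sub>R axis k 1))) (at t within S)" .
  then show ?thesis
    by (simp add: has_vector_derivative_def pd_def linear_cmul[OF has_derivative_linear[OF f]])
qed

lemma line_derivative_real:
  fixes f :: "real^'n::finite \<Rightarrow> real"
  assumes "f differentiable at (p + t *\<^sub>R axis k 1)"
  shows "((\<lambda>t. f (p + t *\<^sub>R axis k 1)) has_real_derivative pd k f (p + t *\<^sub>R axis k 1)) (at t within S)"
  using line_derivative[OF assms] by (simp add: has_real_derivative_iff_has_vector_derivative)

section \<open>Symmetry of second partial derivatives\<close>

lemma mixed_difference:
  fixes f :: "real^'n::finite \<Rightarrow> real"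
  assumes f: "smooth_on U f" and U: "ball p (3 * h) \<subseteq> U" and h: "0 < h"
  obtains q where "q \<in> ball p (3 * h)"
    "f (p + h *\<^sub>R axis i 1 + h *\<^sub>R axis j 1) - f (p + h *\<^sub>R axis i 1) - f (p + h *\<^sub>R axis j 1) + f p
       = h * h * pd j (pd i f) q"
proof -
  \<comment> \<open>These points are at distance at most \<open>2 * h\<close> from \<open>p\<close>,
    strictly inside the ball of radius \<open>3 * h\<close>.\<close>
  have inU: "p + s *\<^sub>R axis i 1 + t *\<^sub>R axis j 1 \<in> ball p (3 * h)" if "0 \<le> s" "s \<le> h" "0 \<le> t" "t \<le> h" for s t
  proof -
    have "norm (s *\<^sub>R axis i 1 + t *\<^sub>R axis j (1::real) :: real^'n) \<le> s + t"
      using norm_triangle_ineq[of "s *\<^sub>R axis i 1 :: real^'n" "t *\<^sub>R axis j 1"] that by (simp add: norm_axis_1)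
    then show ?thesis using that h by (simp add: dist_norm norm_minus_commute algebra_simps)
  qed
  have diff: "f differentiable at x" "pd i f differentiable at x" if "x \<in> ball p (3 * h)" for x
    using that U f smooth_on_pd[OF f] smooth_on_differentiable by blast+
  define \<phi> where "\<phi> s = f ((p + h *\<^sub>R axis j 1) + s *\<^sub>R axis i 1) - f (p + s *\<^sub>R axis i 1)" for s
  have \<phi>': "(\<phi> has_real_derivative
      pd i f ((p + h *\<^sub>R axis j 1) + s *\<^sub>R axis i 1) - pd i f (p + s *\<^sub>R axis i 1)) (at s)"
    if "0 \<le> s" "s \<le> h" for s
    unfolding \<phi>_def using inU[of s h] inU[of s 0] that h
    by (intro DERIV_diff line_derivative_real diff) (auto simp: add_ac)
  from MVT2[OF h \<phi>'] obtain s where s: "0 < s" "s < h" "\<phi> h - \<phi> 0 = (h - 0) *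
      (pd i f ((p + h *\<^sub>R axis j 1) + s *\<^sub>R axis i 1) - pd i f (p + s *\<^sub>R axis i 1))"
    by blast
  define \<psi> where "\<psi> t = pd i f ((p + s *\<^sub>R axis i 1) + t *\<^sub>R axis j 1)" for t
  have \<psi>': "(\<psi> has_real_derivative pd j (pd i f) ((p + s *\<^sub>R axis i 1) + t *\<^sub>R axis j 1)) (at t)"
    if "0 \<le> t" "t \<le> h" for t
    unfolding \<psi>_def using inU[of s t] that s by (intro line_derivative_real diff) auto
  from MVT2[OF h \<psi>'] obtain t where t: "0 < t" "t < h"
    "\<psi> h - \<psi> 0 = (h - 0) * pd j (pd i f) ((p + s *\<^sub>R axis i 1) + t *\<^sub>R axis j 1)"
    by blast
  show thesis
  proof (rule that[of "p + s *\<^sub>R axis i 1 + t *\<^sub>R axis j 1"])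
    show "p + s *\<^sub>R axis i 1 + t *\<^sub>R axis j 1 \<in> ball p (3 * h)" using inU s t by simp
    have "\<phi> h - \<phi> 0 = h * (\<psi> h - \<psi> 0)" using s(3) by (simp add: \<psi>_def add_ac)
    then show "f (p + h *\<^sub>R axis i 1 + h *\<^sub>R axis j 1) - f (p + h *\<^sub>R axis i 1) - f (p + h *\<^sub>R axis j 1) + f p
       = h * h * pd j (pd i f) (p + s *\<^sub>R axis i 1 + t *\<^sub>R axis j 1)"
      unfolding t(3) by (simp add: \<phi>_def add_ac mult.assoc)
  qed
qed

text \<open>The second difference is symmetric in \<open>i\<close> and \<open>j\<close>, so both
  mixed derivatives attain the same value arbitrarily close to \<open>p\<close>; continuity does the
  rest.\<close>

lemma pd_commute_real:
  fixes f :: "real^'n::finite \<Rightarrow> real"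
  assumes U: "open U" "p \<in> U" and f: "smooth_on U f"
  shows "pd i (pd j f) p = pd j (pd i f) p"
proof (rule ccontr)
  define A where "A = pd i (pd j f)"
  define B where "B = pd j (pd i f)"
  assume "pd i (pd j f) p \<noteq> pd j (pd i f) p"
  then have e: "0 < dist (A p) (B p) / 2" by (simp add: A_def B_def)
  have "continuous_on U A" "continuous_on U B"
    unfolding A_def B_def by (intro smooth_on_continuous smooth_on_pd f)+
  then have cont: "isCont A p" "isCont B p" using U by (auto simp: continuous_on_eq_continuous_at)
  obtain d1 where d1: "0 < d1" "\<And>q. dist q p < d1 \<Longrightarrow> dist (A q) (A p) < dist (A p) (B p) / 2"
    using cont(1)[unfolded continuous_at_eps_delta, rule_format, OF e] by auto
  obtain d2 where d2: "0 < d2" "\<And>q. dist q p < d2 \<Longrightarrow> dist (B q) (B p) < dist (A p) (B p) / 2"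
    using cont(2)[unfolded continuous_at_eps_delta, rule_format, OF e] by auto
  obtain d3 where d3: "0 < d3" "ball p d3 \<subseteq> U" using U open_contains_ball by blast
  define h where "h = min d1 (min d2 d3) / 3"
  have h: "0 < h" "ball p (3 * h) \<subseteq> U" using d1 d2 d3 by (auto simp: h_def)
  obtain q where q: "q \<in> ball p (3 * h)" "f (p + h *\<^sub>R axis i 1 + h *\<^sub>R axis j 1) - f (p + h *\<^sub>R axis i 1)
      - f (p + h *\<^sub>R axis j 1) + f p = h * h * B q"
    using mixed_difference[OF f h(2,1), of i j] unfolding B_def by blast
  obtain r where r: "r \<in> ball p (3 * h)" "f (p + h *\<^sub>R axis j 1 + h *\<^sub>R axis i 1) - f (p + h *\<^sub>R axis j 1)
      - f (p + h *\<^sub>R axis i 1) + f p = h * h * A r"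
    using mixed_difference[OF f h(2,1), of j i] unfolding A_def by blast
  have "p + h *\<^sub>R axis j 1 + h *\<^sub>R axis i 1 = p + h *\<^sub>R axis i 1 + h *\<^sub>R axis j 1"
    by (simp add: add_ac)
  then have "f (p + h *\<^sub>R axis j 1 + h *\<^sub>R axis i 1) = f (p + h *\<^sub>R axis i 1 + h *\<^sub>R axis j 1)"
    by (rule arg_cong)
  then have "h * h * A r = h * h * B q" using q(2) r(2) by linarith
  then have "A r = B q" using h by simp
  moreover have "dist (A r) (A p) < dist (A p) (B p) / 2"
    using r(1) by (intro d1) (auto simp: h_def dist_commute)
  moreover have "dist (B q) (B p) < dist (A p) (B p) / 2"
    using q(1) by (intro d2) (auto simp: h_def dist_commute)
  ultimately show False using dist_triangle2[of "A p" "B p" "A r"] by (simp add: dist_commute)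
qed

lemma pd_inner_const: "f differentiable at x \<Longrightarrow> pd i (\<lambda>x. f x \<bullet> b) x = pd i f x \<bullet> b"
  by (subst pd_inner) auto

lemma pd_commute:
  fixes f :: "real^'n::finite \<Rightarrow> 'b::euclidean_space"
  assumes U: "open U" "p \<in> U" and f: "smooth_on U f"
  shows "pd i (pd j f) p = pd j (pd i f) p"
proof (rule euclidean_eqI)
  fix b :: 'b
  have 1: "smooth_on U (\<lambda>x. f x \<bullet> b)" by (intro smooth_on_inner f smooth_on_const U)
  have 2: "pd i (pd j (\<lambda>x. f x \<bullet> b)) p = pd i (pd j f) p \<bullet> b" for i j
  proof -
    have "pd i (pd j (\<lambda>x. f x \<bullet> b)) p = pd i (\<lambda>x. pd j f x \<bullet> b) p"
      by (rule pd_cong[OF U]) (rule pd_inner_const[OF smooth_on_differentiable[OF f]])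
    also have "\<dots> = pd i (pd j f) p \<bullet> b"
      by (rule pd_inner_const[OF smooth_on_differentiable[OF smooth_on_pd[OF f] U(2)]])
    finally show ?thesis .
  qed
  show "pd i (pd j f) p \<bullet> b = pd j (pd i f) p \<bullet> b"
    using pd_commute_real[OF U 1, of i j] by (simp add: 2)
qed

section \<open>Hypersurfaces in curvature line coordinates\<close>

text \<open>Here codimension one enters, by a dimension count: whatever is orthogonal to the normal
  is tangent.\<close>

lemma inj_range_eq_hyperplane:
  fixes D :: "real^'n::finite \<Rightarrow> 'e::euclidean_space"
  assumes D: "linear D" "inj D" and dim: "DIM('e) = CARD('n) + 1"
    and \<nu>: "\<nu> \<noteq> 0" "\<And>v. \<nu> \<bullet> D v = 0"
  shows "range D = {z. \<nu> \<bullet> z = 0}"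
proof (rule subspace_dim_equal)
  show "subspace (range D)" using D by (simp add: linear_subspace_image)
  show "subspace {z. \<nu> \<bullet> z = 0}" by (rule subspace_hyperplane)
  show "range D \<subseteq> {z. \<nu> \<bullet> z = 0}" using \<nu> by auto
  have "dim (range D) = CARD('n)" using dim_image_eq[OF D(1), of UNIV] D(2) by simp
  then show "dim {z. \<nu> \<bullet> z = 0} \<le> dim (range D)" using dim dim_hyperplane[OF \<nu>(1)] by simp
qed

lemma frechet_derivative_eq_sum_pd:
  fixes f :: "real^'n::finite \<Rightarrow> 'b::real_normed_vector"
  assumes "f differentiable at p"
  shows "frechet_derivative f (at p) v = (\<Sum>i\<in>UNIV. v $ i *\<^sub>R pd i f p)"
proof -
  have lin: "linear (frechet_derivative f (at p))"
    using assms by (rule linear_frechet_derivative)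
  have "v = (\<Sum>i\<in>UNIV. v $ i *\<^sub>R axis i 1)"
    by (simp add: vec_eq_iff axis_def if_distrib cong: if_cong)
  then have "frechet_derivative f (at p) v = frechet_derivative f (at p) (\<Sum>i\<in>UNIV. v $ i *\<^sub>R axis i 1)"
    by (rule arg_cong)
  then show ?thesis by (simp add: linear_sum[OF lin] linear_cmul[OF lin] pd_def)
qed

locale unit_normal_chart =
  fixes U :: "(real^'n::finite) set" and X N :: "real^'n \<Rightarrow> 'e::euclidean_space"
  assumes U: "open U" and X: "smooth_on U X" and N: "smooth_on U N"
    and dim: "DIM('e) = CARD('n) + 1"
    and inj_X: "p \<in> U \<Longrightarrow> inj (frechet_derivative X (at p))"
    and norm_N: "p \<in> U \<Longrightarrow> norm (N p) = 1"
    and N_frechet: "p \<in> U \<Longrightarrow> N p \<bullet> frechet_derivative X (at p) v = 0"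
begin

lemmas dX = smooth_on_differentiable[OF X] and dN = smooth_on_differentiable[OF N]

lemma range_frechet: "p \<in> U \<Longrightarrow> range (frechet_derivative X (at p)) = {z. N p \<bullet> z = 0}"
  using norm_N[of p]
  by (intro inj_range_eq_hyperplane linear_frechet_derivative dX inj_X dim N_frechet) auto

lemma N_dN: assumes p: "p \<in> U" shows "N p \<bullet> frechet_derivative N (at p) v = 0"
proof -
  have "((\<lambda>q. N q \<bullet> N q) has_derivative (\<lambda>v. N p \<bullet> frechet_derivative N (at p) v + frechet_derivative N (at p) v \<bullet> N p)) (at p)"
    by (intro has_derivative_inner differentiable_has_derivative dN p)
  moreover have "((\<lambda>q. N q \<bullet> N q) has_derivative (\<lambda>v. 0)) (at p)"
    using has_derivative_cong_open[OF U p, of "\<lambda>q. N q \<bullet> N q" "\<lambda>q. 1"] norm_N by (simp add: norm_eq_1)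
  ultimately have "(\<lambda>v. N p \<bullet> frechet_derivative N (at p) v + frechet_derivative N (at p) v \<bullet> N p) = (\<lambda>v. 0)"
    by (rule has_derivative_unique)
  from fun_cong[OF this, of v] show ?thesis by (simp add: inner_commute)
qed

text \<open>The description defining \<open>shape_operator\<close> is proper: the derivative of a
  unit field is orthogonal to the field, hence tangent, and the differential of \<open>X\<close> is
  injective.\<close>

lemma frechet_shape_operator:
  assumes p: "p \<in> U"
  shows "frechet_derivative X (at p) (shape_operator X N p v) = - frechet_derivative N (at p) v"
proof -
  have "- frechet_derivative N (at p) v \<in> range (frechet_derivative X (at p))"
    unfolding range_frechet[OF p] using N_dN[OF p] by simp
  then obtain w where w: "frechet_derivative X (at p) w = - frechet_derivative N (at p) v" by force
  then show ?thesis unfolding shape_operator_def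
    by (rule theI) (use w inj_X[OF p] in \<open>metis injD\<close>)
qed

lemma shape_operator_eqI:
  assumes p: "p \<in> U" and "frechet_derivative X (at p) w = - frechet_derivative N (at p) v"
  shows "shape_operator X N p v = w"
  using frechet_shape_operator[OF p, of v] assms(2) inj_X[OF p] by (metis injD)

lemma linear_shape_operator: assumes p: "p \<in> U" shows "linear (shape_operator X N p)"
proof (rule linearI)
  note lX = linear_frechet_derivative[OF dX[OF p]] and lN = linear_frechet_derivative[OF dN[OF p]]
  show "shape_operator X N p (v + w) = shape_operator X N p v + shape_operator X N p w" for v w
    by (rule shape_operator_eqI[OF p])
      (simp add: linear_add[OF lX] linear_add[OF lN] frechet_shape_operator[OF p])
  show "shape_operator X N p (c *\<^sub>R v) = c *\<^sub>R shape_operator X N p v" for c v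
    by (rule shape_operator_eqI[OF p])
      (simp add: linear_cmul[OF lX] linear_cmul[OF lN] frechet_shape_operator[OF p])
qed

end

lemma diagonal_matrix_inv:
  fixes d :: "'n::finite \<Rightarrow> real"
  assumes "\<And>i. d i \<noteq> 0"
  shows "matrix_inv (\<chi> i j. if i = j then d i else 0) = (\<chi> i j. if i = j then 1 / d i else 0)" (is "matrix_inv ?A = ?B")
proof -
  have AB: "?A ** ?B = mat 1" "?B ** ?A = mat 1"
    using assms by (auto simp: matrix_matrix_mult_def mat_def vec_eq_iff if_distrib[of "\<lambda>x. x * _"]
        if_distrib[of "\<lambda>x. _ * x"] sum.delta cong: if_cong)
  have "\<exists>B. ?A ** B = mat 1 \<and> B ** ?A = mat 1" by (rule exI[of _ ?B], rule conjI, rule AB, rule AB)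
  from someI_ex[OF this] have "?A ** matrix_inv ?A = mat 1"
    unfolding matrix_inv_def by (rule conjunct1)
  then have "?B ** (?A ** matrix_inv ?A) = ?B" by simp
  then show ?thesis by (simp add: matrix_mul_assoc AB(2))
qed

section \<open>Principal curvatures, Codazzi's equation and the Laplacian\<close>

locale holonomic_chart = unit_normal_chart +
  assumes first_off: "p \<in> U \<Longrightarrow> i \<noteq> j \<Longrightarrow> first_form X p $ i $ j = 0"
    and second_off: "p \<in> U \<Longrightarrow> i \<noteq> j \<Longrightarrow> second_form X N p $ i $ j = 0"
begin

definition "G i p = pd i X p \<bullet> pd i X p"
text \<open>The principal curvature in direction \<open>i\<close>; that the coordinate vectors are
  eigenvectors is \<open>shape_operator_axis\<close>.\<close>

definition "lam i p = - (pd i N p \<bullet> pd i X p) / G i p"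
definition "h p = (\<Sum>i\<in>UNIV. lam i p) / real CARD('a)"
definition "S p = sqrt (\<Prod>i\<in>UNIV. G i p)"

lemma ortho: "p \<in> U \<Longrightarrow> i \<noteq> j \<Longrightarrow> pd i X p \<bullet> pd j X p = 0"
  using first_off[of p i j] by (simp add: first_form_def)

lemma N_pd_X: "p \<in> U \<Longrightarrow> N p \<bullet> pd i X p = 0"
  using N_frechet[of p "axis i 1"] by (simp add: pd_def)

lemma G_pos: assumes p: "p \<in> U" shows "0 < G i p"
proof -
  have "frechet_derivative X (at p) (axis i 1) \<noteq> 0"
    using inj_X[OF p] linear_injective_0[OF linear_frechet_derivative[OF dX[OF p]]] by (auto simp: axis_eq_0_iff)
  then show ?thesis by (simp add: G_def pd_def)
qed

lemma G_nz: "p \<in> U \<Longrightarrow> G i p \<noteq> 0" using G_pos by (metis less_irrefl)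

lemma shape_operator_axis:
  assumes p: "p \<in> U" shows "shape_operator X N p (axis i 1) = lam i p *\<^sub>R axis i 1"
proof -
  define w where "w = shape_operator X N p (axis i 1)"
  have w: "(\<Sum>j\<in>UNIV. w $ j *\<^sub>R pd j X p) = - pd i N p"
    using frechet_shape_operator[OF p, of "axis i 1"]
    unfolding w_def frechet_derivative_eq_sum_pd[OF dX[OF p], symmetric] by (simp add: pd_def)
  have wj: "(\<Sum>j\<in>UNIV. w $ j *\<^sub>R pd j X p) \<bullet> pd k X p = w $ k * G k p" for k
  proof -
    have "(\<Sum>j\<in>UNIV. w $ j *\<^sub>R pd j X p) \<bullet> pd k X p = (\<Sum>j\<in>UNIV. if j = k then w $ k * G k p else 0)"
      unfolding inner_sum_left by (rule sum.cong) (auto simp: ortho[OF p] G_def)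
    then show ?thesis by simp
  qed
  have "w $ k = lam i p * (if k = i then 1 else 0)" for k
  proof (cases "k = i")
    case True then show ?thesis using wj[of i] w G_nz[OF p, of i] by (simp add: lam_def field_simps)
  next
    case False
    have "second_form X N p $ i $ k = w $ k * G k p"
      using wj[of k] by (simp add: second_form_def w_def frechet_derivative_eq_sum_pd[OF dX[OF p]])
    then show ?thesis using second_off[OF p, of i k] False G_nz[OF p, of k] by simp
  qed
  then show ?thesis by (auto simp: vec_eq_iff axis_def w_def)
qed

text \<open>Rodrigues' formula along a line of curvature.\<close>

lemma pd_N: assumes p: "p \<in> U" shows "pd i N p = (- lam i p) *\<^sub>R pd i X p"
proof -
  have "- pd i N p = lam i p *\<^sub>R pd i X p"
    using frechet_shape_operator[OF p, of "axis i 1"] linear_cmul[OF linear_frechet_derivative[OF dX[OF p]]]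
    by (simp add: shape_operator_axis[OF p] pd_def)
  then show ?thesis by (metis minus_equation_iff scaleR_minus_left)
qed

lemma mean_curvature_eq: assumes p: "p \<in> U" shows "mean_curvature X N p = h p"
  by (simp add: mean_curvature_def trace_def matrix_def h_def shape_operator_axis[OF p])

lemma smooth_G: "smooth_on U (G i)"
  unfolding G_def[abs_def] by (intro smooth_on_inner U smooth_on_pd X)

lemma smooth_lam: "smooth_on U (lam i)"
proof -
  have "smooth_on U (\<lambda>p. (-1) * (pd i N p \<bullet> pd i X p) / G i p)"
    by (intro smooth_on_divide smooth_on_mult smooth_on_const smooth_on_inner U smooth_on_pd X N smooth_G G_nz)
  then show ?thesis by (simp add: lam_def[abs_def])
qed

lemma smooth_h: "smooth_on U h"
  unfolding h_def[abs_def] by (intro smooth_on_divide smooth_on_sum smooth_on_const U smooth_lam) simp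

lemmas diffs = smooth_on_differentiable[OF smooth_G] smooth_on_differentiable[OF smooth_lam]
  smooth_on_differentiable[OF smooth_h] smooth_on_differentiable[OF smooth_on_pd[OF X]]
  smooth_on_differentiable[OF smooth_on_pd[OF smooth_G]] smooth_on_differentiable[OF smooth_on_pd[OF smooth_h]]
  smooth_on_differentiable[OF smooth_on_pd[OF smooth_on_pd[OF X]]]
  smooth_on_differentiable[OF smooth_on_pd[OF smooth_lam]]
  dX dN

lemma zero_of_components:
  assumes p: "p \<in> U" and z: "N p \<bullet> z = 0" "\<And>j. z \<bullet> pd j X p = 0"
  shows "z = 0"
proof -
  have "z \<in> range (frechet_derivative X (at p))" using z range_frechet[OF p] by simp
  then obtain w where "z = (\<Sum>j\<in>UNIV. w $ j *\<^sub>R pd j X p)"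
    using frechet_derivative_eq_sum_pd[OF dX[OF p]] by auto
  then have "z \<bullet> z = 0" using z(2) by (simp add: inner_sum_right)
  then show ?thesis by simp
qed

lemma pd_pd_X_commute: "p \<in> U \<Longrightarrow> pd i (pd j X) p = pd j (pd i X) p"
  by (rule pd_commute[OF U _ X])

lemma pd_G: assumes p: "p \<in> U" shows "pd k (G i) p = 2 * (pd k (pd i X) p \<bullet> pd i X p)"
  unfolding G_def[abs_def] by (simp add: pd_inner diffs p inner_commute)

lemma ortho_pd:
  assumes p: "p \<in> U" and "i \<noteq> j"
  shows "pd i X p \<bullet> pd k (pd j X) p + pd k (pd i X) p \<bullet> pd j X p = 0"
proof -
  have "pd k (\<lambda>q. pd i X q \<bullet> pd j X q) p = pd k (\<lambda>q. 0) p"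
    by (rule pd_cong[OF U p]) (use ortho \<open>i \<noteq> j\<close> in auto)
  then show ?thesis by (simp add: pd_inner diffs p)
qed

lemma pd_pd_X_N:
  assumes p: "p \<in> U"
  shows "N p \<bullet> pd k (pd i X) p = (if i = k then lam i p * G i p else 0)"
proof -
  have "pd k (\<lambda>q. N q \<bullet> pd i X q) p = pd k (\<lambda>q. 0) p"
    by (rule pd_cong[OF U p]) (use N_pd_X in auto)
  then have "N p \<bullet> pd k (pd i X) p + pd k N p \<bullet> pd i X p = 0" by (simp add: pd_inner diffs p)
  then show ?thesis using ortho[OF p, of k i] by (auto simp: pd_N[OF p] G_def)
qed

text \<open>The three-index expression is symmetric in its first two indices, since partial
  derivatives commute, and antisymmetric in its last two, by differentiating orthogonality; such an
  expression is zero. This is the identity behind Dupin's theorem.\<close>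

lemma pd_pd_X_distinct:
  assumes p: "p \<in> U" and "i \<noteq> j" "j \<noteq> k" "i \<noteq> k"
  shows "pd i (pd j X) p \<bullet> pd k X p = 0"
  using ortho_pd[OF p \<open>i \<noteq> j\<close>, of k] ortho_pd[OF p \<open>j \<noteq> k\<close>, of i] ortho_pd[OF p \<open>i \<noteq> k\<close>, of j]
    pd_pd_X_commute[OF p, of i j] pd_pd_X_commute[OF p, of j k] pd_pd_X_commute[OF p, of i k]
  by (simp add: inner_commute)

text \<open>The symmetry of the second derivatives of \<open>N\<close>, expanded by Rodrigues'
  formula and multiplied by \<open>pd i X\<close>.\<close>

lemma codazzi:
  assumes p: "p \<in> U" and ij: "i \<noteq> j"
  shows "pd j (lam i) p = (lam j p - lam i p) * (pd j (G i) p / (2 * G i p))"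
proof -
  have 1: "pd j (pd i N) p = - (lam i p *\<^sub>R pd j (pd i X) p + pd j (lam i) p *\<^sub>R pd i X p)" for i j
  proof -
    have "pd j (pd i N) p = pd j (\<lambda>q. - (lam i q *\<^sub>R pd i X q)) p"
      by (rule pd_cong[OF U p]) (simp add: pd_N)
    also have "\<dots> = - pd j (\<lambda>q. lam i q *\<^sub>R pd i X q) p"
      by (rule pd_minus) (intro differentiable_scaleR diffs p)
    finally show ?thesis by (simp add: pd_scaleR diffs p)
  qed
  have "pd j (pd i N) p \<bullet> pd i X p = pd i (pd j N) p \<bullet> pd i X p"
    using pd_commute[OF U p N] by metis
  then have "lam i p * (pd j (pd i X) p \<bullet> pd i X p) + pd j (lam i) p * G i p
      = lam j p * (pd j (pd i X) p \<bullet> pd i X p)"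
    using ortho[OF p, of j i] ij pd_pd_X_commute[OF p, of i j]
    unfolding 1 by (simp add: inner_add_left inner_diff_left G_def)
  then have "pd j (lam i) p * G i p = (lam j p - lam i p) * (pd j (G i) p / 2)"
    unfolding pd_G[OF p] by (simp add: algebra_simps)
  then show ?thesis using G_nz[OF p, of i] by (simp add: field_simps)
qed

text \<open>The exponential form turns the logarithmic derivative of the volume density into the sum
  of those of the \<open>sqrt (G i)\<close>.\<close>

lemma S_exp: assumes p: "p \<in> U" shows "S p = exp ((\<Sum>i\<in>UNIV. ln (G i p)) / 2)"
  unfolding S_def
proof (rule real_sqrt_unique)
  have "(exp ((\<Sum>i\<in>UNIV. ln (G i p)) / 2))\<^sup>2 = exp (\<Sum>i\<in>UNIV. ln (G i p))"
    by (simp add: power2_eq_square exp_add[symmetric])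
  also have "\<dots> = (\<Prod>i\<in>UNIV. G i p)" by (simp add: exp_sum G_pos[OF p])
  finally show "(exp ((\<Sum>i\<in>UNIV. ln (G i p)) / 2))\<^sup>2 = (\<Prod>i\<in>UNIV. G i p)" .
qed simp

lemma S_pos: "p \<in> U \<Longrightarrow> 0 < S p" by (simp add: S_exp)

lemma S_deriv:
  assumes p: "p \<in> U"
  shows "pd k S p = S p * (\<Sum>i\<in>UNIV. pd k (G i) p / (2 * G i p))" and "S differentiable at p"
proof -
  have ln: "(\<lambda>q. ln (G i q)) differentiable at p" "pd k (\<lambda>q. ln (G i q)) p = 1 / G i p * pd k (G i) p" for i
    using pd_compose_real(2,1)[OF diffs(1)[OF p] DERIV_ln_divide[OF G_pos[OF p, of i]]] by blast+
  have sum: "(\<lambda>q. \<Sum>i\<in>UNIV. ln (G i q)) differentiable at p"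
    by (intro differentiable_sum ln ballI) auto
  have psum: "pd k (\<lambda>q. \<Sum>i\<in>UNIV. ln (G i q)) p = (\<Sum>i\<in>UNIV. 1 / G i p * pd k (G i) p)"
    by (subst pd_sum) (simp_all add: ln)
  have "((\<lambda>x. exp (x / 2)) has_real_derivative S p / 2) (at (\<Sum>i\<in>UNIV. ln (G i p)))"
    by (auto intro!: derivative_eq_intros simp: S_exp[OF p])
  from pd_compose_real(1)[OF sum this, of k] pd_compose_real(2)[OF sum this] psum
  have *: "pd k (\<lambda>q. exp ((\<Sum>i\<in>UNIV. ln (G i q)) / 2)) p = S p / 2 * (\<Sum>i\<in>UNIV. 1 / G i p * pd k (G i) p)"
    "(\<lambda>q. exp ((\<Sum>i\<in>UNIV. ln (G i q)) / 2)) differentiable at p" by simp_all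
  show "pd k S p = S p * (\<Sum>i\<in>UNIV. pd k (G i) p / (2 * G i p))"
  proof -
    have "pd k S p = pd k (\<lambda>q. exp ((\<Sum>i\<in>UNIV. ln (G i q)) / 2)) p"
      by (rule pd_cong[OF U p]) (rule S_exp)
    then show ?thesis unfolding *(1) by (simp add: sum_distrib_left mult.assoc)
  qed
  show "S differentiable at p"
    using differentiable_cong_open[OF U p, of S "\<lambda>q. exp ((\<Sum>i\<in>UNIV. ln (G i q)) / 2)"] S_exp *(2)
    by blast
qed

lemma first_form_eq: "p \<in> U \<Longrightarrow> first_form X p = (\<chi> i j. if i = j then G i p else 0)"
  using ortho by (auto simp: first_form_def vec_eq_iff G_def)

lemma laplacian_eq:
  assumes p: "p \<in> U"
  shows "laplacian X f p = (\<Sum>i\<in>UNIV. pd i (\<lambda>q. S q / G i q * pd i f q) p) / S p"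
proof -
  have det: "det (first_form X q) = (\<Prod>i\<in>UNIV. G i q)" if "q \<in> U" for q
    unfolding first_form_eq[OF that] by (subst det_diagonal) auto
  have inv: "matrix_inv (first_form X q) $ i $ j = (if i = j then 1 / G i q else 0)" if "q \<in> U" for q i j
    unfolding first_form_eq[OF that] diagonal_matrix_inv[of "\<lambda>i. G i q", OF G_nz[OF that]] by simp
  have sum: "(\<Sum>j\<in>UNIV. matrix_inv (first_form X q) $ i $ j * pd j f q) = 1 / G i q * pd i f q" if "q \<in> U" for q i
    unfolding inv[OF that] by (simp add: if_distrib[of "\<lambda>x. x * _"] cong: if_cong)
  have "pd i (\<lambda>q. sqrt (det (first_form X q)) *
        (\<Sum>j\<in>UNIV. matrix_inv (first_form X q) $ i $ j * pd j f q)) p = pd i (\<lambda>q. S q / G i q * pd i f q) p" for i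
    by (rule pd_cong[OF U p]) (simp add: det sum S_def)
  then show ?thesis by (simp add: laplacian_def det[OF p] S_def)
qed

end

section \<open>The normal and tangential parts of the biharmonic equation\<close>

locale biharmonic_chart = holonomic_chart +
  assumes biharmonic: "p \<in> U \<Longrightarrow> vector_laplacian X (mean_curvature_vector X N) p = 0"
begin

text \<open>The divergence form of \<open>\<Delta> (h N) = 0\<close> is \<open>\<Sum>\<^sub>i \<partial>\<^sub>i (W i) = 0\<close>, where \<open>W i = (S / G i) \<partial>\<^sub>i (h N)\<close>.\<close>

definition "W i q = (S q / G i q) *\<^sub>R (pd i h q *\<^sub>R N q - (h q * lam i q) *\<^sub>R pd i X q)"

lemma differentiable_SG: "p \<in> U \<Longrightarrow> (\<lambda>q. S q / G i q) differentiable at p"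
  by (intro differentiable_divide S_deriv diffs G_nz)

lemma differentiable_W: "p \<in> U \<Longrightarrow> W i differentiable at p"
  unfolding W_def[abs_def]
  by (intro differentiable_scaleR differentiable_diff differentiable_mult differentiable_SG diffs)

lemma pd_hN: assumes p: "p \<in> U"
  shows "pd i (\<lambda>q. h q *\<^sub>R N q) p = pd i h p *\<^sub>R N p - (h p * lam i p) *\<^sub>R pd i X p"
  by (simp add: pd_scaleR diffs p pd_N)

lemma differentiable_hN: "p \<in> U \<Longrightarrow> (\<lambda>q. h q *\<^sub>R N q) differentiable at p"
  by (intro differentiable_scaleR diffs)

text \<open>The scalar equations of the components are assembled into one vector identity, which can
  then be multiplied by the moving frame \<open>N\<close>, \<open>pd k X\<close>.\<close>

lemma divergence_W: assumes p: "p \<in> U" shows "(\<Sum>i\<in>UNIV. pd i (W i) p) = 0"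
proof (rule euclidean_eqI)
  fix b :: 'b assume b: "b \<in> Basis"
  have pdb: "pd i (\<lambda>q. mean_curvature_vector X N q \<bullet> b) q = (pd i h q *\<^sub>R N q - (h q * lam i q) *\<^sub>R pd i X q) \<bullet> b"
    if q: "q \<in> U" for i q
  proof -
    have "pd i (\<lambda>q. mean_curvature_vector X N q \<bullet> b) q = pd i (\<lambda>q. (h q *\<^sub>R N q) \<bullet> b) q"
      by (rule pd_cong[OF U q]) (simp add: mean_curvature_vector_def mean_curvature_eq)
    also have "\<dots> = pd i (\<lambda>q. h q *\<^sub>R N q) q \<bullet> b"
      by (rule pd_inner_const[OF differentiable_hN[OF q]])
    finally show ?thesis by (simp only: pd_hN[OF q])
  qed
  have "laplacian X (\<lambda>q. mean_curvature_vector X N q \<bullet> b) p = vector_laplacian X (mean_curvature_vector X N) p \<bullet> b"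
    using b by (simp add: vector_laplacian_def)
  then have "laplacian X (\<lambda>q. mean_curvature_vector X N q \<bullet> b) p = 0"
    by (simp add: biharmonic[OF p])
  then have "(\<Sum>i\<in>UNIV. pd i (\<lambda>q. S q / G i q * pd i (\<lambda>q. mean_curvature_vector X N q \<bullet> b) q) p) = 0"
    using S_pos[OF p] by (simp add: laplacian_eq[OF p])
  moreover have "pd i (\<lambda>q. S q / G i q * pd i (\<lambda>q. mean_curvature_vector X N q \<bullet> b) q) p = pd i (W i) p \<bullet> b" for i
  proof -
    have "pd i (\<lambda>q. S q / G i q * pd i (\<lambda>q. mean_curvature_vector X N q \<bullet> b) q) p = pd i (\<lambda>q. W i q \<bullet> b) p"
      by (rule pd_cong[OF U p]) (simp only: pdb W_def inner_scaleR_left)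
    then show ?thesis by (simp only: pd_inner_const[OF differentiable_W[OF p]])
  qed
  ultimately show "(\<Sum>i\<in>UNIV. pd i (W i) p) \<bullet> b = 0 \<bullet> b" by (simp add: inner_sum_left)
qed

lemma W_N: "q \<in> U \<Longrightarrow> W i q \<bullet> N q = S q / G i q * pd i h q"
  using norm_N[of q] N_pd_X[of q i]
  by (simp add: W_def inner_diff_left inner_commute[of "pd i X q"] norm_eq_1)

lemma W_X: "q \<in> U \<Longrightarrow> W i q \<bullet> pd k X q = (if i = k then - (S q * h q * lam k q) else 0)"
  using N_pd_X[of q k] ortho[of q i k] G_nz[of q k]
  by (auto simp: W_def inner_diff_left G_def)

text \<open>Product rule for \<open>W i \<bullet> N\<close>: the divergence of \<open>W\<close>
  drops out and the derivative falls on \<open>N\<close>, where Rodrigues' formula yields the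
  squares of the principal curvatures.\<close>

lemma normal_equation:
  assumes p: "p \<in> U"
  shows "(\<Sum>i\<in>UNIV. pd i (\<lambda>q. S q / G i q * pd i h q) p) = S p * h p * (\<Sum>i\<in>UNIV. (lam i p)\<^sup>2)"
proof -
  have "pd i (\<lambda>q. S q / G i q * pd i h q) p = pd i (W i) p \<bullet> N p + S p * h p * (lam i p)\<^sup>2" for i
  proof -
    have "pd i (\<lambda>q. S q / G i q * pd i h q) p = pd i (\<lambda>q. W i q \<bullet> N q) p"
      by (rule pd_cong[OF U p]) (simp add: W_N)
    also have "\<dots> = W i p \<bullet> pd i N p + pd i (W i) p \<bullet> N p"
      by (simp add: pd_inner differentiable_W diffs p)
    also have "W i p \<bullet> pd i N p = S p * h p * (lam i p)\<^sup>2"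
      using W_X[OF p, of i i] by (simp add: pd_N[OF p] power2_eq_square)
    finally show ?thesis by simp
  qed
  then have "(\<Sum>i\<in>UNIV. pd i (\<lambda>q. S q / G i q * pd i h q) p)
      = (\<Sum>i\<in>UNIV. pd i (W i) p) \<bullet> N p + S p * h p * (\<Sum>i\<in>UNIV. (lam i p)\<^sup>2)"
    by (simp add: sum.distrib inner_sum_left sum_distrib_left)
  then show ?thesis by (simp add: divergence_W[OF p])
qed

text \<open>The same product rule with \<open>pd k X\<close> in place of \<open>N\<close>. The
  derivatives of the metric that appear are exactly those in Codazzi's equations, whose sum over
  \<open>i\<close> is \<open>n\<close> times the derivative of \<open>h\<close>.\<close>

lemma tangential_equation:
  assumes p: "p \<in> U"
  shows "pd k h p * (2 * lam k p + real CARD('a) * h p) = 0"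
proof -
  define c where "c i = pd k (G i) p / (2 * G i p)" for i
  have XX: "pd i (pd k X) p \<bullet> pd i X p = c i * G i p" for i
    using pd_G[OF p, of k i] G_nz[OF p, of i] pd_pd_X_commute[OF p, of i k] by (simp add: c_def)
  have summand: "pd i (\<lambda>q. W i q \<bullet> pd k X q) p = pd i (W i) p \<bullet> pd k X p
      + S p * ((if i = k then pd k h p * lam k p else 0) - h p * (lam i p * c i))" for i
  proof -
    have "pd i (\<lambda>q. W i q \<bullet> pd k X q) p = W i p \<bullet> pd i (pd k X) p + pd i (W i) p \<bullet> pd k X p"
      by (simp add: pd_inner differentiable_W diffs p)
    also have "W i p \<bullet> pd i (pd k X) p = S p / G i p *
        (pd i h p * (N p \<bullet> pd i (pd k X) p) - h p * lam i p * (pd i (pd k X) p \<bullet> pd i X p))"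
      by (simp add: W_def inner_diff_left inner_commute[of "pd i X p"])
    also have "\<dots> = S p * ((if i = k then pd k h p * lam k p else 0) - h p * (lam i p * c i))"
      unfolding XX pd_pd_X_N[OF p] using G_nz[OF p] by (auto simp: field_simps)
    finally show ?thesis by simp
  qed
  have "(\<Sum>i\<in>UNIV. pd i (\<lambda>q. W i q \<bullet> pd k X q) p)
     = (\<Sum>i\<in>UNIV. pd i (W i) p) \<bullet> pd k X p + S p * (pd k h p * lam k p - h p * (\<Sum>i\<in>UNIV. lam i p * c i))"
    unfolding summand by (simp add: sum.distrib inner_sum_left sum_distrib_left[symmetric] sum_subtractf)
  then have 1: "(\<Sum>i\<in>UNIV. pd i (\<lambda>q. W i q \<bullet> pd k X q) p)
     = S p * (pd k h p * lam k p - h p * (\<Sum>i\<in>UNIV. lam i p * c i))"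
    by (simp add: divergence_W[OF p])
  have "pd i (\<lambda>q. W i q \<bullet> pd k X q) p = (if i = k then pd k (\<lambda>q. - (S q * h q * lam k q)) p else 0)" for i
  proof -
    have "pd i (\<lambda>q. W i q \<bullet> pd k X q) p = pd i (\<lambda>q. if i = k then - (S q * h q * lam k q) else 0) p"
      by (rule pd_cong[OF U p]) (simp add: W_X)
    then show ?thesis by simp
  qed
  then have 2: "(\<Sum>i\<in>UNIV. pd i (\<lambda>q. W i q \<bullet> pd k X q) p) = pd k (\<lambda>q. - (S q * h q * lam k q)) p" by simp
  have "pd k (\<lambda>q. - (S q * h q * lam k q)) p = - pd k (\<lambda>q. S q * h q * lam k q) p"
    by (rule pd_minus) (intro differentiable_mult S_deriv diffs p)
  also have "pd k (\<lambda>q. S q * h q * lam k q) p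
      = S p * h p * pd k (lam k) p + (S p * pd k h p + S p * (\<Sum>i\<in>UNIV. c i) * h p) * lam k p"
    by (simp add: pd_mult S_deriv differentiable_mult diffs p c_def)
  finally have "S p * (pd k h p * lam k p - h p * (\<Sum>i\<in>UNIV. lam i p * c i))
      = - (S p * h p * pd k (lam k) p + (S p * pd k h p + S p * (\<Sum>i\<in>UNIV. c i) * h p) * lam k p)"
    using 1 2 by simp
  then have "S p * (2 * pd k h p * lam k p + h p * (pd k (lam k) p + (\<Sum>i\<in>UNIV. c i) * lam k p - (\<Sum>i\<in>UNIV. lam i p * c i))) = 0"
    by (simp add: algebra_simps)
  then have 3: "2 * pd k h p * lam k p + h p * (pd k (lam k) p + (\<Sum>i\<in>UNIV. c i) * lam k p - (\<Sum>i\<in>UNIV. lam i p * c i)) = 0"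
    using S_pos[OF p] by simp
  have "pd k (lam k) p + (\<Sum>i\<in>UNIV. c i) * lam k p - (\<Sum>i\<in>UNIV. lam i p * c i)
      = pd k (lam k) p + (\<Sum>i\<in>UNIV. (lam k p - lam i p) * c i)"
    by (simp add: sum_distrib_right sum_subtractf algebra_simps)
  \<comment> \<open>In the second sum the term \<open>i = k\<close> is zero, so the isolated
    derivative of \<open>lam k\<close> takes its place and completes the trace.\<close>
  also have "\<dots> = (\<Sum>i\<in>UNIV. if i = k then pd k (lam k) p else 0) + (\<Sum>i\<in>UNIV. (lam k p - lam i p) * c i)"
    by simp
  also have "\<dots> = (\<Sum>i\<in>UNIV. pd k (lam i) p)"
    unfolding sum.distrib[symmetric] by (rule sum.cong) (auto simp: codazzi[OF p] c_def)
  also have "\<dots> = real CARD('a) * pd k h p"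
  proof -
    have "pd k h p = pd k (\<lambda>q. (\<Sum>i\<in>UNIV. lam i q) * (1 / real CARD('a))) p"
      unfolding h_def[abs_def] by simp
    also have "\<dots> = (\<Sum>i\<in>UNIV. pd k (lam i) p) * (1 / real CARD('a))"
      by (subst pd_mult) (simp_all add: pd_sum diffs p differentiable_sum)
    finally show ?thesis by simp
  qed
  finally show ?thesis using 3 by (simp add: algebra_simps)
qed

end

section \<open>Lines along which the mean curvature varies\<close>

locale biharmonic_chart_direction = biharmonic_chart U X N
  for U :: "(real^'n::finite) set" and X N :: "real^'n \<Rightarrow> 'e::euclidean_space" +
  fixes V :: "(real^'n) set" and k :: 'n
  assumes V: "open V" "V \<subseteq> U" and h_nz: "p \<in> V \<Longrightarrow> h p \<noteq> 0" and pd_h_nz: "p \<in> V \<Longrightarrow> pd k h p \<noteq> 0"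
begin

lemma VU: "p \<in> V \<Longrightarrow> p \<in> U" using V by blast

lemma lam_k: "p \<in> V \<Longrightarrow> lam k p = - (real CARD('n) / 2) * h p"
  using tangential_equation[OF VU, of p k] pd_h_nz[of p] by simp

lemma pd_lam_k: assumes p: "p \<in> V" shows "pd j (lam k) p = - (real CARD('n) / 2) * pd j h p"
proof -
  have "pd j (lam k) p = pd j (\<lambda>q. - (real CARD('n) / 2) * h q) p"
    by (rule pd_cong[OF V(1) p]) (rule lam_k)
  also have "\<dots> = - (real CARD('n) / 2) * pd j h p"
    by (subst pd_mult) (simp_all add: diffs VU[OF p])
  finally show ?thesis .
qed

text \<open>A second varying direction \<open>j\<close> would share the principal curvature
  \<open>- n h / 2\<close> with \<open>k\<close>. Codazzi's equation then makes this curvature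
  constant in direction \<open>j\<close>, and \<open>h\<close> with it.\<close>

lemma pd_h_other: assumes p: "p \<in> V" and j: "j \<noteq> k" shows "pd j h p = 0"
proof (rule ccontr)
  assume nz: "pd j h p \<noteq> 0"
  then have "lam j p = lam k p" using tangential_equation[OF VU[OF p], of j] lam_k[OF p] by simp
  then have "pd j (lam k) p = 0" using codazzi[OF VU[OF p], of k j] j by simp
  then show False using nz pd_lam_k[OF p, of j] by simp
qed

text \<open>Codazzi's equation for \<open>lam k\<close> leaves \<open>lam j = lam k\<close> as the
  only alternative. Then the derivative of \<open>lam j\<close> along \<open>k\<close> is zero by
  Codazzi, yet equal to that of \<open>lam k\<close>, a nonzero multiple of the derivative of
  \<open>h\<close>.\<close>

lemma pd_G_k: assumes p: "p \<in> V" and j: "j \<noteq> k" shows "pd j (G k) p = 0"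
proof (rule ccontr)
  assume nz: "pd j (G k) p \<noteq> 0"
  \<comment> \<open>The equality of the two curvatures is needed on an open set, because it is
    differentiated.\<close>
  define V' where "V' = {q \<in> V. pd j (G k) q \<noteq> 0}"
  have "continuous_on V (pd j (G k))"
    using smooth_on_continuous[OF smooth_on_pd[OF smooth_G]] V(2) continuous_on_subset by blast
  then have "open (V \<inter> pd j (G k) -` (- {0}))"
    by (rule continuous_open_preimage[OF _ V(1)]) auto
  moreover have "V \<inter> pd j (G k) -` (- {0}) = V'" by (auto simp: V'_def)
  ultimately have V': "open V'" "p \<in> V'" using p nz by (auto simp: V'_def)
  have eq: "lam j q = lam k q" if "q \<in> V'" for q
  proof -
    have q: "q \<in> V" "pd j (G k) q \<noteq> 0" using that by (auto simp: V'_def)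
    have "pd j (lam k) q = 0" using pd_lam_k[OF q(1)] pd_h_other[OF q(1) j] by simp
    then show ?thesis using codazzi[OF VU[OF q(1)], of k j] j q(2) G_nz[OF VU[OF q(1)], of k] by auto
  qed
  have "pd k (lam j) p = pd k (lam k) p" by (rule pd_cong[OF V' eq])
  moreover have "pd k (lam j) p = 0" using codazzi[OF VU[OF p] j] eq[OF V'(2)] by simp
  ultimately show False using pd_lam_k[OF p, of k] pd_h_nz[OF p] by simp
qed

text \<open>The derivative of \<open>ln (sqrt (G j))\<close> along \<open>k\<close>, which is also a
  Christoffel symbol of the chart.\<close>

definition "c j p = pd k (G j) p / (2 * G j p)"

lemma pd_G_c: "p \<in> V \<Longrightarrow> pd k (G j) p = 2 * c j p * G j p"
  using G_nz[OF VU] by (simp add: c_def)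

lemma pd_k_pd_j_X:
  assumes p: "p \<in> V" and j: "j \<noteq> k"
  shows "pd k (pd j X) p = c j p *\<^sub>R pd j X p"
proof -
  note pU = VU[OF p]
  have "pd k (pd j X) p - c j p *\<^sub>R pd j X p = 0"
  proof (rule zero_of_components[OF pU])
    show "N p \<bullet> (pd k (pd j X) p - c j p *\<^sub>R pd j X p) = 0"
      using j by (simp add: inner_diff_right pd_pd_X_N[OF pU] N_pd_X[OF pU])
    fix i
    consider "i = j" | "i = k" | "i \<noteq> j" "i \<noteq> k" by blast
    then show "(pd k (pd j X) p - c j p *\<^sub>R pd j X p) \<bullet> pd i X p = 0"
    proof cases
      case 1
      then show ?thesis using pd_G[OF pU, of k j] pd_G_c[OF p, of j] by (simp add: inner_diff_left G_def)
    next
      case 2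
      then show ?thesis
        using pd_G[OF pU, of j k] pd_G_k[OF p j] ortho[OF pU j] pd_pd_X_commute[OF pU, of k j]
        by (simp add: inner_diff_left)
    next
      case 3
      then show ?thesis
        using pd_pd_X_distinct[OF pU, of k j i] j ortho[OF pU, of j i] by (simp add: inner_diff_left)
    qed
  qed
  then show ?thesis by simp
qed

text \<open>No tangential component transversal to the line is left: up to parametrisation the
  \<open>k\<close>-lines are geodesics of the hypersurface.\<close>

lemma pd_k_pd_k_X:
  assumes p: "p \<in> V"
  shows "pd k (pd k X) p = c k p *\<^sub>R pd k X p + (lam k p * G k p) *\<^sub>R N p"
proof -
  note pU = VU[OF p]
  have "pd k (pd k X) p - (c k p *\<^sub>R pd k X p + (lam k p * G k p) *\<^sub>R N p) = 0"
  proof (rule zero_of_components[OF pU])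
    show "N p \<bullet> (pd k (pd k X) p - (c k p *\<^sub>R pd k X p + (lam k p * G k p) *\<^sub>R N p)) = 0"
      using norm_N[OF pU] by (simp add: inner_diff_right inner_add_right pd_pd_X_N[OF pU] N_pd_X[OF pU] norm_eq_1)
    fix i
    show "(pd k (pd k X) p - (c k p *\<^sub>R pd k X p + (lam k p * G k p) *\<^sub>R N p)) \<bullet> pd i X p = 0"
    proof (cases "i = k")
      case True
      then show ?thesis using pd_G[OF pU, of k k] pd_G_c[OF p, of k]
        by (simp add: inner_diff_left inner_add_left N_pd_X[OF pU] G_def)
    next
      case False
      then have "pd k X p \<bullet> pd k (pd i X) p = 0"
        using ortho[OF pU, of k i] by (simp add: pd_k_pd_j_X[OF p])
      then show ?thesis using ortho_pd[OF pU, of k i k] False ortho[OF pU, of k i]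
        by (simp add: inner_diff_left inner_add_left N_pd_X[OF pU])
    qed
  qed
  then show ?thesis by simp
qed

text \<open>The third derivative that appears is evaluated in a second way:
  \<open>pd k (pd k X)\<close> is orthogonal to \<open>pd j X\<close> on all of \<open>V\<close>,
  and this relation is differentiated in direction \<open>j\<close>.\<close>

lemma gauss:
  assumes p: "p \<in> V" and j: "j \<noteq> k"
  shows "pd k (pd k (G j)) p = 2 * G j p * ((c j p)\<^sup>2 + c k p * c j p - lam k p * lam j p * G k p)"
proof -
  note pU = VU[OF p]
  define t where "t = pd k (pd k (pd j X)) p \<bullet> pd j X p"
  have "pd k (pd k (G j)) p = pd k (\<lambda>q. 2 * (pd k (pd j X) q \<bullet> pd j X q)) p"
    by (rule pd_cong[OF U pU]) (rule pd_G)
  also have "\<dots> = 2 * pd k (\<lambda>q. pd k (pd j X) q \<bullet> pd j X q) p"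
    by (subst pd_mult) (simp_all add: differentiable_inner diffs pU)
  also have "pd k (\<lambda>q. pd k (pd j X) q \<bullet> pd j X q) p = pd k (pd j X) p \<bullet> pd k (pd j X) p + t"
    by (simp add: pd_inner diffs pU t_def)
  also have "pd k (pd j X) p \<bullet> pd k (pd j X) p = (c j p)\<^sup>2 * G j p"
    by (simp add: pd_k_pd_j_X[OF p j] power2_eq_square G_def)
  finally have 1: "pd k (pd k (G j)) p = 2 * ((c j p)\<^sup>2 * G j p + t)" .
  have "pd k (pd k (pd j X)) p = pd k (pd j (pd k X)) p"
    by (rule pd_cong[OF U pU]) (rule pd_pd_X_commute)
  also have "\<dots> = pd j (pd k (pd k X)) p"
    by (rule pd_commute[OF U pU smooth_on_pd[OF X]])
  finally have t: "t = pd j (pd k (pd k X)) p \<bullet> pd j X p" by (simp add: t_def)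
  have "pd j (\<lambda>q. pd k (pd k X) q \<bullet> pd j X q) p = pd j (\<lambda>q. 0) p"
  proof (rule pd_cong[OF V(1) p])
    fix q assume q: "q \<in> V"
    show "pd k (pd k X) q \<bullet> pd j X q = 0"
      using j ortho[OF VU[OF q], of k j] by (simp add: pd_k_pd_k_X[OF q] inner_add_left N_pd_X[OF VU[OF q]])
  qed
  then have "pd k (pd k X) p \<bullet> pd j (pd j X) p + t = 0" by (simp add: pd_inner diffs pU t)
  moreover have "pd k X p \<bullet> pd j (pd j X) p = - (c j p * G j p)"
    using ortho_pd[OF pU, of k j j] j pd_pd_X_commute[OF pU, of j k]
    by (simp add: pd_k_pd_j_X[OF p j] G_def)
  ultimately have "t = c k p * c j p * G j p - lam k p * G k p * (lam j p * G j p)"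
    by (simp add: pd_k_pd_k_X[OF p] inner_add_left pd_pd_X_N[OF pU])
  then show ?thesis unfolding 1 by (simp add: algebra_simps power2_eq_square)
qed

definition "e q = sqrt (G k q)"
text \<open>The index \<open>k\<close> itself is made a trivial component of the system, so that the index type stays the same.\<close>

definition "l j q = (if j = k then 0 else lam j q)"
definition "w j q = (if j = k then 0 else c j q / e q)"
text \<open>The arc-length derivative of \<open>lam k\<close>, as \<open>pd_lam_k_m\<close>
  confirms, written in terms of \<open>l\<close> and \<open>w\<close>.\<close>

definition "m q = - (\<Sum>j\<in>UNIV. (lam k q - l j q) * w j q) / 3"

lemma e_pos: "p \<in> V \<Longrightarrow> 0 < e p" and e_sq: "p \<in> V \<Longrightarrow> e p * e p = G k p"
  using G_pos[OF VU, of p k] by (auto simp: e_def)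

lemma e_deriv: assumes p: "p \<in> V" shows "e differentiable at p" "pd k e p = c k p * e p"
proof -
  have "(sqrt has_real_derivative 1 / (2 * e p)) (at (G k p))"
    using DERIV_real_sqrt[OF G_pos[OF VU[OF p], of k]] by (simp add: e_def field_simps)
  note * = pd_compose_real[OF diffs(1)[OF VU[OF p]] this]
  show "e differentiable at p" using *(2) by (simp add: e_def[abs_def])
  have "pd k e p = 1 / (2 * e p) * pd k (G k) p" using *(1) by (simp add: e_def[abs_def])
  then show "pd k e p = c k p * e p"
    using e_pos[OF p] by (simp add: pd_G_c[OF p] e_sq[OF p, symmetric])
qed

lemma c_deriv:
  assumes p: "p \<in> V" and j: "j \<noteq> k"
  shows "c j differentiable at p" "pd k (c j) p = c k p * c j p - (c j p)\<^sup>2 - lam k p * lam j p * G k p"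
proof -
  have Gn: "G j p \<noteq> 0" by (rule G_nz[OF VU[OF p]])
  show d: "c j differentiable at p"
    unfolding c_def[abs_def] using Gn by (intro differentiable_divide differentiable_mult diffs VU[OF p]) auto
  have "pd k (pd k (G j)) p = pd k (\<lambda>q. (2 * c j q) * G j q) p"
    by (rule pd_cong[OF V(1) p]) (rule pd_G_c)
  also have "\<dots> = 2 * c j p * pd k (G j) p + 2 * pd k (c j) p * G j p"
    by (simp add: pd_mult d differentiable_mult diffs VU[OF p])
  finally have "2 * G j p * pd k (c j) p = pd k (pd k (G j)) p - 2 * c j p * pd k (G j) p" by simp
  also have "\<dots> = 2 * G j p * (c k p * c j p - (c j p)\<^sup>2 - lam k p * lam j p * G k p)"
    unfolding gauss[OF p j] pd_G_c[OF p] by (simp add: algebra_simps power2_eq_square)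
  finally show "pd k (c j) p = c k p * c j p - (c j p)\<^sup>2 - lam k p * lam j p * G k p"
    using Gn by simp
qed

text \<open>Passing to arc length removes the term \<open>c k * c j\<close>, because
  \<open>e\<close> has logarithmic derivative \<open>c k\<close>; a Riccati equation with no
  reference to the metric remains.\<close>

lemma w_deriv:
  assumes p: "p \<in> V"
  shows "w j differentiable at p" "pd k (w j) p = e p * (- (w j p)\<^sup>2 - lam k p * l j p)"
proof -
  have ep: "e p \<noteq> 0" using e_pos[OF p] by simp
  show d: "w j differentiable at p"
    unfolding w_def[abs_def] using ep c_deriv(1)[OF p] e_deriv(1)[OF p]
    by (cases "j = k") (simp_all add: differentiable_divide)
  show "pd k (w j) p = e p * (- (w j p)\<^sup>2 - lam k p * l j p)"
  proof (cases "j = k")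
    case True then show ?thesis by (simp add: w_def[abs_def] l_def)
  next
    case False
    have "pd k (c j) p = pd k (\<lambda>q. w j q * e q) p"
      by (rule pd_cong[OF V(1) p]) (use e_pos False in \<open>force simp: w_def\<close>)
    also have "\<dots> = w j p * (c k p * e p) + pd k (w j) p * e p"
      by (simp add: pd_mult d e_deriv[OF p])
    finally have "pd k (w j) p * e p = c k p * c j p - (c j p)\<^sup>2 - lam k p * lam j p * (e p * e p) - w j p * (c k p * e p)"
      by (simp add: c_deriv(2)[OF p False] e_sq[OF p])
    moreover have "c j p = w j p * e p" using ep False by (simp add: w_def)
    ultimately have "pd k (w j) p * e p = (e p * (- (w j p)\<^sup>2 - lam k p * l j p)) * e p"
      using False by (simp add: l_def algebra_simps power2_eq_square)
    then show ?thesis using ep by simp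
  qed
qed

lemma l_deriv:
  assumes p: "p \<in> V"
  shows "l j differentiable at p" "pd k (l j) p = e p * ((lam k p - l j p) * w j p)"
proof -
  show "l j differentiable at p"
    unfolding l_def[abs_def] by (cases "j = k") (simp_all add: diffs VU[OF p])
  show "pd k (l j) p = e p * ((lam k p - l j p) * w j p)"
  proof (cases "j = k")
    case True then show ?thesis by (simp add: w_def l_def[abs_def])
  next
    case False
    then have "pd k (l j) p = pd k (lam j) p" by (simp add: l_def[abs_def])
    also have "\<dots> = (lam k p - lam j p) * c j p" using codazzi[OF VU[OF p] False] by (simp add: c_def)
    finally show ?thesis using False e_pos[OF p] by (simp add: w_def l_def)
  qed
qed

text \<open>The \<open>3\<close> arises by inserting \<open>n h = \<lambda>_k + \<Sum> l j\<close>
  into \<open>2 \<lambda>_k = - n h\<close>.\<close>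

lemma lam_k_eq: assumes p: "p \<in> V" shows "lam k p = - (\<Sum>j\<in>UNIV. l j p) / 3"
proof -
  have "(\<Sum>j\<in>UNIV. lam j p) = lam k p + (\<Sum>j\<in>UNIV - {k}. lam j p)" by (simp add: sum.remove)
  also have "(\<Sum>j\<in>UNIV - {k}. lam j p) = (\<Sum>j\<in>UNIV - {k}. l j p)" by (rule sum.cong) (auto simp: l_def)
  also have "\<dots> = (\<Sum>j\<in>UNIV. l j p)" by (simp add: sum.remove[of UNIV k "\<lambda>j. l j p"]) (simp add: l_def)
  finally show ?thesis using lam_k[OF p] by (simp add: h_def)
qed

lemma pd_lam_k_m: assumes p: "p \<in> V" shows "pd k (lam k) p = e p * m p"
proof -
  have "pd k (lam k) p = pd k (\<lambda>q. (-1/3) * (\<Sum>j\<in>UNIV. l j q)) p"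
    by (rule pd_cong[OF V(1) p]) (use lam_k_eq in simp)
  also have "\<dots> = (-1/3) * (\<Sum>j\<in>UNIV. pd k (l j) p)"
    by (subst pd_mult) (simp_all add: pd_sum l_deriv(1)[OF p] differentiable_sum)
  also have "\<dots> = e p * m p"
    unfolding l_deriv(2)[OF p] m_def by (simp add: sum_distrib_left[symmetric])
  finally show ?thesis .
qed

text \<open>Only the summand \<open>i = k\<close> of the normal equation survives, since
  \<open>h\<close> varies in no other direction, and \<open>h\<close> is a constant multiple of
  \<open>lam k\<close>.\<close>

lemma m_deriv:
  assumes p: "p \<in> V"
  shows "m differentiable at p"
    "pd k m p = e p * (((lam k p)\<^sup>2 + (\<Sum>j\<in>UNIV. (l j p)\<^sup>2)) * lam k p - (\<Sum>j\<in>UNIV. w j p) * m p)"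
proof -
  note pU = VU[OF p]
  show dm: "m differentiable at p"
    unfolding m_def[abs_def]
    by (intro differentiable_divide differentiable_minus differentiable_sum ballI differentiable_mult
        differentiable_diff diffs pU l_deriv(1)[OF p] w_deriv(1)[OF p]) auto
  define n where "n = real CARD('n)"
  have n: "0 < n" by (simp add: n_def)
  have ep: "0 < e p" by (rule e_pos[OF p])
  have dSe: "(\<lambda>q. S q / e q) differentiable at p"
    using ep by (intro differentiable_divide S_deriv pU e_deriv(1)[OF p]) auto
  \<comment> \<open>\<open>S / e\<close> is the product of the \<open>sqrt (G j)\<close> with
    \<open>j \<noteq> k\<close>, so its logarithmic derivative is \<open>e\<close> times the sum of
    the \<open>w j\<close>.\<close>
  have pd_Se: "pd k (\<lambda>q. S q / e q) p = S p * (\<Sum>j\<in>UNIV. w j p)"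
  proof -
    have "pd k S p = pd k (\<lambda>q. S q / e q * e q) p"
      by (rule pd_cong[OF V(1) p]) (use e_pos in force)
    also have "\<dots> = S p / e p * (c k p * e p) + pd k (\<lambda>q. S q / e q) p * e p"
      by (simp only: pd_mult[OF dSe e_deriv(1)[OF p]] e_deriv(2)[OF p])
    finally have "pd k (\<lambda>q. S q / e q) p * e p = pd k S p - S p * c k p" using ep by simp
    also have "pd k S p = S p * (\<Sum>j\<in>UNIV. c j p)" using S_deriv(1)[OF pU, of k] by (simp add: c_def)
    also have "(\<Sum>j\<in>UNIV. c j p) = c k p + (\<Sum>j\<in>UNIV - {k}. c j p)" by (simp add: sum.remove)
    also have "(\<Sum>j\<in>UNIV - {k}. c j p) = (\<Sum>j\<in>UNIV - {k}. e p * w j p)"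
      by (rule sum.cong) (use ep in \<open>auto simp: w_def\<close>)
    also have "\<dots> = e p * (\<Sum>j\<in>UNIV. w j p)"
    proof -
      have "(\<Sum>j\<in>UNIV. w j p) = w k p + (\<Sum>j\<in>UNIV - {k}. w j p)" by (simp add: sum.remove)
      moreover have "w k p = 0" by (simp add: w_def)
      ultimately show ?thesis by (simp add: sum_distrib_left)
    qed
    finally have "pd k (\<lambda>q. S q / e q) p * e p = (S p * (\<Sum>j\<in>UNIV. w j p)) * e p"
      by (simp add: algebra_simps)
    then show ?thesis using ep by simp
  qed
  have "(\<Sum>i\<in>UNIV. pd i (\<lambda>q. S q / G i q * pd i h q) p) = (\<Sum>i\<in>UNIV. if i = k then pd k (\<lambda>q. S q / G k q * pd k h q) p else 0)"
  proof (rule sum.cong[OF refl])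
    fix i
    have "pd i (\<lambda>q. S q / G i q * pd i h q) p = 0" if "i \<noteq> k"
    proof -
      have "pd i (\<lambda>q. S q / G i q * pd i h q) p = pd i (\<lambda>q. 0) p"
        by (rule pd_cong[OF V(1) p]) (use pd_h_other that in simp)
      then show ?thesis by simp
    qed
    then show "pd i (\<lambda>q. S q / G i q * pd i h q) p = (if i = k then pd k (\<lambda>q. S q / G k q * pd k h q) p else 0)"
      by simp
  qed
  then have "pd k (\<lambda>q. S q / G k q * pd k h q) p = S p * h p * (\<Sum>i\<in>UNIV. (lam i p)\<^sup>2)"
    using normal_equation[OF pU] by simp
  also have "pd k (\<lambda>q. S q / G k q * pd k h q) p = pd k (\<lambda>q. (- 2 / n) * (S q / e q * m q)) p"
  proof (rule pd_cong[OF V(1) p])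
    fix q assume q: "q \<in> V"
    have "pd k h q = (- 2 / n) * (e q * m q)"
      using pd_lam_k[OF q, of k] pd_lam_k_m[OF q] n by (simp add: n_def field_simps)
    then show "S q / G k q * pd k h q = (- 2 / n) * (S q / e q * m q)"
      using e_pos[OF q] by (simp only: e_sq[OF q, symmetric]) (simp add: mult_ac)
  qed
  also have "\<dots> = (- 2 / n) * pd k (\<lambda>q. S q / e q * m q) p"
    by (simp only: pd_mult[OF differentiable_const differentiable_mult[OF dSe dm]] pd_const mult_zero_left add_0_right)
  also have "pd k (\<lambda>q. S q / e q * m q) p = S p / e p * pd k m p + S p * (\<Sum>j\<in>UNIV. w j p) * m p"
    by (simp only: pd_mult[OF dSe dm] pd_Se)
  also have "h p = (- 2 / n) * lam k p" using lam_k[OF p] n by (simp add: n_def field_simps)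
  finally have "(- 2 / n) * (S p / e p * pd k m p + S p * (\<Sum>j\<in>UNIV. w j p) * m p)
      = (- 2 / n) * (S p * lam k p * (\<Sum>i\<in>UNIV. (lam i p)\<^sup>2))" by (simp add: mult_ac)
  then have "S p / e p * pd k m p + S p * (\<Sum>j\<in>UNIV. w j p) * m p = S p * lam k p * (\<Sum>i\<in>UNIV. (lam i p)\<^sup>2)"
    using n by simp
  then have "S p * (pd k m p + e p * (\<Sum>j\<in>UNIV. w j p) * m p) = S p * (e p * (lam k p * (\<Sum>i\<in>UNIV. (lam i p)\<^sup>2)))"
    using ep by (simp add: field_simps)
  then have "pd k m p + e p * (\<Sum>j\<in>UNIV. w j p) * m p = e p * (lam k p * (\<Sum>i\<in>UNIV. (lam i p)\<^sup>2))"
    using S_pos[OF pU] by simp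
  moreover have "(\<Sum>i\<in>UNIV. (lam i p)\<^sup>2) = (lam k p)\<^sup>2 + (\<Sum>j\<in>UNIV. (l j p)\<^sup>2)"
  proof -
    have "(\<Sum>i\<in>UNIV. (lam i p)\<^sup>2) = (lam k p)\<^sup>2 + (\<Sum>i\<in>UNIV - {k}. (lam i p)\<^sup>2)" by (simp add: sum.remove)
    also have "(\<Sum>i\<in>UNIV - {k}. (lam i p)\<^sup>2) = (\<Sum>i\<in>UNIV - {k}. (l i p)\<^sup>2)"
      by (rule sum.cong) (auto simp: l_def)
    also have "\<dots> = (\<Sum>i\<in>UNIV. (l i p)\<^sup>2)"
      by (simp add: sum.remove[of UNIV k "\<lambda>j. (l j p)\<^sup>2"]) (simp add: l_def)
    finally show ?thesis .
  qed
  ultimately show "pd k m p = e p * (((lam k p)\<^sup>2 + (\<Sum>j\<in>UNIV. (l j p)\<^sup>2)) * lam k p - (\<Sum>j\<in>UNIV. w j p) * m p)"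
    by (simp add: algebra_simps)
qed

text \<open>Rigidity on a segment of a \<open>k\<close>-line makes \<open>lam k\<close> or its
  arc-length derivative vanish; both are nonzero multiples of quantities without zeros on
  \<open>V\<close>.\<close>

lemma no_such_direction: "V = {}"
proof (rule ccontr)
  assume "V \<noteq> {}"
  then obtain p where p: "p \<in> V" by blast
  obtain d where d: "0 < d" "ball p d \<subseteq> V" using V(1) p open_contains_ball by blast
  define \<gamma> where "\<gamma> t = p + t *\<^sub>R axis k 1" for t :: real
  have \<gamma>V: "\<gamma> t \<in> V" if "t \<in> {-d<..<d}" for t
    using that by (intro subsetD[OF d(2)]) (auto simp: \<gamma>_def dist_norm)
  have deriv: "((\<lambda>t. f (\<gamma> t)) has_real_derivative pd k f (\<gamma> t)) (at t)"
    if "\<And>q. q \<in> V \<Longrightarrow> f differentiable at q" "t \<in> {-d<..<d}" for f t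
    using line_derivative_real[of f p t k UNIV] that(1)[OF \<gamma>V[OF that(2)]] by (simp add: \<gamma>_def)
  have "lam k (\<gamma> 0) = 0 \<or> m (\<gamma> 0) = 0"
  proof (rule quadratic_system_rigidity[where l = "\<lambda>j t. l j (\<gamma> t)" and w = "\<lambda>j t. w j (\<gamma> t)" and e = "\<lambda>t. e (\<gamma> t)"
        and L = "\<lambda>t. lam k (\<gamma> t)" and m = "\<lambda>t. m (\<gamma> t)" and a = "-d" and b = d])
    fix t assume t: "t \<in> {-d<..<d}"
    show "e (\<gamma> t) \<noteq> 0" using e_pos[OF \<gamma>V[OF t]] by simp
    show "((\<lambda>t. l j (\<gamma> t)) has_real_derivative e (\<gamma> t) * ((lam k (\<gamma> t) - l j (\<gamma> t)) * w j (\<gamma> t))) (at t)" for j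
      using deriv[OF l_deriv(1) t, of j] by (simp only: l_deriv(2)[OF \<gamma>V[OF t]])
    show "((\<lambda>t. w j (\<gamma> t)) has_real_derivative e (\<gamma> t) * (- (w j (\<gamma> t))\<^sup>2 - lam k (\<gamma> t) * l j (\<gamma> t))) (at t)" for j
      using deriv[OF w_deriv(1) t, of j] by (simp only: w_deriv(2)[OF \<gamma>V[OF t]])
    show "((\<lambda>t. m (\<gamma> t)) has_real_derivative e (\<gamma> t) * (((lam k (\<gamma> t))\<^sup>2 + (\<Sum>j\<in>UNIV. (l j (\<gamma> t))\<^sup>2)) * lam k (\<gamma> t)
        - (\<Sum>j\<in>UNIV. w j (\<gamma> t)) * m (\<gamma> t))) (at t)"
      using deriv[OF m_deriv(1) t] by (simp only: m_deriv(2)[OF \<gamma>V[OF t]])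
    show "lam k (\<gamma> t) = - (\<Sum>j\<in>UNIV. l j (\<gamma> t)) / 3" by (rule lam_k_eq[OF \<gamma>V[OF t]])
    show "m (\<gamma> t) = - (\<Sum>j\<in>UNIV. (lam k (\<gamma> t) - l j (\<gamma> t)) * w j (\<gamma> t)) / 3" by (simp add: m_def)
  next
    show "(0::real) \<in> {-d<..<d}" using d by simp
  qed
  then have "lam k p = 0 \<or> m p = 0" by (simp add: \<gamma>_def)
  moreover have "lam k p \<noteq> 0" using lam_k[OF p] h_nz[OF p] by simp
  moreover have "m p \<noteq> 0" using pd_lam_k_m[OF p] pd_lam_k[OF p, of k] pd_h_nz[OF p] by auto
  ultimately show False by blast
qed

end

text \<open>Where \<open>h\<close> is not zero, all its partial derivatives vanish by the preceding
  result, so the normal equation reduces to \<open>h |A|^2 = 0\<close>. Then every principal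
  curvature is zero, and so is their mean.\<close>

lemma (in biharmonic_chart) h_zero:
  assumes p: "p \<in> U" shows "h p = 0"
proof (rule ccontr)
  assume hp: "h p \<noteq> 0"
  have op: "open {q \<in> A. f q \<noteq> 0}" if "open A" "A \<subseteq> U" "smooth_on U f" for A and f :: "_ \<Rightarrow> real"
  proof -
    have "open (A \<inter> f -` (- {0}))"
      by (rule continuous_open_preimage[OF continuous_on_subset[OF smooth_on_continuous[OF that(3)] that(2)] that(1)]) auto
    moreover have "A \<inter> f -` (- {0}) = {q \<in> A. f q \<noteq> 0}" by auto
    ultimately show ?thesis by simp
  qed
  define V where "V = {q \<in> U. h q \<noteq> 0}"
  have V: "open V" "V \<subseteq> U" "p \<in> V" using op[OF U _ smooth_h] p hp by (auto simp: V_def)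
  have "pd k h q = 0" if "q \<in> V" for q k
  proof (rule ccontr)
    assume nz: "pd k h q \<noteq> 0"
    interpret biharmonic_chart_direction U X N "{q \<in> V. pd k h q \<noteq> 0}" k
      by unfold_locales (use op[OF V(1,2) smooth_on_pd[OF smooth_h]] V(2) in \<open>auto simp: V_def\<close>)
    show False using no_such_direction that nz by blast
  qed
  then have "pd i (\<lambda>q. S q / G i q * pd i h q) p = pd i (\<lambda>q. 0) p" for i
    by (intro pd_cong[OF V(1,3)]) simp
  then have "S p * h p * (\<Sum>i\<in>UNIV. (lam i p)\<^sup>2) = 0" using normal_equation[OF p] by simp
  then have "(\<Sum>i\<in>UNIV. (lam i p)\<^sup>2) = 0" using S_pos[OF p] hp by simp
  then have "lam i p = 0" for i by (simp add: sum_nonneg_eq_0_iff)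
  then show False using hp by (simp add: h_def)
qed

section \<open>Independence of the chart\<close>

text \<open>A transition map between two charts is at first only continuous. A left inverse
  \<open>g\<close> of \<open>D'\<close> makes \<open>g \<circ> X'\<close> tangent to a translation
  at \<open>\<tau> p\<close>, and composing with \<tau> gives the known differentiable map
  \<open>g \<circ> X\<close>.\<close>

lemma differentiable_through_immersion:
  fixes X' :: "'b::euclidean_space \<Rightarrow> 'e::euclidean_space" and \<tau> :: "'a::real_normed_vector \<Rightarrow> 'b"
  assumes X': "(X' has_derivative D') (at (\<tau> p))" "inj D'" and X: "(X has_derivative D) (at p)"
    and \<tau>: "isCont \<tau> p" and W: "open W" "p \<in> W" "\<And>x. x \<in> W \<Longrightarrow> X' (\<tau> x) = X x"
  shows "\<exists>T. (\<tau> has_derivative T) (at p)"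
proof -
  have lD': "linear D'" using X'(1) by (rule has_derivative_linear)
  obtain g where g: "linear g" "g \<circ> D' = id" using linear_injective_left_inverse[OF lD' X'(2)] by blast
  have bg: "bounded_linear g" using g(1) by (simp add: linear_conv_bounded_linear)
  define T where "T = (\<lambda>v. g (D v))"
  have G: "((\<lambda>y. g (X' y)) has_derivative (\<lambda>v. v)) (at (\<tau> p))"
    using bounded_linear.has_derivative[OF bg X'(1)] g(2) by (simp add: fun_eq_iff)
  have GX: "((\<lambda>x. g (X x)) has_derivative T) (at p)"
    unfolding T_def by (rule bounded_linear.has_derivative[OF bg X])
  then have bT: "bounded_linear T" by (rule has_derivative_bounded_linear)
  obtain B where B: "0 < B" "\<And>v. norm (T v) \<le> norm v * B" using bounded_linear.pos_bounded[OF bT] by blast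
  have near: "\<exists>d>0. \<forall>x. norm (x - p) < d \<longrightarrow> norm (\<tau> x - \<tau> p - (g (X x) - g (X p))) \<le> e * norm (\<tau> x - \<tau> p)"
    if "0 < e" for e
  proof -
    obtain d1 where d1: "0 < d1" "\<And>y. norm (y - \<tau> p) < d1 \<Longrightarrow> norm (g (X' y) - g (X' (\<tau> p)) - (y - \<tau> p)) \<le> e * norm (y - \<tau> p)"
      using G \<open>0 < e\<close> unfolding has_derivative_at_alt by blast
    obtain d2 where d2: "0 < d2" "\<And>x. dist x p < d2 \<Longrightarrow> dist (\<tau> x) (\<tau> p) < d1"
      using \<tau>[unfolded continuous_at_eps_delta, rule_format, OF d1(1)] by auto
    obtain d3 where d3: "0 < d3" "ball p d3 \<subseteq> W" using W open_contains_ball by blast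
    have "norm (\<tau> x - \<tau> p - (g (X x) - g (X p))) \<le> e * norm (\<tau> x - \<tau> p)" if x: "norm (x - p) < min d2 d3" for x
    proof -
      have "x \<in> W" using x d3 by (auto simp: dist_norm norm_minus_commute)
      then have eq: "X' (\<tau> x) = X x" "X' (\<tau> p) = X p" using W by auto
      have "norm (\<tau> x - \<tau> p) < d1" using d2(2)[of x] x by (simp add: dist_norm)
      from d1(2)[OF this] show ?thesis unfolding eq by (simp add: norm_minus_commute)
    qed
    then show ?thesis using d2 d3 by (intro exI[of _ "min d2 d3"]) auto
  qed
  have "(\<tau> has_derivative T) (at p)"
    unfolding has_derivative_at_alt
  proof (intro conjI bT allI impI)
    fix e :: real assume e: "0 < e"
    define C where "C = 2 * (B + 1)"
    have C: "0 < C" using B by (simp add: C_def)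
    \<comment> \<open>The factor \<open>1/2\<close> lets the error be absorbed and gives the
      Lipschitz bound with \<open>C\<close>; only with this bound does the sharper factor
      \<open>e / (2 * C)\<close> become small relative to \<open>norm (x - p)\<close>.\<close>
    obtain d1 where d1: "0 < d1" "\<And>x. norm (x - p) < d1 \<Longrightarrow> norm (\<tau> x - \<tau> p - (g (X x) - g (X p))) \<le> 1/2 * norm (\<tau> x - \<tau> p)"
      using near[of "1/2"] by auto
    obtain d2 where d2: "0 < d2" "\<And>x. norm (x - p) < d2 \<Longrightarrow> norm (\<tau> x - \<tau> p - (g (X x) - g (X p))) \<le> e / (2 * C) * norm (\<tau> x - \<tau> p)"
      using near[of "e / (2 * C)"] e C by auto
    obtain d3 where d3: "0 < d3" "\<And>x. norm (x - p) < d3 \<Longrightarrow> norm (g (X x) - g (X p) - T (x - p)) \<le> min 1 (e/2) * norm (x - p)"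
      using GX[unfolded has_derivative_at_alt] e by (metis half_gt_zero min_less_iff_conj zero_less_one)
    have "norm (\<tau> x - \<tau> p - T (x - p)) \<le> e * norm (x - p)" if x: "norm (x - p) < min d1 (min d2 d3)" for x
    proof -
      define a b where "a = \<tau> x - \<tau> p" and "b = g (X x) - g (X p)"
      have 1: "norm (a - b) \<le> 1/2 * norm a" "norm (a - b) \<le> e / (2 * C) * norm a"
        using d1(2)[of x] d2(2)[of x] x by (auto simp: a_def b_def)
      have bT: "norm (b - T (x - p)) \<le> min 1 (e/2) * norm (x - p)" using d3(2)[of x] x by (simp add: b_def)
      have m: "min 1 (e/2) * norm (x - p) \<le> 1 * norm (x - p)" "min 1 (e/2) * norm (x - p) \<le> e/2 * norm (x - p)"
        by (intro mult_right_mono; simp)+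
      have "norm b \<le> norm (T (x - p)) + norm (b - T (x - p))"
        using norm_triangle_ineq[of "T (x - p)" "b - T (x - p)"] by simp
      then have "norm b \<le> (B + 1) * norm (x - p)" using B(2)[of "x - p"] bT m(1) by (simp add: algebra_simps)
      moreover have "norm a \<le> norm b + norm (a - b)" using norm_triangle_ineq[of b "a - b"] by simp
      moreover have "C * norm (x - p) = 2 * ((B + 1) * norm (x - p))" by (simp add: C_def)
      ultimately have "norm a \<le> C * norm (x - p)" using 1(1) by linarith
      then have "e / (2 * C) * norm a \<le> e / (2 * C) * (C * norm (x - p))" using e C by (intro mult_left_mono) auto
      also have "\<dots> = e / 2 * norm (x - p)" using C by simp
      finally have "norm (a - b) \<le> e / 2 * norm (x - p)" using 1(2) by simp
      moreover have "norm (a - T (x - p)) \<le> norm (a - b) + norm (b - T (x - p))"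
        using norm_triangle_ineq[of "a - b" "b - T (x - p)"] by simp
      ultimately have "norm (a - T (x - p)) \<le> e / 2 * norm (x - p) + e / 2 * norm (x - p)"
        using bT m(2) by linarith
      then show ?thesis by (simp add: a_def)
    qed
    then show "\<exists>d>0. \<forall>y. norm (y - p) < d \<longrightarrow> norm (\<tau> y - \<tau> p - T (y - p)) \<le> e * norm (y - p)"
      using d1(1) d2(1) d3(1) by (intro exI[of _ "min d1 (min d2 d3)"]) auto
  qed
  then show ?thesis by blast
qed

text \<open>\<open>T\<close> will be the differential of a transition map and \<open>s\<close> the
  sign relating the two unit normals.\<close>

lemma trace_matrix_conjugate:
  fixes A A' T :: "real^'n::finite \<Rightarrow> real^'n"
  assumes lin: "linear A" "linear A'" "linear T" and T: "inj T" and eq: "\<And>v. T (A v) = s *\<^sub>R A' (T v)"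
  shows "trace (matrix A) = s * trace (matrix A')"
proof -
  obtain Ti where Ti: "linear Ti" "\<And>v. Ti (T v) = v" "\<And>v. T (Ti v) = v"
    using linear_injective_isomorphism[OF lin(3) T] by blast
  define B where "B = (\<lambda>v. s *\<^sub>R A' v)"
  have B: "linear B" unfolding B_def using lin(2) by (rule linear_compose_scale_right)
  have BT: "linear (B \<circ> T)" by (rule linear_compose[OF lin(3) B])
  have "A = Ti \<circ> (B \<circ> T)"
  proof
    fix v
    have "Ti (T (A v)) = Ti (B (T v))" by (simp only: eq B_def)
    then show "A v = (Ti \<circ> (B \<circ> T)) v" using Ti(2) by simp
  qed
  then have "trace (matrix A) = trace (matrix Ti ** matrix (B \<circ> T))" by (simp add: matrix_compose[OF BT Ti(1)])
  also have "\<dots> = trace (matrix (B \<circ> T) ** matrix Ti)" by (rule trace_mul_sym)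
  also have "matrix (B \<circ> T) ** matrix Ti = matrix ((B \<circ> T) \<circ> Ti)" by (rule matrix_compose[OF Ti(1) BT, symmetric])
  also have "(B \<circ> T) \<circ> Ti = B" using Ti(3) by auto
  finally show ?thesis by (simp add: trace_def matrix_def B_def sum_distrib_left)
qed

text \<open>Both normals are orthogonal to the same tangent hyperplane, hence differ by a sign. The
  sign is continuous and so locally constant; the shape operators are therefore conjugate up to that
  sign.\<close>

lemma mean_curvature_transition:
  fixes X X' :: "real^'n::finite \<Rightarrow> 'e::euclidean_space"
  assumes c: "unit_normal_chart U X N" and c': "unit_normal_chart U' X' N'"
    and W: "open W" "p \<in> W" "W \<subseteq> U" and \<tau>: "continuous_on W \<tau>" "\<And>x. x \<in> W \<Longrightarrow> \<tau> x \<in> U'"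
      "\<And>x. x \<in> W \<Longrightarrow> X' (\<tau> x) = X x"
    and zero: "mean_curvature X' N' (\<tau> p) = 0"
  shows "mean_curvature X N p = 0"
proof -
  interpret c: unit_normal_chart U X N by (rule c)
  interpret c': unit_normal_chart U' X' N' by (rule c')
  have \<tau>_cont: "isCont \<tau> x" if "x \<in> W" for x
    using \<tau>(1) W(1) that by (simp add: continuous_on_eq_continuous_at)
  have D: "(X has_derivative frechet_derivative X (at x)) (at x)" if "x \<in> W" for x
    using c.dX that W(3) by (intro differentiable_has_derivative) blast
  have D': "(X' has_derivative frechet_derivative X' (at (\<tau> x))) (at (\<tau> x))" if "x \<in> W" for x
    using c'.dX \<tau>(2)[OF that] by (intro differentiable_has_derivative) blast
  have "\<exists>T. (\<tau> has_derivative T) (at x)" if "x \<in> W" for x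
    using differentiable_through_immersion[OF D'[OF that] c'.inj_X[OF \<tau>(2)[OF that]] D[OF that] \<tau>_cont[OF that] W(1) that \<tau>(3)] .
  then obtain T where T: "\<And>x. x \<in> W \<Longrightarrow> (\<tau> has_derivative T x) (at x)" by metis
  have DT: "frechet_derivative X (at x) v = frechet_derivative X' (at (\<tau> x)) (T x v)" if x: "x \<in> W" for x v
  proof -
    have "((\<lambda>x. X' (\<tau> x)) has_derivative (\<lambda>v. frechet_derivative X' (at (\<tau> x)) (T x v))) (at x)"
      by (rule has_derivative_compose[OF T[OF x] D'[OF x]])
    then have "(X has_derivative (\<lambda>v. frechet_derivative X' (at (\<tau> x)) (T x v))) (at x)"
      using has_derivative_cong_open[OF W(1) x, of "\<lambda>x. X' (\<tau> x)" X] \<tau>(3) by blast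
    then show ?thesis by (rule frechet_derivative_eqI)
  qed
  define s where "s x = N x \<bullet> N' (\<tau> x)" for x
  have N': "N' (\<tau> x) = s x *\<^sub>R N x" if x: "x \<in> W" for x
  proof -
    have xU: "x \<in> U" using W x by blast
    define z where "z = N' (\<tau> x) - s x *\<^sub>R N x"
    have Nz: "N x \<bullet> z = 0" using c.norm_N[OF xU] by (simp add: z_def s_def inner_diff_right norm_eq_1)
    then have "z \<in> range (frechet_derivative X (at x))" using c.range_frechet[OF xU] by simp
    then have "N' (\<tau> x) \<bullet> z = 0" using DT[OF x] c'.N_frechet[OF \<tau>(2)[OF x]] by auto
    then have "z \<bullet> z = 0" using Nz by (simp add: z_def inner_diff_left)
    then show ?thesis by (simp add: z_def)
  qed
  have s_sq: "s x * s x = 1" if x: "x \<in> W" for x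
  proof -
    have "norm (N' (\<tau> x)) = \<bar>s x\<bar>" using N'[OF x] c.norm_N[of x] W(3) x by auto
    then have "\<bar>s x\<bar> = 1" using c'.norm_N[OF \<tau>(2)[OF x]] by simp
    then show ?thesis by (metis abs_mult_self_eq mult_1)
  qed
  have pU: "p \<in> U" and qU: "\<tau> p \<in> U'" using W \<tau> by auto
  have "isCont s p"
    unfolding s_def
    by (intro isCont_inner isCont_o2[OF \<tau>_cont[OF W(2)]] differentiable_imp_continuous_within c.dN c'.dN pU qU)
  \<comment> \<open>Distance \<open>1\<close> suffices, because the possible values \<open>1\<close>
    and \<open>-1\<close> of \<open>s\<close> are \<open>2\<close> apart.\<close>
  then obtain d where d: "0 < d" "\<And>x. dist x p < d \<Longrightarrow> dist (s x) (s p) < 1"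
    unfolding continuous_at_eps_delta using zero_less_one by blast
  have s_eq: "s x = s p" if x: "x \<in> W \<inter> ball p d" for x
  proof -
    have "\<bar>s x - s p\<bar> < 1" using d(2)[of x] x by (simp add: dist_commute dist_real_def)
    moreover have "(s x - 1) * (s x + 1) = 0" "(s p - 1) * (s p + 1) = 0"
      using s_sq[of x] s_sq[OF W(2)] x by (simp_all add: algebra_simps)
    then have "s x = 1 \<or> s x = -1" "s p = 1 \<or> s p = -1" by auto
    ultimately show ?thesis by auto
  qed
  have "(N has_derivative (\<lambda>v. s p *\<^sub>R frechet_derivative N' (at (\<tau> p)) (T p v))) (at p)"
  proof -
    have "((\<lambda>x. s p *\<^sub>R N' (\<tau> x)) has_derivative (\<lambda>v. s p *\<^sub>R frechet_derivative N' (at (\<tau> p)) (T p v))) (at p)"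
      by (intro has_derivative_scaleR_right has_derivative_compose[OF T[OF W(2)]]
          differentiable_has_derivative c'.dN qU)
    moreover have "s p *\<^sub>R N' (\<tau> x) = N x" if "x \<in> W \<inter> ball p d" for x
      using N'[of x] s_eq[OF that] s_sq[OF W(2)] that by simp
    ultimately show ?thesis
      using has_derivative_cong_open[of "W \<inter> ball p d" p "\<lambda>x. s p *\<^sub>R N' (\<tau> x)" N] W d by auto
  qed
  then have NT: "frechet_derivative N (at p) v = s p *\<^sub>R frechet_derivative N' (at (\<tau> p)) (T p v)" for v
    by (rule frechet_derivative_eqI)
  have TA: "T p (shape_operator X N p v) = s p *\<^sub>R shape_operator X' N' (\<tau> p) (T p v)" for v
  proof -
    have lin: "linear (frechet_derivative X' (at (\<tau> p)))" by (rule linear_frechet_derivative[OF c'.dX[OF qU]])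
    have "frechet_derivative X' (at (\<tau> p)) (T p (shape_operator X N p v))
        = frechet_derivative X' (at (\<tau> p)) (s p *\<^sub>R shape_operator X' N' (\<tau> p) (T p v))"
      unfolding DT[OF W(2), symmetric] c.frechet_shape_operator[OF pU] linear_cmul[OF lin]
        c'.frechet_shape_operator[OF qU] NT by simp
    then show ?thesis using c'.inj_X[OF qU] by (rule injD[rotated])
  qed
  have "inj (T p)"
    using c.inj_X[OF pU] DT[OF W(2)] by (metis injD injI)
  then have "trace (matrix (shape_operator X N p)) = s p * trace (matrix (shape_operator X' N' (\<tau> p)))"
    by (intro trace_matrix_conjugate[OF c.linear_shape_operator[OF pU] c'.linear_shape_operator[OF qU]
          has_derivative_linear[OF T[OF W(2)]]] TA)
  then show ?thesis using zero by (simp add: mean_curvature_def)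
qed

lemma unit_normal_chartI:
  assumes "hypersurface TYPE('n::finite) M F" "local_param M F U \<phi>" "unit_normal_on (U :: (real^'n) set) (F \<circ> \<phi>) N"
  shows "unit_normal_chart U (F \<circ> \<phi>) N"
  using assms by unfold_locales (auto simp: hypersurface_def local_param_def unit_normal_on_def)

theorem theorem2:
  fixes M :: "'m::{t2_space,second_countable_topology} set"
    and F :: "'m \<Rightarrow> 'e::euclidean_space"
  assumes "hypersurface TYPE('n::finite) M F"
    and "holonomic TYPE('n) M F"
    and "biharmonic TYPE('n) M F"
  shows "minimal TYPE('n) M F"
  unfolding minimal_def
proof (intro allI impI ballI)
  fix U :: "(real^'n) set" and \<phi> N p
  assume lp: "local_param M F U \<phi>" and un: "unit_normal_on U (F \<circ> \<phi>) N" and p: "p \<in> U"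
  obtain \<psi> where U: "open U" and oM: "openin (top_of_set M) (\<phi> ` U)" and hom: "homeomorphism U (\<phi> ` U) \<phi> \<psi>"
    using lp unfolding local_param_def by blast
  have sub: "\<phi> ` U \<subseteq> M" using oM openin_imp_subset by blast
  then have "\<phi> p \<in> M" using p by blast
  then obtain U' :: "(real^'n) set" and \<phi>' N' where lp': "local_param M F U' \<phi>'" and m: "\<phi> p \<in> \<phi>' ` U'"
    and un': "unit_normal_on U' (F \<circ> \<phi>') N'"
    and diag: "\<And>p i j. p \<in> U' \<Longrightarrow> i \<noteq> j \<Longrightarrow>
           first_form (F \<circ> \<phi>') p $ i $ j = 0 \<and> second_form (F \<circ> \<phi>') N' p $ i $ j = 0"
    using assms(2) unfolding holonomic_def by metis
  have c: "unit_normal_chart U (F \<circ> \<phi>) N" and c': "unit_normal_chart U' (F \<circ> \<phi>') N'"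
    using assms(1) lp un lp' un' by (auto intro: unit_normal_chartI)
  interpret c': unit_normal_chart U' "F \<circ> \<phi>'" N' by (rule c')
  interpret c': biharmonic_chart U' "F \<circ> \<phi>'" N'
    by unfold_locales (use diag assms(3) lp' un' in \<open>auto simp: biharmonic_def\<close>)
  obtain \<psi>' where oM': "openin (top_of_set M) (\<phi>' ` U')" and hom': "homeomorphism U' (\<phi>' ` U') \<phi>' \<psi>'"
    using lp' unfolding local_param_def by blast
  \<comment> \<open>The overlap of the given chart with the curvature line chart. On it
    \<open>\<psi>' \<circ> \<phi>\<close> is the transition map that carries the vanishing of the
    mean curvature back to the given chart.\<close>
  define W where "W = U \<inter> \<phi> -` (\<phi>' ` U')"
  have "openin (top_of_set U) W"
    unfolding W_def
    by (rule continuous_openin_preimage[OF homeomorphism_cont1[OF hom] _ oM']) (use sub in auto)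
  then have W: "open W" "p \<in> W" "W \<subseteq> U" using U p m by (auto simp: W_def openin_open_eq)
  show "mean_curvature (F \<circ> \<phi>) N p = 0"
  proof (rule mean_curvature_transition[OF c c' W, where \<tau> = "\<lambda>x. \<psi>' (\<phi> x)"])
    show "continuous_on W (\<lambda>x. \<psi>' (\<phi> x))"
      by (rule continuous_on_compose2[OF homeomorphism_cont2[OF hom'] continuous_on_subset[OF homeomorphism_cont1[OF hom] W(3)]])
        (auto simp: W_def)
    have *: "\<psi>' (\<phi> x) \<in> U' \<and> \<phi>' (\<psi>' (\<phi> x)) = \<phi> x" if "x \<in> W" for x
      using that hom' unfolding W_def homeomorphism_def by auto
    show "\<psi>' (\<phi> x) \<in> U'" "(F \<circ> \<phi>') (\<psi>' (\<phi> x)) = (F \<circ> \<phi>) x" if "x \<in> W" for x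
      using *[OF that] by auto
    show "mean_curvature (F \<circ> \<phi>') N' (\<psi>' (\<phi> p)) = 0"
      using *[OF W(2)] by (simp add: c'.mean_curvature_eq c'.h_zero)
  qed
qed

end
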